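(* (i) Let $F\not\equiv 0$ be a real entire function of order at most one satisfying $F(-u)=F(u)$, and assume $\mathcal Z(F)\subseteq S_{\sqrt{15/28}}$. Then $$C_{F,n}^{-}\preceq C_{F,n+1}^{-}\qquad\text{for every integer } n\ge 0.$$ The strip constant is optimal uniformly in $n$: for every $\varepsilon>0$ there is an even (nonzero) polynomial $F$ with real coefficients and all zeros in $S_{\sqrt{15/28}+\varepsilon}$ for which $C_{F,1}^{-}\preceq C_{F,2}^{-}$ fails. (ii) Let $G\not\equiv 0$ be a real entire function of order at most one satisfying $G(-u)=-G(u)$, and assume $\mathcal Z(G)\subseteq S_1$. Then $$C_{G,n}^{+}\preceq C_{G,n+1}^{+}\qquad\text{for every integer } n\ge 0.$$
   Context: A polynomial or entire function $H$ is called real if $H(\overline u)=\overline{H(u)}$. $\mathcal Z(H)$ is the zero set of $H$ (without multiplicity), and $S_h=\{u\in\mathbb C: |\operatorname{Re} u|\le h\}$. Centered binomial sample: for an integer $d\ge 0$, $B_d[H](z)=\sum_{j=0}^d\binom dj H\!\left(j-\tfrac d2\right)z^j$. Quotients: if $F$ is real and even, $B_{2n+1}[F]$ is reciprocal with a forced zero at $z=-1$; $C_{F,n}^{-}$ is the unique real polynomial with $$B_{2n+1}[F](z)=z^n(z+1)\,C_{F,n}^{-}(z+z^{-1}).$$ If $G$ is real and odd, $B_{2n+1}[G]$ is anti-reciprocal with a forced zero at $z=1$; $C_{G,n}^{+}$ is the unique real polynomial with $$B_{2n+1}[G](z)=z^n(z-1)\,C_{G,n}^{+}(z+z^{-1}).$$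 Weak Obreschkoff relation: for real polynomials $A,B$, write $A\preceq B$ if every nonzero polynomial of the form $B+tA$, $t\in\mathbb R$, has only real zeros (nonzero constants count as real-rooted). Conventions: $0\preceq 0$, and $0\preceq B$ and $B\preceq 0$ for every nonzero real-rooted polynomial $B$. *)

theory Defs
  imports "HOL-Complex_Analysis.Complex_Analysis" "HOL-Library.Landau_Symbols"
begin

definition real_fun :: "(complex \<Rightarrow> complex) \<Rightarrow> bool" where
  "real_fun H \<longleftrightarrow> (\<forall>u. H (cnj u) = cnj (H u))"

definition zero_set :: "(complex \<Rightarrow> complex) \<Rightarrow> complex set" where
  "zero_set H = {u. H u = 0}"

definition strip :: "real \<Rightarrow> complex set" where
  "strip h = {u. \<bar>Re u\<bar> \<le> h}"

(* The order of an entire function; it is \<infinity> if the set of admissible exponents is empty. *)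
definition entire_order :: "(complex \<Rightarrow> complex) \<Rightarrow> ereal" where
  "entire_order H =
     Inf {ereal \<rho> | \<rho>. 0 \<le> \<rho> \<and> (\<lambda>u. norm (H u)) \<in> O[at_infinity](\<lambda>u. exp (norm u powr \<rho>))}"

definition binomial_sample :: "nat \<Rightarrow> (complex \<Rightarrow> complex) \<Rightarrow> complex \<Rightarrow> complex" where
  "binomial_sample d H z = (\<Sum>j=0..d. of_nat (d choose j) * H (of_nat j - of_nat d / 2) * z ^ j)"

definition cpoly :: "real poly \<Rightarrow> complex poly" where
  "cpoly p = map_poly complex_of_real p"

(* z = 0 has to be excluded: there inverse z is the junk value 0. *)
definition quot_minus :: "(complex \<Rightarrow> complex) \<Rightarrow> nat \<Rightarrow> real poly" where
  "quot_minus F n = (THE C. \<forall>z. z \<noteq> 0 \<longrightarrow>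
     binomial_sample (2 * n + 1) F z = z ^ n * (z + 1) * poly (cpoly C) (z + inverse z))"

definition quot_plus :: "(complex \<Rightarrow> complex) \<Rightarrow> nat \<Rightarrow> real poly" where
  "quot_plus G n = (THE C. \<forall>z. z \<noteq> 0 \<longrightarrow>
     binomial_sample (2 * n + 1) G z = z ^ n * (z - 1) * poly (cpoly C) (z + inverse z))"

definition real_rooted :: "real poly \<Rightarrow> bool" where
  "real_rooted p \<longleftrightarrow> (\<forall>z. poly (cpoly p) z = 0 \<longrightarrow> z \<in> \<real>)"

(* The conventions for the zero polynomial are instances of this definition; see the
   weak_obreschkoff lemmas below. *)
definition weak_obreschkoff :: "real poly \<Rightarrow> real poly \<Rightarrow> bool"  (infix "\<preceq>\<^sub>O" 50) where
  "A \<preceq>\<^sub>O B \<longleftrightarrow> (\<forall>t. B + smult t A \<noteq> 0 \<longrightarrow> real_rooted (B + smult t A))"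

lemma cpoly_simps [simp]:
  "cpoly 0 = 0" "cpoly (p + q) = cpoly p + cpoly q" "cpoly (p - q) = cpoly p - cpoly q"
  "cpoly (smult a p) = smult (of_real a) (cpoly p)" "cpoly (pCons a p) = pCons (of_real a) (cpoly p)"
  "cpoly 1 = 1"
  unfolding cpoly_def by (auto intro!: poly_eqI simp: coeff_map_poly coeff_pCons split: nat.splits)

lemma cpoly_eq_0_iff [simp]: "cpoly p = 0 \<longleftrightarrow> p = 0"
  by (auto simp: cpoly_def poly_eq_iff coeff_map_poly)

lemma weak_obreschkoff_0_0: "0 \<preceq>\<^sub>O 0"
  by (simp add: weak_obreschkoff_def)

lemma weak_obreschkoff_0_left: "B \<noteq> 0 \<Longrightarrow> 0 \<preceq>\<^sub>O B \<longleftrightarrow> real_rooted B"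
  by (simp add: weak_obreschkoff_def)

lemma weak_obreschkoff_0_right: "B \<noteq> 0 \<Longrightarrow> B \<preceq>\<^sub>O 0 \<longleftrightarrow> real_rooted B"
  unfolding weak_obreschkoff_def real_rooted_def
  by (auto dest: spec[of _ 1])

lemma entire_order_le_1_iff:
  "entire_order H \<le> 1 \<longleftrightarrow>
     (\<forall>\<epsilon>>0. (\<lambda>u. norm (H u)) \<in> O[at_infinity](\<lambda>u. exp (norm u powr (1 + \<epsilon>))))"
proof
  assume le: "entire_order H \<le> 1"
  show "\<forall>\<epsilon>>0. (\<lambda>u. norm (H u)) \<in> O[at_infinity](\<lambda>u. exp (norm u powr (1 + \<epsilon>)))"
  proof (intro allI impI)
    fix \<epsilon> :: real assume "\<epsilon> > 0"
    hence "entire_order H < ereal (1 + \<epsilon>)"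
      using le by (metis ereal_less(2) less_add_same_cancel1 less_ereal.simps(1) one_ereal_def order_le_less_trans)
    then obtain \<rho> where \<rho>: "\<rho> < 1 + \<epsilon>" "0 \<le> \<rho>"
        "(\<lambda>u. norm (H u)) \<in> O[at_infinity](\<lambda>u. exp (norm u powr \<rho>))"
      unfolding entire_order_def Inf_less_iff by auto
    have "eventually (\<lambda>u::complex. norm u \<ge> 1) at_infinity"
      by (auto simp: eventually_at_infinity)
    hence "(\<lambda>u::complex. exp (norm u powr \<rho>)) \<in> O[at_infinity](\<lambda>u. exp (norm u powr (1 + \<epsilon>)))"
      by (intro landau_o.big_mono) (use \<rho> in \<open>auto elim!: eventually_mono intro!: powr_mono\<close>)
    with \<rho>(3) show "(\<lambda>u. norm (H u)) \<in> O[at_infinity](\<lambda>u. exp (norm u powr (1 + \<epsilon>)))"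
      by (rule landau_o.big_trans)
  qed
next
  assume *: "\<forall>\<epsilon>>0. (\<lambda>u. norm (H u)) \<in> O[at_infinity](\<lambda>u. exp (norm u powr (1 + \<epsilon>)))"
  have "entire_order H \<le> 1 + ereal \<epsilon>" if "\<epsilon> > 0" for \<epsilon>
    unfolding entire_order_def
    by (rule Inf_lower) (use * that in \<open>auto intro!: exI[of _ "1 + \<epsilon>"] simp: one_ereal_def\<close>)
  thus "entire_order H \<le> 1"
    by (rule ereal_le_epsilon2[rule_format])
qed

(* quot_basis s k is the polynomial in z + 1/z equal to (z ^ (k + 1) + s * z ^ (- k)) / (z + s),
   for s = 1 or s = -1. It shows that quot_minus and quot_plus exist and are unique. *)
fun quot_basis :: "real \<Rightarrow> nat \<Rightarrow> real poly" where
  "quot_basis s 0 = 1"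
| "quot_basis s (Suc 0) = [:- s, 1:]"
| "quot_basis s (Suc (Suc k)) = [:0, 1:] * quot_basis s (Suc k) - quot_basis s k"

lemma quot_basis:
  assumes "s = 1 \<or> s = -1" "z \<noteq> 0"
  shows "z ^ k * (z + of_real s) * poly (cpoly (quot_basis s k)) (z + inverse z)
           = z ^ (2 * k + 1) + of_real s"
  using assms
proof (induction s k rule: quot_basis.induct)
  case (3 s k)
  let ?P = "\<lambda>k. poly (cpoly (quot_basis s k)) (z + inverse z)"
  have "z ^ Suc (Suc k) * (z + of_real s) * ?P (Suc (Suc k))
      = (z\<^sup>2 + 1) * (z ^ Suc k * (z + of_real s) * ?P (Suc k)) - z\<^sup>2 * (z ^ k * (z + of_real s) * ?P k)"
  proof -
    have "?P (Suc (Suc k)) = (z + inverse z) * ?P (Suc k) - ?P k" by simp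
    moreover have "z * inverse z = 1" using 3 by simp
    hence "z * (z * q) * c * ((z + inverse z) * a - b) = (z * z + 1) * (z * q * c * a) - z * z * (q * c * b)"
      for q c a b by algebra
    ultimately show ?thesis
      by (simp only: power2_eq_square power_Suc)
  qed
  also have "\<dots> = (z\<^sup>2 + 1) * (z ^ (2 * Suc k + 1) + of_real s) - z\<^sup>2 * (z ^ (2 * k + 1) + of_real s)"
    by (simp only: 3(1)[OF 3(3,4)] 3(2)[OF 3(3,4)])
  also have "\<dots> = z ^ (2 * Suc (Suc k) + 1) + of_real s"
    by (simp add: algebra_simps power2_eq_square)
  finally show ?case .
qed (auto simp: field_simps power2_eq_square power3_eq_cube eval_nat_numeral)

lemma quotient_ex1:
  assumes "real_fun H" and s: "s = 1 \<or> s = -1" and sym: "\<And>u. H (-u) = of_real s * H u"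
  shows "\<exists>!C. \<forall>z. z \<noteq> 0 \<longrightarrow>
     binomial_sample (2 * n + 1) H z = z ^ n * (z + of_real s) * poly (cpoly C) (z + inverse z)"
proof (rule ex_ex1I)
  define b where "b j = of_nat ((2 * n + 1) choose j) * H (of_nat j - of_nat (2 * n + 1) / 2)" for j
  have b_real: "b j = of_real (Re (b j))" for j
  proof -
    have "cnj (b j) = b j"
      unfolding b_def by (simp flip: assms(1)[unfolded real_fun_def, rule_format])
    thus ?thesis by (metis Reals_cnj_iff of_real_Re)
  qed
  have b_sym: "b (2 * n + 1 - j) = of_real s * b j" if "j \<le> n" for j
  proof -
    have "of_nat (2 * n + 1 - j) - of_nat (2 * n + 1) / 2 = - (of_nat j - of_nat (2 * n + 1) / 2 :: complex)"
      using that by (simp add: of_nat_diff field_simps)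
    moreover have "(2 * n + 1) choose (2 * n + 1 - j) = (2 * n + 1) choose j"
      using that by (intro binomial_symmetric[symmetric]) auto
    ultimately show ?thesis by (simp only: b_def sym mult_ac)
  qed
  have ss: "of_real s * of_real s = (1 :: complex)" using s by auto
  define C where "C = (\<Sum>j\<le>n. smult (s * Re (b j)) (quot_basis s (n - j)))"
  have cC: "cpoly C = (\<Sum>j\<le>n. smult (of_real s * b j) (cpoly (quot_basis s (n - j))))"
  proof -
    have "cpoly (\<Sum>j\<in>A. f j) = (\<Sum>j\<in>A. cpoly (f j))" if "finite A" for A :: "nat set" and f
      using that by induction auto
    thus ?thesis unfolding C_def by (simp flip: b_real)
  qed
  show "\<exists>C. \<forall>z. z \<noteq> 0 \<longrightarrow>
     binomial_sample (2 * n + 1) H z = z ^ n * (z + of_real s) * poly (cpoly C) (z + inverse z)"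
  proof (intro exI[of _ C] allI impI)
    fix z :: complex assume z: "z \<noteq> 0"
    have "{0..2*n+1} = {..n} \<union> {n+1..2*n+1}" by auto
    hence "binomial_sample (2 * n + 1) H z = (\<Sum>j\<le>n. b j * z ^ j) + (\<Sum>j=n+1..2*n+1. b j * z ^ j)"
      unfolding binomial_sample_def b_def by (simp only:) (intro sum.union_disjoint, auto)
    also have "(\<Sum>j=n+1..2*n+1. b j * z ^ j) = (\<Sum>j\<le>n. b (2*n+1-j) * z ^ (2*n+1-j))"
      by (intro sum.reindex_bij_witness[of _ "\<lambda>j. 2*n+1-j" "\<lambda>j. 2*n+1-j"]) auto
    also have "\<dots> = (\<Sum>j\<le>n. of_real s * b j * z ^ (2*n+1-j))"
      by (intro sum.cong) (use b_sym in auto)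
    also have "(\<Sum>j\<le>n. b j * z ^ j) + \<dots> =
        (\<Sum>j\<le>n. of_real s * b j * (z ^ j * (z ^ (2 * (n - j) + 1) + of_real s)))"
      unfolding sum.distrib [symmetric]
    proof (intro sum.cong refl)
      fix j assume "j \<in> {..n}"
      hence "z ^ (2*n+1-j) = z ^ j * z ^ (2 * (n - j) + 1)"
        by (subst power_add [symmetric]) (rule arg_cong[of _ _ "(^) z"], auto)
      moreover have "of_real s * (b j * (of_real s * z ^ j)) = b j * z ^ j"
        using ss by (metis mult.assoc mult.commute mult_1)
      ultimately show "b j * z ^ j + of_real s * b j * z ^ (2*n+1-j) =
          of_real s * b j * (z ^ j * (z ^ (2 * (n - j) + 1) + of_real s))"
        by (simp add: algebra_simps)
    qed
    also have "\<dots> = (\<Sum>j\<le>n. of_real s * b j *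
        (z ^ n * (z + of_real s) * poly (cpoly (quot_basis s (n - j))) (z + inverse z)))"
    proof (intro sum.cong refl)
      fix j assume "j \<in> {..n}"
      hence "z ^ n = z ^ j * z ^ (n - j)" by (simp flip: power_add)
      thus "of_real s * b j * (z ^ j * (z ^ (2 * (n - j) + 1) + of_real s)) = of_real s * b j *
        (z ^ n * (z + of_real s) * poly (cpoly (quot_basis s (n - j))) (z + inverse z))"
        unfolding quot_basis[OF s z, symmetric] by (simp only: mult_ac)
    qed
    also have "\<dots> = z ^ n * (z + of_real s) * poly (cpoly C) (z + inverse z)"
      unfolding cC by (simp add: poly_sum sum_distrib_left mult_ac)
    finally show "binomial_sample (2 * n + 1) H z = \<dots>" .
  qed
next
  fix C D :: "real poly"
  assume CD: "\<forall>z. z \<noteq> 0 \<longrightarrow>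
     binomial_sample (2 * n + 1) H z = z ^ n * (z + of_real s) * poly (cpoly C) (z + inverse z)"
    "\<forall>z. z \<noteq> 0 \<longrightarrow>
     binomial_sample (2 * n + 1) H z = z ^ n * (z + of_real s) * poly (cpoly D) (z + inverse z)"
  have root: "poly (cpoly (C - D)) w = 0" if "w \<noteq> - 2 * of_real s" for w
  proof -
    define z where "z = (w + csqrt (w\<^sup>2 - 4)) / 2"
    have "(csqrt (w\<^sup>2 - 4))\<^sup>2 = w\<^sup>2 - 4" by simp
    hence eq: "z * z + 1 = w * z"
      unfolding z_def by (simp add: field_simps power2_eq_square) algebra
    hence z0: "z \<noteq> 0" by auto
    hence w: "w = z + inverse z" using eq by (simp add: field_simps)
    have "z + of_real s \<noteq> 0"
    proof
      assume "z + of_real s = 0"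
      hence "z = - of_real s" by (simp add: eq_neg_iff_add_eq_0)
      thus False using that s w by auto
    qed
    with CD z0 w show ?thesis by auto
  qed
  have "infinite (- {- 2 * complex_of_real s})"
    unfolding Compl_eq_Diff_UNIV by (intro Diff_infinite_finite infinite_UNIV_char_0) auto
  hence "infinite {w. poly (cpoly (C - D)) w = 0}"
    by (rule infinite_super[rotated]) (use root in auto)
  hence "cpoly (C - D) = 0" using poly_roots_finite by blast
  hence "C - D = 0" by (simp only: cpoly_eq_0_iff)
  thus "C = D" by simp
qed

lemma quot_minus_eq:
  assumes "real_fun F" "\<And>u. F (-u) = F u" "z \<noteq> 0"
  shows "binomial_sample (2 * n + 1) F z = z ^ n * (z + 1) * poly (cpoly (quot_minus F n)) (z + inverse z)"
  using theI'[OF quotient_ex1[of F 1 n]] assms unfolding quot_minus_def by simp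

lemma quot_plus_eq:
  assumes "real_fun G" "\<And>u. G (-u) = - G u" "z \<noteq> 0"
  shows "binomial_sample (2 * n + 1) G z = z ^ n * (z - 1) * poly (cpoly (quot_plus G n)) (z + inverse z)"
  using theI'[OF quotient_ex1[of G "-1" n]] assms unfolding quot_plus_def by simp

end

theory Submission
  imports Defs "HOL-Real_Asymp.Real_Asymp"
begin

text \<open>
  With \<open>x = 2 cos t\<close>, the quotient polynomial times \<open>cos (t/2)\<close> becomes a half-integral cosine
  polynomial with coefficients \<open>binom(2n+1, n-k) F(k+1/2)\<close> at \<open>cos ((k+1/2) t)\<close>. A zero pair of the even
  function \<open>F\<close> multiplies the coefficients by \<open>(k+1/2)\<^sup>2 - s\<close>, that is, applies the operator
  \<open>-(D\<^sup>2 + s)\<close>. By Rolle arguments such an operator loses no sign change on \<open>(0, \<pi>)\<close> if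
  \<open>s \<le> 1/4\<close>; neither does the product of two operators with \<open>1/4 \<le> s \<le> 1\<close>, or with complex
  conjugate \<open>s\<close> coming from the strip \<open>|Re u| \<le> 1\<close>. Hence all zeros but at most one pair can be
  ignored. For \<open>F = 1\<close> the pencil is \<open>X\<^sup>n (X + t)\<close> with \<open>X = x + 2\<close>, and the one remaining
  factor turns it into \<open>X\<^sup>n\<^sup>-\<^sup>1\<close> times a quadratic, which is real-rooted for \<open>s \<le> 15/28\<close>.
  So every pencil has \<open>n\<close> real roots and degree at most \<open>n + 1\<close>. An entire function of order one is
  approximated on the sample points by finite products of its zero factors. The odd case is reduced to this
  one by \<open>x \<mapsto> -x\<close> and \<open>G(u) = u F(u)\<close>.
\<close>

subsection \<open>Differential operators that lose no sign changes\<close>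

text \<open>The thresholds come from the even homogeneous solutions of the operators. For one
  factor, \<open>cos (sqrt s t)\<close> must stay positive on \<open>[0, pi)\<close>, hence
  \<open>s \<le> 1/4\<close>. Two factors have a two-dimensional space of even solutions, and it
  suffices that some member, the Wronskian and one quantity at \<open>pi\<close> are positive, which
  works up to frequency 1. So an odd number of large real factors leaves one over, and only that one
  needs the special form of the pencil: \<open>-D\<^sup>2\<close> maps
  \<open>cos (t/2) X\<^sup>n\<close> into the span of \<open>cos (t/2) X\<^sup>n\<close> and
  \<open>cos (t/2) X\<^sup>n\<^sup>-\<^sup>1\<close>. The resulting condition is tightest at
  \<open>n = 1\<close>, where it gives 15/28; in the odd case it is weaker than
  \<open>s \<le> 1\<close>, so there the strip is limited by the pairs and quadruples. Nearly all
  zeros of \<open>X\<^sup>n (X + t)\<close> sit in one multiple zero at the edge and become sign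
  changes only after a perturbation, which is why \<open>osc\<close> is closed under limits.
  Evenness makes \<open>F\<close> a function of \<open>u\<^sup>2\<close> of order at most 1/2, so
  its product over zeros has no exponential factor and finite subproducts suffice.\<close>

definition alternates :: "(real \<Rightarrow> real) \<Rightarrow> real set \<Rightarrow> nat \<Rightarrow> real \<Rightarrow> bool" where
  "alternates f S k e \<longleftrightarrow>
     (\<exists>y. (\<forall>i\<le>k. y i \<in> S \<and> 0 < e * (-1) ^ i * f (y i)) \<and> (\<forall>i<k. y i < y (Suc i)))"

text \<open>One application of the mean value theorem per interval, so \<open>k + 2\<close> points
  give \<open>k + 1\<close>. The weight is required to be positive only inside the intervals, since
  the weights used later may vanish at 0.\<close>

lemma rolle_alternation:
  fixes P Q w :: "real \<Rightarrow> real"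
  assumes y: "\<And>i. i \<le> k \<Longrightarrow> y i < y (Suc i)"
    and step: "\<And>i. i \<le> k \<Longrightarrow> 0 < e * (-1) ^ i * (P (y i) - P (y (Suc i)))"
    and sub: "\<And>i t. i \<le> k \<Longrightarrow> y i < t \<Longrightarrow> t < y (Suc i) \<Longrightarrow> t \<in> S \<and> 0 < w t"
    and der: "\<And>i t. i \<le> k \<Longrightarrow> y i \<le> t \<Longrightarrow> t \<le> y (Suc i) \<Longrightarrow>
                (P has_real_derivative w t * Q t) (at t)"
  shows "\<exists>z. (\<forall>i\<le>k. y i < z i \<and> z i < y (Suc i) \<and> z i \<in> S \<and> 0 < (-e) * (-1) ^ i * Q (z i))
            \<and> (\<forall>i<k. z i < z (Suc i))"
proof -
  have "\<exists>t. y i < t \<and> t < y (Suc i) \<and> 0 < (-e) * (-1) ^ i * Q t" if i: "i \<le> k" for i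
  proof -
    obtain t where t: "y i < t" "t < y (Suc i)"
      and eq: "P (y (Suc i)) - P (y i) = (y (Suc i) - y i) * (w t * Q t)"
      using MVT2[of "y i" "y (Suc i)" P "\<lambda>t. w t * Q t"] y[OF i] der[OF i] by auto
    have "0 < e * (-1) ^ i * (- ((y (Suc i) - y i) * (w t * Q t)))"
      using step[OF i] eq by (smt (verit))
    also have "\<dots> = ((y (Suc i) - y i) * w t) * ((-e) * (-1) ^ i * Q t)" by (simp add: algebra_simps)
    finally have "0 < ((y (Suc i) - y i) * w t) * ((-e) * (-1) ^ i * Q t)" .
    moreover have "0 < (y (Suc i) - y i) * w t" using y[OF i] sub[OF i t] by simp
    ultimately show ?thesis using t zero_less_mult_pos by blast
  qed
  then obtain z where z: "\<And>i. i \<le> k \<Longrightarrow> y i < z i \<and> z i < y (Suc i) \<and> 0 < (-e) * (-1) ^ i * Q (z i)"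
    by metis
  have "z i < z (Suc i)" if "i < k" for i
    using z[of i] z[of "Suc i"] that by force
  then show ?thesis using z sub by (intro exI[of _ z]) auto
qed

text \<open>The end point \<open>b\<close> replaces the sign change that Rolle loses. A weak
  inequality at \<open>b\<close> is enough, and nothing is asked at \<open>a\<close>: in
  \<open>fourth_order_no_loss\<close> the function \<open>g1 / w\<close> is singular at 0, and its
  value at \<open>pi\<close> is controlled only in sign.\<close>

lemma rolle_alternation_append:
  fixes P Q w :: "real \<Rightarrow> real"
  assumes y: "\<And>i. i \<le> k \<Longrightarrow> a < y i \<and> y i < b \<and> 0 < e * (-1) ^ i * P (y i)"
    and inc: "\<And>i. i < k \<Longrightarrow> y i < y (Suc i)"
    and b: "e * (-1) ^ k * P b \<le> 0"
    and w: "\<And>t. a < t \<Longrightarrow> t < b \<Longrightarrow> 0 < w t"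
    and der: "\<And>t. a < t \<Longrightarrow> t \<le> b \<Longrightarrow> (P has_real_derivative w t * Q t) (at t)"
  shows "\<exists>z. (\<forall>i\<le>k. a < z i \<and> z i < b \<and> 0 < (-e) * (-1) ^ i * Q (z i)) \<and> (\<forall>i<k. z i < z (Suc i))"
proof -
  define y' where "y' i = (if i \<le> k then y i else b)" for i
  have "\<exists>z. (\<forall>i\<le>k. y' i < z i \<and> z i < y' (Suc i) \<and> z i \<in> {a<..<b} \<and> 0 < (-e) * (-1) ^ i * Q (z i))
            \<and> (\<forall>i<k. z i < z (Suc i))"
  proof (rule rolle_alternation)
    fix i assume i: "i \<le> k"
    show "y' i < y' (Suc i)" using i y inc by (auto simp: y'_def)
    show "0 < e * (-1) ^ i * (P (y' i) - P (y' (Suc i)))"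
    proof (cases "i = k")
      case True
      then show ?thesis using y[of k] b by (auto simp: y'_def algebra_simps)
    next
      case False
      then show ?thesis using i y[of i] y[of "Suc i"] by (auto simp: y'_def algebra_simps)
    qed
    fix t assume t: "y' i < t" "t < y' (Suc i)"
    then have "a < t \<and> t < b" using i y[of i] y[of "Suc i"] by (auto simp: y'_def split: if_splits)
    then show "t \<in> {a<..<b} \<and> 0 < w t" using w by auto
  next
    fix i t assume i: "i \<le> k" and t: "y' i \<le> t" "t \<le> y' (Suc i)"
    then have "a < t \<and> t \<le> b" using y[of i] y[of "Suc i"] by (auto simp: y'_def split: if_splits)
    then show "(P has_real_derivative w t * Q t) (at t)" using der by auto
  qed
  then show ?thesis by (metis greaterThanLessThan_iff)
qed

text \<open>Leaving the zero at \<open>a\<close>, the function must first move towards the sign of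
  its first point, so \<open>e\<close> is kept instead of reversed. The points may reach
  \<open>b\<close> because the sequence for \<open>g2\<close> in \<open>fourth_order_no_loss\<close>
  may end at \<open>pi\<close>.\<close>

lemma rolle_alternation_prepend:
  fixes P Q w :: "real \<Rightarrow> real"
  assumes y: "\<And>i. i \<le> k \<Longrightarrow> a < y i \<and> y i \<le> b \<and> 0 < e * (-1) ^ i * P (y i)"
    and inc: "\<And>i. i < k \<Longrightarrow> y i < y (Suc i)"
    and a: "P a = 0"
    and w: "\<And>t. a < t \<Longrightarrow> t < b \<Longrightarrow> 0 < w t"
    and der: "\<And>t. a \<le> t \<Longrightarrow> t \<le> b \<Longrightarrow> (P has_real_derivative w t * Q t) (at t)"
  shows "\<exists>z. (\<forall>i\<le>k. a < z i \<and> z i < b \<and> 0 < e * (-1) ^ i * Q (z i)) \<and> (\<forall>i<k. z i < z (Suc i))"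
proof -
  define y' where "y' i = (if i = 0 then a else y (i - 1))" for i
  have "\<exists>z. (\<forall>i\<le>k. y' i < z i \<and> z i < y' (Suc i) \<and> z i \<in> {a<..<b} \<and> 0 < (- (-e)) * (-1) ^ i * Q (z i))
            \<and> (\<forall>i<k. z i < z (Suc i))"
  proof (rule rolle_alternation)
    fix i assume i: "i \<le> k"
    show "y' i < y' (Suc i)" using i y[of i] inc[of "i - 1"] by (auto simp: y'_def)
    show "0 < (-e) * (-1) ^ i * (P (y' i) - P (y' (Suc i)))"
    proof (cases i)
      case 0
      then show ?thesis using y[of 0] a by (auto simp: y'_def)
    next
      case (Suc j)
      then show ?thesis using i y[of j] y[of "Suc j"] by (auto simp: y'_def algebra_simps)
    qed
    fix t assume t: "y' i < t" "t < y' (Suc i)"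
    then have "a < t \<and> t < b" using i y[of i] y[of "i - 1"] by (cases i) (auto simp: y'_def split: if_splits)
    then show "t \<in> {a<..<b} \<and> 0 < w t" using w by auto
  next
    fix i t assume i: "i \<le> k" and t: "y' i \<le> t" "t \<le> y' (Suc i)"
    then have "a \<le> t \<and> t \<le> b" using y[of i] y[of "i - 1"] by (cases i) (auto simp: y'_def split: if_splits)
    then show "(P has_real_derivative w t * Q t) (at t)" using der by auto
  qed
  then show ?thesis by (metis greaterThanLessThan_iff minus_minus)
qed

text \<open>
  Since \<open>(f/u)' = (u f' - u' f) / u\<^sup>2\<close> and \<open>(u f' - u' f)' = u (f'' + s f)\<close>, two applications of
  Rolle suffice; each would lose a sign change, but the boundary conditions at \<open>\<pi>\<close> and at \<open>0\<close> supply
  an additional zero.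
\<close>

lemma second_order_no_loss:
  fixes f f1 f2 u u1 :: "real \<Rightarrow> real"
  assumes f: "\<And>t. (f has_real_derivative f1 t) (at t)" "\<And>t. (f1 has_real_derivative f2 t) (at t)"
    and u: "\<And>t. (u has_real_derivative u1 t) (at t)" "\<And>t. (u1 has_real_derivative - s * u t) (at t)"
    and bd: "f1 0 = 0" "u1 0 = 0" "f pi = 0"
    and pos: "\<And>t. 0 \<le> t \<Longrightarrow> t \<le> pi \<Longrightarrow> 0 < u t"
    and alt: "alternates f {0<..<pi} k e"
  shows "alternates (\<lambda>t. - (f2 t + s * f t)) {0<..<pi} k e"
proof -
  obtain y where y: "\<And>i. i \<le> k \<Longrightarrow> 0 < y i \<and> y i < pi \<and> 0 < e * (-1) ^ i * f (y i)"
    "\<And>i. i < k \<Longrightarrow> y i < y (Suc i)"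
    using alt by (auto simp: alternates_def)
  have "\<exists>z. (\<forall>i\<le>k. 0 < z i \<and> z i < pi \<and> 0 < (-e) * (-1) ^ i * (u (z i) * f1 (z i) - u1 (z i) * f (z i)))
          \<and> (\<forall>i<k. z i < z (Suc i))"
  proof (rule rolle_alternation_append[where P = "\<lambda>t. f t / u t" and w = "\<lambda>t. 1 / (u t)\<^sup>2" and y = y])
    show "0 < y i \<and> y i < pi \<and> 0 < e * (-1) ^ i * (f (y i) / u (y i))" if "i \<le> k" for i
      using y(1)[OF that] pos[of "y i"] by (simp add: zero_less_divide_iff)
    show "((\<lambda>t. f t / u t) has_real_derivative 1 / (u t)\<^sup>2 * (u t * f1 t - u1 t * f t)) (at t)"
      if "0 < t" "t \<le> pi" for t
      using pos[of t] that
      by (auto intro!: derivative_eq_intros f u simp: field_simps power2_eq_square)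
    show "0 < 1 / (u t)\<^sup>2" if "0 < t" "t < pi" for t using pos[of t] that by simp
  qed (use y bd in auto)
  then obtain z where z: "\<And>i. i \<le> k \<Longrightarrow> 0 < z i \<and> z i \<le> pi \<and> 0 < (-e) * (-1) ^ i * (u (z i) * f1 (z i) - u1 (z i) * f (z i))"
    "\<And>i. i < k \<Longrightarrow> z i < z (Suc i)" by (metis less_imp_le)
  have "\<exists>r. (\<forall>i\<le>k. 0 < r i \<and> r i < pi \<and> 0 < (-e) * (-1) ^ i * (f2 (r i) + s * f (r i))) \<and> (\<forall>i<k. r i < r (Suc i))"
  proof (rule rolle_alternation_prepend[where P = "\<lambda>t. u t * f1 t - u1 t * f t" and w = u and y = z])
    show "((\<lambda>t. u t * f1 t - u1 t * f t) has_real_derivative u t * (f2 t + s * f t)) (at t)" for t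
      by (auto intro!: derivative_eq_intros f u simp: algebra_simps)
  qed (use z bd pos in auto)
  then show ?thesis unfolding alternates_def by (auto simp: algebra_simps)
qed

text \<open>\<open>D\<^sup>2\<close> acts on the span of \<open>U\<close> and \<open>V\<close> by a
  2 x 2 matrix, so by Cayley-Hamilton the operator \<open>L\<close> of the conclusion annihilates
  both. It is formally self-adjoint and has the symmetric factorization \<open>L = (1/u) D
  (u\<^sup>2/w) D (w\<^sup>2/u\<^sup>2) D (u\<^sup>2/w) D (1/u)\<close>, where
  \<open>u = V + \<epsilon> U\<close> and \<open>w\<close> is the Wronskian of \<open>U\<close> and
  \<open>V\<close>. Each \<open>D\<close> is one Rolle argument, and the intermediate functions are
  \<open>g1\<close>, \<open>g2\<close>, \<open>g3\<close>, \<open>g4\<close>.\<close>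

lemma fourth_order_no_loss:
  fixes f f1 f2 f3 f4 U U1 V V1 :: "real \<Rightarrow> real"
  assumes f: "\<And>t. (f has_real_derivative f1 t) (at t)" "\<And>t. (f1 has_real_derivative f2 t) (at t)"
      "\<And>t. (f2 has_real_derivative f3 t) (at t)" "\<And>t. (f3 has_real_derivative f4 t) (at t)"
    and U: "\<And>t. (U has_real_derivative U1 t) (at t)"
      "\<And>t. (U1 has_real_derivative - \<alpha> * U t - \<beta> * V t) (at t)"
    and V: "\<And>t. (V has_real_derivative V1 t) (at t)"
      "\<And>t. (V1 has_real_derivative - \<gamma> * V t + \<delta> * U t) (at t)"
    and f0: "f1 0 = 0" "f3 0 = 0" "f pi = 0" "f2 pi = 0"
    and UV0: "U1 0 = 0" "V1 0 = 0"
    and u: "\<And>t. 0 \<le> t \<Longrightarrow> t \<le> pi \<Longrightarrow> 0 < V t + \<epsilon> * U t"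
    and W: "\<And>t. 0 < t \<Longrightarrow> t \<le> pi \<Longrightarrow> 0 < U t * V1 t - V t * U1 t"
    and Wpi: "0 < \<delta> * (U pi)\<^sup>2 + \<beta> * (V pi)\<^sup>2 + (\<alpha> - \<gamma>) * U pi * V pi"
    and alt: "alternates f {0<..<pi} k e"
  shows "alternates (\<lambda>t. f4 t + (\<alpha> + \<gamma>) * f2 t + (\<alpha> * \<gamma> + \<beta> * \<delta>) * f t) {0<..<pi} k e"
proof -
  define u where "u t = V t + \<epsilon> * U t" for t
  define u1 where "u1 t = V1 t + \<epsilon> * U1 t" for t
  define U2 where "U2 t = - \<alpha> * U t - \<beta> * V t" for t
  define V2 where "V2 t = - \<gamma> * V t + \<delta> * U t" for t
  define u2 where "u2 t = V2 t + \<epsilon> * U2 t" for t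
  define u3 where "u3 t = (- \<gamma> * V1 t + \<delta> * U1 t) + \<epsilon> * (- \<alpha> * U1 t - \<beta> * V1 t)" for t
  define u4 where "u4 t = (- \<gamma> * V2 t + \<delta> * U2 t) + \<epsilon> * (- \<alpha> * U2 t - \<beta> * V2 t)" for t
  define w where "w t = U t * V1 t - V t * U1 t" for t
  define w1 where "w1 t = U t * V2 t - V t * U2 t" for t
  define Z where "Z t = V2 t * U1 t - V1 t * U2 t" for t
  define g1 where "g1 t = u t * f1 t - u1 t * f t" for t
  \<comment> \<open>The 3 x 3 Wronskian of \<open>U\<close>, \<open>V\<close>,
    \<open>f\<close>.\<close>
  define g2 where "g2 t = w t * f2 t - w1 t * f1 t + Z t * f t" for t
  \<comment> \<open>The bilinear concomitant in Lagrange's identity: its derivative is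
    \<open>u L f - f L u\<close>, and \<open>L u = 0\<close>.\<close>
  define g3 where "g3 t = u t * f3 t - u1 t * f2 t + u2 t * f1 t - u3 t * f t + (\<alpha> + \<gamma>) * g1 t" for t
  define g4 where "g4 t = f4 t + (\<alpha> + \<gamma>) * f2 t + (\<alpha> * \<gamma> + \<beta> * \<delta>) * f t" for t
  have du: "(u has_real_derivative u1 t) (at t)" "(u1 has_real_derivative u2 t) (at t)"
    "(u2 has_real_derivative u3 t) (at t)" "(u3 has_real_derivative u4 t) (at t)" for t
    unfolding u_def[abs_def] u1_def[abs_def] u2_def[abs_def] u3_def[abs_def] u4_def[abs_def] U2_def[abs_def] V2_def[abs_def]
    by (auto intro!: derivative_eq_intros U V simp: algebra_simps)
  have dw: "(w has_real_derivative w1 t) (at t)" for t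
    unfolding w_def[abs_def] w1_def[abs_def] U2_def V2_def
    by (auto intro!: derivative_eq_intros U V simp: algebra_simps)
  have upos: "0 < u t" if "0 \<le> t" "t \<le> pi" for t using u that by (simp add: u_def)
  have wpos: "0 < w t" if "0 < t" "t \<le> pi" for t using W that by (simp add: w_def)
  have w0: "w 0 = 0" using UV0 by (simp add: w_def)

  obtain y where y: "\<And>i. i \<le> k \<Longrightarrow> 0 < y i \<and> y i < pi \<and> 0 < e * (-1) ^ i * f (y i)"
    "\<And>i. i < k \<Longrightarrow> y i < y (Suc i)"
    using alt by (auto simp: alternates_def)

  have "\<exists>z. (\<forall>i\<le>k. 0 < z i \<and> z i < pi \<and> 0 < (-e) * (-1) ^ i * g1 (z i)) \<and> (\<forall>i<k. z i < z (Suc i))"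
  proof (rule rolle_alternation_append[where P = "\<lambda>t. f t / u t" and w = "\<lambda>t. 1 / (u t)\<^sup>2" and y = y])
    show "0 < y i \<and> y i < pi \<and> 0 < e * (-1) ^ i * (f (y i) / u (y i))" if "i \<le> k" for i
      using y(1)[OF that] upos[of "y i"] by (simp add: zero_less_divide_iff)
    show "((\<lambda>t. f t / u t) has_real_derivative 1 / (u t)\<^sup>2 * g1 t) (at t)"
      if "0 < t" "t \<le> pi" for t
      using upos[of t] that unfolding g1_def
      by (auto intro!: derivative_eq_intros f du simp: field_simps power2_eq_square)
    show "0 < 1 / (u t)\<^sup>2" if "0 < t" "t < pi" for t using upos[of t] that by simp
  qed (use y f0 in auto)
  then obtain z where z: "\<And>i. i \<le> k \<Longrightarrow> 0 < z i \<and> z i < pi \<and> 0 < (-e) * (-1) ^ i * g1 (z i)"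
    "\<And>i. i < k \<Longrightarrow> z i < z (Suc i)" by blast

  have id2: "(w1 t * g1 t + u t * g2 t) = (u t * f2 t - u2 t * f t) * w t" for t
    unfolding g1_def g2_def Z_def w1_def w_def u_def u1_def u2_def U2_def V2_def by algebra
  have der2: "((\<lambda>t. g1 t / w t) has_real_derivative (u t / (w t)\<^sup>2) * g2 t) (at t)" if "0 < t" "t \<le> pi" for t
  proof -
    have "(g1 has_real_derivative u t * f2 t - u2 t * f t) (at t)"
      unfolding g1_def[abs_def] by (auto intro!: derivative_eq_intros f du simp: algebra_simps)
    then have "((\<lambda>t. g1 t / w t) has_real_derivative ((u t * f2 t - u2 t * f t) * w t - g1 t * w1 t) / (w t * w t)) (at t)"
      using wpos[OF that] by (intro DERIV_divide dw) auto
    moreover have "((u t * f2 t - u2 t * f t) * w t - g1 t * w1 t) / (w t * w t) = (u t / (w t)\<^sup>2) * g2 t"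
      using id2[of t] by (simp add: power2_eq_square algebra_simps)
    ultimately show ?thesis by simp
  qed
  have "\<exists>r. (\<forall>i\<le>k. 0 < r i \<and> r i \<le> pi \<and> 0 < e * (-1) ^ i * g2 (r i)) \<and> (\<forall>i<k. r i < r (Suc i))"
  \<comment> \<open>Since \<open>w 0 = 0\<close>, the extra point must come from \<open>pi\<close>,
    where \<open>g1 pi = u pi * f1 pi\<close> has unknown sign. If it does not share the sign of the
    last point, Rolle applies up to \<open>pi\<close>. Otherwise Rolle between the points yields one
    point too few, but \<open>g2 pi = - w1 pi * f1 pi\<close> has the required sign, so
    \<open>pi\<close> itself is the last point.\<close>
  proof (cases "e * (-1) ^ k * f1 pi \<ge> 0")
    case True
    have "\<exists>r. (\<forall>i\<le>k. 0 < r i \<and> r i < pi \<and> 0 < (-(-e)) * (-1) ^ i * g2 (r i)) \<and> (\<forall>i<k. r i < r (Suc i))"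
    proof (rule rolle_alternation_append[where P = "\<lambda>t. g1 t / w t" and w = "\<lambda>t. u t / (w t)\<^sup>2" and y = z])
      show "0 < z i \<and> z i < pi \<and> 0 < (-e) * (-1) ^ i * (g1 (z i) / w (z i))" if "i \<le> k" for i
        using z(1)[OF that] wpos[of "z i"] zero_less_divide_iff[of "(-e) * (-1) ^ i * g1 (z i)" "w (z i)"] by auto
      have "(-e) * (-1) ^ k * (g1 pi / w pi) = - (e * (-1) ^ k * f1 pi) * (u pi / w pi)"
        using f0 by (simp add: g1_def)
      also have "\<dots> \<le> 0" using True upos[of pi] wpos[of pi] by (intro mult_nonpos_nonneg) auto
      finally show "(-e) * (-1) ^ k * (g1 pi / w pi) \<le> 0" .
      show "0 < u t / (w t)\<^sup>2" if "0 < t" "t < pi" for t using upos[of t] wpos[of t] that by simp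
    qed (use z der2 in auto)
    then show ?thesis by (metis less_imp_le minus_minus)
  next
    case False
    have g2pi: "0 < e * (-1) ^ k * g2 pi"
    proof -
      have "w1 pi = \<delta> * (U pi)\<^sup>2 + \<beta> * (V pi)\<^sup>2 + (\<alpha> - \<gamma>) * U pi * V pi"
        unfolding w1_def U2_def V2_def by (simp add: algebra_simps power2_eq_square)
      then have "0 < w1 pi" using Wpi by simp
      moreover have "e * (-1) ^ k * g2 pi = (- (e * (-1) ^ k * f1 pi)) * w1 pi"
        using f0 by (simp add: g2_def algebra_simps)
      ultimately show ?thesis using False by (simp add: mult_neg_pos)
    qed
    show ?thesis
    proof (cases k)
      case 0
      then show ?thesis using g2pi by (intro exI[of _ "\<lambda>_. pi"]) auto
    next
      case (Suc j)
      have "\<exists>r. (\<forall>i\<le>j. z i < r i \<and> r i < z (Suc i) \<and> r i \<in> {0<..<pi} \<and> 0 < (-(-e)) * (-1) ^ i * g2 (r i))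
            \<and> (\<forall>i<j. r i < r (Suc i))"
      proof (rule rolle_alternation[where P = "\<lambda>t. g1 t / w t" and w = "\<lambda>t. u t / (w t)\<^sup>2"])
        fix i assume i: "i \<le> j"
        have zi: "0 < z i" "z i < pi" "0 < z (Suc i)" "z (Suc i) < pi" using z(1)[of i] z(1)[of "Suc i"] i Suc by auto
        show "z i < z (Suc i)" using z(2)[of i] i Suc by auto
        have "0 < (-e) * (-1) ^ i * g1 (z i) / w (z i)" "0 < (-e) * (-1) ^ (Suc i) * g1 (z (Suc i)) / w (z (Suc i))"
          using z(1)[of i] z(1)[of "Suc i"] i Suc wpos[of "z i"] wpos[of "z (Suc i)"] zi
          by (auto simp: divide_less_0_iff zero_less_divide_iff)
        then show "0 < (-e) * (-1) ^ i * (g1 (z i) / w (z i) - g1 (z (Suc i)) / w (z (Suc i)))"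
          by (simp add: algebra_simps)
        show "t \<in> {0<..<pi} \<and> 0 < u t / (w t)\<^sup>2" if "z i < t" "t < z (Suc i)" for t
          using that zi upos[of t] wpos[of t] by auto
        show "((\<lambda>t. g1 t / w t) has_real_derivative (u t / (w t)\<^sup>2) * g2 t) (at t)" if "z i \<le> t" "t \<le> z (Suc i)" for t
          using that zi der2[of t] by auto
      qed
      then obtain r where r: "\<And>i. i \<le> j \<Longrightarrow> 0 < r i \<and> r i < pi \<and> 0 < e * (-1) ^ i * g2 (r i)"
        "\<And>i. i < j \<Longrightarrow> r i < r (Suc i)" by auto
      define r' where "r' i = (if i \<le> j then r i else pi)" for i
      have "\<forall>i\<le>k. 0 < r' i \<and> r' i \<le> pi \<and> 0 < e * (-1) ^ i * g2 (r' i)"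
        using r(1) g2pi Suc by (auto simp: r'_def le_Suc_eq less_imp_le)
      moreover have "\<forall>i<k. r' i < r' (Suc i)"
        using r Suc by (auto simp: r'_def less_Suc_eq)
      ultimately show ?thesis by blast
    qed
  qed
  then obtain r where r: "\<And>i. i \<le> k \<Longrightarrow> 0 < r i \<and> r i \<le> pi \<and> 0 < e * (-1) ^ i * g2 (r i)"
    "\<And>i. i < k \<Longrightarrow> r i < r (Suc i)" by blast

  have "\<exists>q. (\<forall>i\<le>k. 0 < q i \<and> q i < pi \<and> 0 < e * (-1) ^ i * g3 (q i)) \<and> (\<forall>i<k. q i < q (Suc i))"
  proof (rule rolle_alternation_prepend[where P = "\<lambda>t. g2 t / u t" and w = "\<lambda>t. w t / (u t)\<^sup>2" and y = r])
    show "0 < r i \<and> r i \<le> pi \<and> 0 < e * (-1) ^ i * (g2 (r i) / u (r i))" if "i \<le> k" for i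
      using r(1)[OF that] upos[of "r i"] zero_less_divide_iff[of "e * (-1) ^ i * g2 (r i)" "u (r i)"] by auto
    have "w1 0 * f1 0 = 0" "Z 0 = 0" using f0 UV0 by (auto simp: Z_def)
    then show "g2 0 / u 0 = 0" using w0 by (simp add: g2_def)
    show "0 < w t / (u t)\<^sup>2" if "0 < t" "t < pi" for t using upos[of t] wpos[of t] that by simp
    show "((\<lambda>t. g2 t / u t) has_real_derivative w t / (u t)\<^sup>2 * g3 t) (at t)" if t: "0 \<le> t" "t \<le> pi" for t
    proof -
      define w2 where "w2 t = U1 t * V2 t + U t * (- \<gamma> * V1 t + \<delta> * U1 t) - V1 t * U2 t - V t * (- \<alpha> * U1 t - \<beta> * V1 t)" for t
      define Z1 where "Z1 t = (- \<gamma> * V1 t + \<delta> * U1 t) * U1 t - V1 t * (- \<alpha> * U1 t - \<beta> * V1 t)" for t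
      define g2' where "g2' = w1 t * f2 t + w t * f3 t - w2 t * f1 t - w1 t * f2 t + Z1 t * f t + Z t * f1 t"
      have U2: "(U2 has_real_derivative - \<alpha> * U1 t - \<beta> * V1 t) (at t)"
        and V2: "(V2 has_real_derivative - \<gamma> * V1 t + \<delta> * U1 t) (at t)"
        unfolding U2_def[abs_def] V2_def[abs_def] by (auto intro!: derivative_eq_intros U V)
      have UU: "(U1 has_real_derivative U2 t) (at t)" "(V1 has_real_derivative V2 t) (at t)"
        using U V by (auto simp: U2_def V2_def)
      have "(w1 has_real_derivative w2 t) (at t)" "(Z has_real_derivative Z1 t) (at t)"
        unfolding w1_def[abs_def] w2_def Z_def[abs_def] Z1_def
        by (auto intro!: derivative_eq_intros U V U2 V2 UU simp: algebra_simps)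
      then have "(g2 has_real_derivative g2') (at t)"
        unfolding g2_def[abs_def] g2'_def by (auto intro!: derivative_eq_intros f dw simp: algebra_simps)
      then have "((\<lambda>t. g2 t / u t) has_real_derivative (g2' * u t - g2 t * u1 t) / (u t * u t)) (at t)"
        using upos[OF t] by (intro DERIV_divide du) auto
      moreover have "g2' * u t - g2 t * u1 t = w t * g3 t"
        unfolding g3_def g2'_def g2_def g1_def w2_def Z1_def Z_def w1_def w_def u_def u1_def u2_def u3_def U2_def V2_def
        by algebra
      ultimately show ?thesis by (simp add: power2_eq_square)
    qed
  qed (use r in auto)
  then obtain q where q: "\<And>i. i \<le> k \<Longrightarrow> 0 < q i \<and> q i \<le> pi \<and> 0 < e * (-1) ^ i * g3 (q i)"
    "\<And>i. i < k \<Longrightarrow> q i < q (Suc i)" by (metis less_imp_le)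

  have "\<exists>p. (\<forall>i\<le>k. 0 < p i \<and> p i < pi \<and> 0 < e * (-1) ^ i * g4 (p i)) \<and> (\<forall>i<k. p i < p (Suc i))"
  proof (rule rolle_alternation_prepend[where P = g3 and w = u and y = q])
    show "g3 0 = 0" using f0 UV0 by (simp add: g3_def g1_def u1_def u3_def)
    show "(g3 has_real_derivative u t * g4 t) (at t)" for t
    proof -
      have "(g3 has_real_derivative u t * f4 t - u4 t * f t + (\<alpha> + \<gamma>) * (u t * f2 t - u2 t * f t)) (at t)"
        unfolding g3_def[abs_def] g1_def[abs_def]
        by (auto intro!: derivative_eq_intros f du simp: algebra_simps)
      moreover have "u t * f4 t - u4 t * f t + (\<alpha> + \<gamma>) * (u t * f2 t - u2 t * f t) = u t * g4 t"
        unfolding g4_def u4_def u2_def u_def U2_def V2_def by algebra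
      ultimately show ?thesis by simp
    qed
  qed (use q upos in auto)
  then show ?thesis unfolding alternates_def g4_def by auto
qed

subsection \<open>Coefficient multipliers\<close>

definition node :: "nat \<Rightarrow> real" where "node k = (real k + 1/2)\<^sup>2"

definition half_cos :: "nat \<Rightarrow> (nat \<Rightarrow> real) \<Rightarrow> real \<Rightarrow> real" where
  "half_cos m c t = (\<Sum>k\<le>m. c k * cos ((real k + 1/2) * t))"

definition half_sin :: "nat \<Rightarrow> (nat \<Rightarrow> real) \<Rightarrow> real \<Rightarrow> real" where
  "half_sin m c t = (\<Sum>k\<le>m. c k * sin ((real k + 1/2) * t))"

text \<open>
  Closing the condition under limits of coefficients avoids all genericity assumptions. In particular
  \<open>c = 0\<close> is admitted.
\<close>

definition osc :: "nat \<Rightarrow> nat \<Rightarrow> (nat \<Rightarrow> real) \<Rightarrow> bool" where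
  "osc n m c \<longleftrightarrow> (\<forall>\<eta>>0. \<exists>c'. (\<forall>k\<le>m. \<bar>c' k - c k\<bar> < \<eta>) \<and> (\<exists>e. alternates (half_cos m c') {0<..<pi} n e))"

definition keeps :: "(real \<Rightarrow> real) \<Rightarrow> bool" where
  "keeps M \<longleftrightarrow> (\<forall>n m c. osc n m c \<longrightarrow> osc n m (\<lambda>k. M (node k) * c k))"

lemma has_derivative_half_cos:
  "(half_cos m c has_real_derivative half_sin m (\<lambda>k. - ((real k + 1/2) * c k)) t) (at t)"
  unfolding half_cos_def[abs_def] half_sin_def
proof (rule DERIV_sum)
  fix k
  have "((\<lambda>t. cos ((real k + 1/2) * t)) has_real_derivative - sin ((real k + 1/2) * t) * (real k + 1/2)) (at t)"
    by (auto intro!: derivative_eq_intros)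
  from DERIV_cmult[OF this, of "c k"]
  show "((\<lambda>t. c k * cos ((real k + 1/2) * t)) has_real_derivative
      - ((real k + 1/2) * c k) * sin ((real k + 1/2) * t)) (at t)"
    by (simp add: mult_ac)
qed

lemma has_derivative_half_sin:
  "(half_sin m c has_real_derivative half_cos m (\<lambda>k. (real k + 1/2) * c k) t) (at t)"
  unfolding half_cos_def half_sin_def[abs_def]
proof (rule DERIV_sum)
  fix k
  have "((\<lambda>t. sin ((real k + 1/2) * t)) has_real_derivative cos ((real k + 1/2) * t) * (real k + 1/2)) (at t)"
    by (auto intro!: derivative_eq_intros)
  from DERIV_cmult[OF this, of "c k"]
  show "((\<lambda>t. c k * sin ((real k + 1/2) * t)) has_real_derivative
      (real k + 1/2) * c k * cos ((real k + 1/2) * t)) (at t)"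
    by (simp add: mult_ac)
qed

lemma half_cos_pi: "half_cos m c pi = 0"
proof -
  have "cos ((real k + 1/2) * pi) = 0" for k
    by (simp add: algebra_simps cos_add)
  then show ?thesis by (simp add: half_cos_def)
qed

lemma half_sin_0: "half_sin m c 0 = 0"
  by (simp add: half_sin_def)

lemma half_cos_add: "half_cos m (\<lambda>k. c k + d k) t = half_cos m c t + half_cos m d t"
  by (simp add: half_cos_def sum.distrib algebra_simps)

lemma half_cos_cmult: "half_cos m (\<lambda>k. r * c k) t = r * half_cos m c t"
  by (simp add: half_cos_def sum_distrib_left algebra_simps)

lemma osc_closed:
  assumes "\<And>\<eta>. 0 < \<eta> \<Longrightarrow> \<exists>c'. (\<forall>k\<le>m. \<bar>c' k - c k\<bar> < \<eta>) \<and> osc n m c'"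
  shows "osc n m c"
  unfolding osc_def
proof (intro allI impI)
  fix \<eta> :: real assume "0 < \<eta>"
  then obtain c' where c': "\<forall>k\<le>m. \<bar>c' k - c k\<bar> < \<eta> / 2" "osc n m c'"
    using assms[of "\<eta> / 2"] by auto
  then obtain c'' where c'': "\<forall>k\<le>m. \<bar>c'' k - c' k\<bar> < \<eta> / 2" "\<exists>e. alternates (half_cos m c'') {0<..<pi} n e"
    unfolding osc_def using \<open>0 < \<eta>\<close> half_gt_zero by blast
  have "\<forall>k\<le>m. \<bar>c'' k - c k\<bar> < \<eta>" using c'(1) c''(1) by (smt (verit) field_sum_of_halves)
  then show "\<exists>c'. (\<forall>k\<le>m. \<bar>c' k - c k\<bar> < \<eta>) \<and> (\<exists>e. alternates (half_cos m c') {0<..<pi} n e)"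
    using c''(2) by blast
qed

lemma abs_le_sum: "k \<le> m \<Longrightarrow> \<bar>f k\<bar> \<le> (\<Sum>i\<le>m. \<bar>f i :: real\<bar>)" for k m :: nat
  by (rule member_le_sum) auto

lemma mult_small:
  fixes f :: "nat \<Rightarrow> real"
  assumes "0 < \<eta>" "\<bar>x\<bar> < \<eta> / (1 + (\<Sum>i\<le>m. \<bar>f i\<bar>))" "k \<le> m"
  shows "\<bar>f k * x\<bar> < \<eta>"
proof -
  have S: "0 < 1 + (\<Sum>i\<le>m. \<bar>f i\<bar>)" by (simp add: add_pos_nonneg sum_nonneg)
  have "\<bar>f k * x\<bar> \<le> (1 + (\<Sum>i\<le>m. \<bar>f i\<bar>)) * \<bar>x\<bar>"
    using abs_le_sum[OF assms(3), of f] by (auto simp: abs_mult intro!: mult_right_mono)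
  also have "\<dots> < \<eta>" using assms(2) S by (simp add: field_simps)
  finally show ?thesis .
qed

lemma small_bound_pos: "0 < (\<eta>::real) \<Longrightarrow> 0 < \<eta> / (1 + (\<Sum>i\<le>(m::nat). \<bar>f i\<bar>))"
  by (intro divide_pos_pos add_pos_nonneg sum_nonneg) auto

lemma keepsD: "keeps M \<Longrightarrow> osc n m c \<Longrightarrow> osc n m (\<lambda>k. M (node k) * c k)"
  unfolding keeps_def by (elim allE impE)

lemma keepsI:
  assumes "\<And>n m c e. alternates (half_cos m c) {0<..<pi} n e \<Longrightarrow>
             alternates (half_cos m (\<lambda>k. M (node k) * c k)) {0<..<pi} n e"
  shows "keeps M"
  unfolding keeps_def osc_def
proof (intro allI impI)
  fix n m c and \<eta> :: real
  assume *: "\<forall>\<eta>>0. \<exists>c'. (\<forall>k\<le>m. \<bar>c' k - c k\<bar> < \<eta>) \<and> (\<exists>e. alternates (half_cos m c') {0<..<pi} n e)"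
    and \<eta>: "0 < \<eta>"
  obtain c' e where c': "\<And>k. k \<le> m \<Longrightarrow> \<bar>c' k - c k\<bar> < \<eta> / (1 + (\<Sum>i\<le>m. \<bar>M (node i)\<bar>))"
    "alternates (half_cos m c') {0<..<pi} n e"
    using *[rule_format, OF small_bound_pos[OF \<eta>, where f = "\<lambda>i. M (node i)" and m = m]] by blast
  have "\<bar>M (node k) * c' k - M (node k) * c k\<bar> < \<eta>" if "k \<le> m" for k
    using mult_small[OF \<eta> c'(1)[OF that] that] by (simp add: algebra_simps)
  then show "\<exists>c'. (\<forall>k\<le>m. \<bar>c' k - M (node k) * c k\<bar> < \<eta>) \<and> (\<exists>e. alternates (half_cos m c') {0<..<pi} n e)"
    using assms[OF c'(2)] by (intro exI[of _ "\<lambda>k. M (node k) * c' k"]) blast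
qed

lemma keeps_limit:
  assumes "\<And>m \<eta>. 0 < \<eta> \<Longrightarrow> \<exists>M'. keeps M' \<and> (\<forall>k\<le>m. \<bar>M' (node k) - M (node k)\<bar> < \<eta>)"
  shows "keeps M"
  unfolding keeps_def
proof (intro allI impI osc_closed)
  fix n m c and \<eta> :: real assume c: "osc n m c" and \<eta>: "0 < \<eta>"
  obtain M' where M': "keeps M'" "\<And>k. k \<le> m \<Longrightarrow> \<bar>M' (node k) - M (node k)\<bar> < \<eta> / (1 + (\<Sum>i\<le>m. \<bar>c i\<bar>))"
    using assms[OF small_bound_pos[OF \<eta>, where f = c and m = m], of m] by blast
  have "\<bar>M' (node k) * c k - M (node k) * c k\<bar> < \<eta>" if "k \<le> m" for k
    using mult_small[OF \<eta> M'(2)[OF that] that] by (simp add: algebra_simps)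
  then show "\<exists>c'. (\<forall>k\<le>m. \<bar>c' k - M (node k) * c k\<bar> < \<eta>) \<and> osc n m c'"
    using keepsD[OF M'(1) c] by (intro exI[of _ "\<lambda>k. M' (node k) * c k"]) simp
qed



lemma keeps_family_limit:
  assumes "F \<noteq> bot" and "\<forall>\<^sub>F s in F. keeps (M' s)" and "\<And>x. ((\<lambda>s. M' s x) \<longlongrightarrow> M x) F"
  shows "keeps M"
proof (rule keeps_limit)
  fix m and \<eta> :: real assume \<eta>: "0 < \<eta>"
  have "\<forall>\<^sub>F s in F. \<forall>k\<in>{..m}. \<bar>M' s (node k) - M (node k)\<bar> < \<eta>"
    using assms(3) \<eta> by (intro eventually_ball_finite) (auto simp: tendsto_iff dist_real_def)
  with assms(2) have "\<forall>\<^sub>F s in F. keeps (M' s) \<and> (\<forall>k\<in>{..m}. \<bar>M' s (node k) - M (node k)\<bar> < \<eta>)"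
    by (rule eventually_conj)
  from eventually_happens'[OF assms(1) this]
  obtain s where "keeps (M' s)" "\<forall>k\<in>{..m}. \<bar>M' s (node k) - M (node k)\<bar> < \<eta>"
    by blast
  then show "\<exists>M'. keeps M' \<and> (\<forall>k\<le>m. \<bar>M' (node k) - M (node k)\<bar> < \<eta>)"
    by (intro exI[of _ "M' s"]) simp
qed

lemma keeps_mult: "keeps M \<Longrightarrow> keeps N \<Longrightarrow> keeps (\<lambda>x. M x * N x)"
  by (subst keeps_def, intro allI impI, subst mult.assoc, intro keepsD)

lemma alternates_cmult:
  assumes "alternates f S n e" "r \<noteq> 0"
  shows "alternates (\<lambda>t. r * f t) S n (e / r)"
proof -
  have "e / r * (-1) ^ i * (r * f t) = e * (-1) ^ i * f t" for i t
    using assms(2) by simp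
  then show ?thesis using assms(1) unfolding alternates_def by (simp only:)
qed

lemma keeps_const:
  assumes r: "r \<noteq> 0"
  shows "keeps (\<lambda>_. r)"
  unfolding keeps_def
proof (intro allI impI)
  fix n m c assume c: "osc n m c"
  show "osc n m (\<lambda>k. r * c k)"
    unfolding osc_def
  proof (intro allI impI)
    fix \<eta> :: real assume "0 < \<eta>"
    then have "0 < \<eta> / \<bar>r\<bar>" using r by simp
    then obtain c' e where c': "\<And>k. k \<le> m \<Longrightarrow> \<bar>c' k - c k\<bar> < \<eta> / \<bar>r\<bar>" "alternates (half_cos m c') {0<..<pi} n e"
      using c unfolding osc_def by blast
    have "\<bar>r * c' k - r * c k\<bar> < \<eta>" if "k \<le> m" for k
    proof -
      have "\<bar>r * c' k - r * c k\<bar> = \<bar>r\<bar> * \<bar>c' k - c k\<bar>" by (simp flip: right_diff_distrib abs_mult)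
      also have "\<dots> < \<eta>" using c'(1)[OF that] r by (simp add: field_simps)
      finally show ?thesis .
    qed
    moreover have "half_cos m (\<lambda>k. r * c' k) = (\<lambda>t. r * half_cos m c' t)" by (simp add: half_cos_cmult fun_eq_iff)
    then have "alternates (half_cos m (\<lambda>k. r * c' k)) {0<..<pi} n (e / r)"
      using alternates_cmult[OF c'(2) r] by metis
    ultimately show "\<exists>c'. (\<forall>k\<le>m. \<bar>c' k - r * c k\<bar> < \<eta>) \<and> (\<exists>e. alternates (half_cos m c') {0<..<pi} n e)"
      by (intro exI[of _ "\<lambda>k. r * c' k"] exI[of _ "e / r"] conjI allI impI)
  qed
qed

lemma half_cos_derivs:
  fixes c :: "nat \<Rightarrow> real" and m :: nat
  defines "f1 \<equiv> half_sin m (\<lambda>k. - ((real k + 1/2) * c k))"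
    and "f2 \<equiv> half_cos m (\<lambda>k. - (node k * c k))"
    and "f3 \<equiv> half_sin m (\<lambda>k. (real k + 1/2) * node k * c k)"
    and "f4 \<equiv> half_cos m (\<lambda>k. (node k)\<^sup>2 * c k)"
  shows "(half_cos m c has_real_derivative f1 t) (at t)" "(f1 has_real_derivative f2 t) (at t)"
    "(f2 has_real_derivative f3 t) (at t)" "(f3 has_real_derivative f4 t) (at t)"
    "f1 0 = 0" "f3 0 = 0" "half_cos m c pi = 0" "f2 pi = 0"
proof -
  show "(half_cos m c has_real_derivative f1 t) (at t)"
    unfolding f1_def by (rule has_derivative_half_cos)
  show "(f1 has_real_derivative f2 t) (at t)"
    using has_derivative_half_sin[of m "\<lambda>k. - ((real k + 1/2) * c k)" t]
    by (simp add: f1_def f2_def node_def power2_eq_square mult.assoc)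
  show "(f2 has_real_derivative f3 t) (at t)"
    using has_derivative_half_cos[of m "\<lambda>k. - (node k * c k)" t]
    by (simp add: f2_def f3_def mult.assoc)
  show "(f3 has_real_derivative f4 t) (at t)"
    using has_derivative_half_sin[of m "\<lambda>k. (real k + 1/2) * node k * c k" t]
    by (simp add: f3_def f4_def node_def power2_eq_square mult.assoc)
qed (auto simp: f1_def f2_def f3_def half_sin_0 half_cos_pi)

section \<open>Multipliers of real pairs and of complex quadruples\<close>

lemma keeps_real_aux:
  assumes u: "\<And>t. (u has_real_derivative u1 t) (at t)" "\<And>t. (u1 has_real_derivative - s * u t) (at t)"
    and "u1 0 = 0" and pos: "\<And>t. 0 \<le> t \<Longrightarrow> t \<le> pi \<Longrightarrow> 0 < u t"
  shows "keeps (\<lambda>x. x - s)"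
proof (rule keepsI)
  fix n m c e assume alt: "alternates (half_cos m c) {0<..<pi} n e"
  have "alternates (\<lambda>t. - (half_cos m (\<lambda>k. - (node k * c k)) t + s * half_cos m c t)) {0<..<pi} n e"
    by (rule second_order_no_loss[OF half_cos_derivs(1,2) u half_cos_derivs(5) \<open>u1 0 = 0\<close> half_cos_derivs(7) pos alt])
  also have "(\<lambda>t. - (half_cos m (\<lambda>k. - (node k * c k)) t + s * half_cos m c t))
      = half_cos m (\<lambda>k. (node k - s) * c k)"
    by (simp add: half_cos_def fun_eq_iff sum_distrib_left algebra_simps flip: sum.distrib sum_negf sum_subtractf)
  finally show "alternates (half_cos m (\<lambda>k. (node k - s) * c k)) {0<..<pi} n e" .
qed

text \<open>The even solution is \<open>cos (sqrt s t)\<close>, whose argument stays below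
  \<open>pi / 2\<close> up to \<open>t = pi\<close> because \<open>sqrt s < 1/2\<close>; for
  negative \<open>s\<close> it is a hyperbolic cosine.\<close>

lemma keeps_real_strict:
  assumes "s < 1/4"
  shows "keeps (\<lambda>x. x - s)"
proof (cases "0 \<le> s")
  case True
  define a where "a = sqrt s"
  have a: "0 \<le> a" "a\<^sup>2 = s" using True by (auto simp: a_def)
  have "a < 1/2" using assms a by (metis power2_less_imp_less power_one_over real_sqrt_four real_sqrt_pow2 zero_le_divide_1_iff zero_le_numeral)
  show ?thesis
  proof (rule keeps_real_aux[where u = "\<lambda>t. cos (a * t)" and ?u1.0 = "\<lambda>t. - (a * sin (a * t))"])
    show "0 < cos (a * t)" if "0 \<le> t" "t \<le> pi" for t
    proof (rule cos_gt_zero_pi)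
      have "a * t \<le> a * pi" using a that by (intro mult_left_mono) auto
      also have "\<dots> < 1/2 * pi" using \<open>a < 1/2\<close> by (intro mult_strict_right_mono) auto
      finally show "a * t < pi / 2" by simp
      have "0 \<le> a * t" using a that by simp
      then show "- (pi / 2) < a * t" using pi_gt_zero by linarith
    qed
    show "((\<lambda>t. - (a * sin (a * t))) has_real_derivative - s * cos (a * t)) (at t)" for t
      by (auto intro!: derivative_eq_intros simp: a(2)[symmetric] power2_eq_square)
  qed (auto intro!: derivative_eq_intros)
next
  case False
  define a where "a = sqrt (- s)"
  have a: "a * a = - s" using False by (simp add: a_def)
  show ?thesis
  proof (rule keeps_real_aux[where u = "\<lambda>t. cosh (a * t)" and ?u1.0 = "\<lambda>t. a * sinh (a * t)"])
    show "((\<lambda>t. a * sinh (a * t)) has_real_derivative - s * cosh (a * t)) (at t)" for t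
      by (auto intro!: derivative_eq_intros simp: a[symmetric])
  qed (auto intro!: derivative_eq_intros simp: cosh_real_pos)
qed

lemma keeps_real:
  assumes "s \<le> 1/4"
  shows "keeps (\<lambda>x. x - s)"
proof (rule keeps_family_limit[where F = "at_left s" and M' = "\<lambda>s x. x - s"])
  show "\<forall>\<^sub>F s' in at_left s. keeps (\<lambda>x. x - s')"
    unfolding eventually_at_left_field using assms
    by (intro exI[of _ "s - 1"]) (auto intro!: keeps_real_strict)
  show "((\<lambda>s. x - s) \<longlongrightarrow> x - s) (at_left s)" for x
    by (auto intro!: tendsto_intros)
qed auto

text \<open>\<open>V\<close> vanishes at 0 and is positive elsewhere, while \<open>U\<close> is
  positive at 0; hence \<open>V + \<epsilon> U\<close> is positive for small
  \<open>\<epsilon> > 0\<close>. On the compact set where \<open>U\<close> is nonpositive,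
  \<open>V\<close> has a positive minimum, and this limits \<open>\<epsilon>\<close>.\<close>

lemma keeps_fourth_order_aux:
  assumes U: "\<And>t. (U has_real_derivative U1 t) (at t)"
      "\<And>t. (U1 has_real_derivative - \<alpha> * U t - \<beta> * V t) (at t)"
    and V: "\<And>t. (V has_real_derivative V1 t) (at t)"
      "\<And>t. (V1 has_real_derivative - \<gamma> * V t + \<delta> * U t) (at t)"
    and UV0: "U1 0 = 0" "V1 0 = 0" "0 < U 0" "V 0 = 0"
    and pos: "\<And>t. 0 < t \<Longrightarrow> t \<le> pi \<Longrightarrow> 0 < V t"
    and W: "\<And>t. 0 < t \<Longrightarrow> t \<le> pi \<Longrightarrow> 0 < U t * V1 t - V t * U1 t"
    and Wpi: "0 < \<delta> * (U pi)\<^sup>2 + \<beta> * (V pi)\<^sup>2 + (\<alpha> - \<gamma>) * U pi * V pi"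
  shows "keeps (\<lambda>x. x\<^sup>2 - (\<alpha> + \<gamma>) * x + (\<alpha> * \<gamma> + \<beta> * \<delta>))"
proof (rule keepsI)
  have cont: "continuous_on A U" "continuous_on A V" for A
    using U(1) V(1) by (meson DERIV_isCont continuous_at_imp_continuous_on)+
  have "\<exists>\<epsilon>. \<forall>t\<in>{0..pi}. 0 < V t + \<epsilon> * U t"
  proof (cases "{t\<in>{0..pi}. U t \<le> 0} = {}")
    case True
    then have "0 < U t" if "t \<in> {0..pi}" for t using that by force
    moreover have "0 \<le> V t" if "t \<in> {0..pi}" for t
      using that pos[of t] UV0 by (cases "t = 0") auto
    ultimately show ?thesis by (intro exI[of _ 1]) (force intro: add_nonneg_pos)
  next
    case False
    have "closed {t\<in>{0..pi}. U t \<le> 0}"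
      by (intro continuous_on_closed_Collect_le cont continuous_intros closed_atLeastAtMost)
    then have "compact {t\<in>{0..pi}. U t \<le> 0}"
      by (intro compact_eq_bounded_closed[THEN iffD2] conjI)
         (rule bounded_subset[OF bounded_closed_interval[of 0 pi]], auto)
    then obtain t0 where t0: "t0 \<in> {0..pi}" "U t0 \<le> 0"
        and min: "\<And>t. t \<in> {0..pi} \<Longrightarrow> U t \<le> 0 \<Longrightarrow> V t0 \<le> V t"
      using continuous_attains_inf[OF _ False, of V] cont by auto
    have Vt0: "0 < V t0" using t0 UV0 pos[of t0] by (cases "t0 = 0") auto
    have "bounded (U ` {0..pi})"
      by (intro compact_imp_bounded compact_continuous_image cont) auto
    then obtain B where B: "0 < B" "\<And>t. t \<in> {0..pi} \<Longrightarrow> \<bar>U t\<bar> \<le> B"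
      unfolding bounded_pos by auto
    define \<epsilon> where "\<epsilon> = V t0 / (2 * B)"
    have "0 < \<epsilon>" using Vt0 B by (simp add: \<epsilon>_def)
    have "0 < V t + \<epsilon> * U t" if t: "t \<in> {0..pi}" for t
    proof (cases "U t \<le> 0")
      case True
      have "\<epsilon> * \<bar>U t\<bar> \<le> \<epsilon> * B" using B(2)[OF t] \<open>0 < \<epsilon>\<close> by (intro mult_left_mono) auto
      also have "\<dots> < V t0" using B Vt0 by (simp add: \<epsilon>_def)
      also have "\<dots> \<le> V t" using min[OF t True] .
      finally show ?thesis using True by simp
    next
      case False
      moreover have "0 \<le> V t" using t pos[of t] UV0 by (cases "t = 0") auto
      ultimately show ?thesis using \<open>0 < \<epsilon>\<close> by (simp add: add_nonneg_pos)
    qed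
    then show ?thesis by blast
  qed
  then obtain \<epsilon> where "\<forall>t\<in>{0..pi}. 0 < V t + \<epsilon> * U t" ..
  then have \<epsilon>: "0 < V t + \<epsilon> * U t" if "0 \<le> t" "t \<le> pi" for t using that by simp
  fix n m c e assume alt: "alternates (half_cos m c) {0<..<pi} n e"
  have "alternates (\<lambda>t. half_cos m (\<lambda>k. (node k)\<^sup>2 * c k) t + (\<alpha> + \<gamma>) * half_cos m (\<lambda>k. - (node k * c k)) t
          + (\<alpha> * \<gamma> + \<beta> * \<delta>) * half_cos m c t) {0<..<pi} n e"
    by (rule fourth_order_no_loss[OF half_cos_derivs(1-4) U V half_cos_derivs(5-8) UV0(1,2) \<epsilon> W Wpi alt])
  also have "(\<lambda>t. half_cos m (\<lambda>k. (node k)\<^sup>2 * c k) t + (\<alpha> + \<gamma>) * half_cos m (\<lambda>k. - (node k * c k)) t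
          + (\<alpha> * \<gamma> + \<beta> * \<delta>) * half_cos m c t)
      = half_cos m (\<lambda>k. ((node k)\<^sup>2 - (\<alpha> + \<gamma>) * node k + (\<alpha> * \<gamma> + \<beta> * \<delta>)) * c k)"
    unfolding half_cos_def fun_eq_iff
    by (auto simp: sum_distrib_left algebra_simps simp flip: sum.distrib)
  finally show "alternates (half_cos m (\<lambda>k. ((node k)\<^sup>2 - (\<alpha> + \<gamma>) * node k + (\<alpha> * \<gamma> + \<beta> * \<delta>)) * c k)) {0<..<pi} n e" .
qed

lemma less_sinh: "0 < x \<Longrightarrow> x < sinh (x::real)"
proof -
  assume "0 < x"
  have "sinh 0 - 0 < sinh x - x"
  proof (rule DERIV_pos_imp_increasing_open[OF \<open>0 < x\<close>])
    fix t :: real assume "0 < t" "t < x"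
    then have "1 < cosh t" using cosh_real_strict_mono[of 0 t] by simp
    then show "\<exists>y. ((\<lambda>t. sinh t - t) has_real_derivative y) (at t) \<and> 0 < y"
      by (intro exI[of _ "cosh t - 1"]) (auto intro!: derivative_eq_intros)
  qed (auto intro!: continuous_intros)
  then show ?thesis by simp
qed

text \<open>Here \<open>U + i V = cos ((a - i b) t)\<close>, which gives \<alpha> = \<gamma> =
  \<open>a\<^sup>2 - b\<^sup>2\<close> and \<beta> = \<delta> = \<open>2 a b\<close>. The bound
  \<open>a < 1\<close> keeps \<open>sin (a t)\<close>, hence \<open>V\<close>, positive up to
  \<open>pi\<close>.\<close>

lemma keeps_complex_strict:
  assumes "0 < a" "a < 1" "0 < b"
  shows "keeps (\<lambda>x. (x - (a\<^sup>2 - b\<^sup>2))\<^sup>2 + (2 * a * b)\<^sup>2)"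
proof -
  define p where "p = a\<^sup>2 - b\<^sup>2"
  define r where "r = 2 * a * b"
  define U where "U t = cos (a * t) * cosh (b * t)" for t
  define V where "V t = sin (a * t) * sinh (b * t)" for t
  define U1 where "U1 t = b * cos (a * t) * sinh (b * t) - a * sin (a * t) * cosh (b * t)" for t
  define V1 where "V1 t = a * cos (a * t) * sinh (b * t) + b * sin (a * t) * cosh (b * t)" for t
  have Vpos: "0 < V t" if "0 < t" "t \<le> pi" for t
  proof -
    have "a * t < 1 * pi" using assms that by (intro mult_less_le_imp_less) auto
    moreover have "0 < a * t" using assms that by simp
    ultimately have "0 < sin (a * t)" by (intro sin_gt_zero) auto
    moreover have "0 < sinh (b * t)" using assms that by simp
    ultimately show ?thesis by (simp add: V_def)
  qed
  have "keeps (\<lambda>x. x\<^sup>2 - (p + p) * x + (p * p + r * r))"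
  proof (rule keeps_fourth_order_aux[where U = U and V = V and ?U1.0 = U1 and ?V1.0 = V1])
    show "(U has_real_derivative U1 t) (at t)" "(V has_real_derivative V1 t) (at t)" for t
      unfolding U_def[abs_def] V_def[abs_def] U1_def V1_def
      by (auto intro!: derivative_eq_intros simp: algebra_simps)
    show "(U1 has_real_derivative - p * U t - r * V t) (at t)" "(V1 has_real_derivative - p * V t + r * U t) (at t)" for t
      unfolding U_def V_def U1_def[abs_def] V1_def[abs_def] p_def r_def
      by (auto intro!: derivative_eq_intros simp: algebra_simps power2_eq_square)
    show "0 < U t * V1 t - V t * U1 t" if t: "0 < t" "t \<le> pi" for t
    proof -
      let ?c = "cos (a * t)" and ?s = "sin (a * t)" and ?ch = "cosh (b * t)" and ?sh = "sinh (b * t)"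
      have "?c\<^sup>2 + ?s\<^sup>2 = 1" "?ch\<^sup>2 - ?sh\<^sup>2 = 1" by (auto simp: cosh_square_eq)
      moreover have "U t * V1 t - V t * U1 t = a * (?sh * ?ch) * (?c\<^sup>2 + ?s\<^sup>2) + b * (?s * ?c) * (?ch\<^sup>2 - ?sh\<^sup>2)"
        unfolding U_def V_def U1_def V1_def by algebra
      ultimately have eq: "U t * V1 t - V t * U1 t = a * (?sh * ?ch) + b * (?s * ?c)" by simp
      \<comment> \<open>Both terms of the Wronskian are compared with \<open>a b t\<close>: the
        hyperbolic product exceeds \<open>b t\<close>, and the trigonometric one is at most
        \<open>a t\<close> in absolute value.\<close>
      have "b * t < ?sh" using less_sinh assms t by simp
      moreover have "?sh * 1 \<le> ?sh * ?ch"
        using cosh_real_ge_1[of "b * t"] assms t by (intro mult_left_mono) auto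
      ultimately have "b * t < ?sh * ?ch" by simp
      then have "a * (b * t) < a * (?sh * ?ch)" using assms by simp
      moreover have "\<bar>?s * ?c\<bar> \<le> a * t"
      proof -
        have "\<bar>?s * ?c\<bar> \<le> \<bar>?s\<bar> * 1" unfolding abs_mult by (intro mult_left_mono) auto
        also have "\<dots> \<le> a * t" using abs_sin_x_le_abs_x[of "a * t"] assms t by simp
        finally show ?thesis .
      qed
      then have "b * \<bar>?s * ?c\<bar> \<le> b * (a * t)" using assms by (intro mult_left_mono) auto
      moreover have "b * (- \<bar>?s * ?c\<bar>) \<le> b * (?s * ?c)" using assms by (intro mult_left_mono) auto
      ultimately show ?thesis unfolding eq by (simp only: mult_minus_right) (simp only: mult.left_commute)
    qed
    have "0 < r * (V pi)\<^sup>2" using Vpos[of pi] assms by (simp add: r_def)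
    moreover have "0 \<le> r * (U pi)\<^sup>2" using assms by (simp add: r_def)
    ultimately show "0 < r * (U pi)\<^sup>2 + r * (V pi)\<^sup>2 + (p - p) * U pi * V pi" by simp
  qed (use Vpos in \<open>auto simp: U_def V_def U1_def V1_def\<close>)
  also have "(\<lambda>x. x\<^sup>2 - (p + p) * x + (p * p + r * r)) = (\<lambda>x. (x - (a\<^sup>2 - b\<^sup>2))\<^sup>2 + (2 * a * b)\<^sup>2)"
    by (simp add: fun_eq_iff p_def r_def power2_eq_square algebra_simps)
  finally show ?thesis .
qed

lemma keeps_complex:
  assumes "0 < a" "a \<le> 1" "0 < b"
  shows "keeps (\<lambda>x. (x - (a\<^sup>2 - b\<^sup>2))\<^sup>2 + (2 * a * b)\<^sup>2)"
proof (rule keeps_family_limit[where F = "at_left a" and M' = "\<lambda>a x. (x - (a\<^sup>2 - b\<^sup>2))\<^sup>2 + (2 * a * b)\<^sup>2"])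
  show "\<forall>\<^sub>F a in at_left a. keeps (\<lambda>x. (x - (a\<^sup>2 - b\<^sup>2))\<^sup>2 + (2 * a * b)\<^sup>2)"
    unfolding eventually_at_left_field using assms
    by (intro exI[of _ 0]) (auto intro!: keeps_complex_strict)
  show "((\<lambda>a. (x - (a\<^sup>2 - b\<^sup>2))\<^sup>2 + (2 * a * b)\<^sup>2) \<longlongrightarrow> (x - (a\<^sup>2 - b\<^sup>2))\<^sup>2 + (2 * a * b)\<^sup>2) (at_left a)" for x
    by (intro tendsto_intros)
qed auto

lemma half_less_sin:
  assumes "0 < x" "x \<le> pi / 2" shows "x / 2 < sin (x::real)"
proof -
  let ?y = "x / 2"
  have "sin 0 - 0 * cos 0 < sin ?y - ?y * cos ?y"
  proof (rule DERIV_pos_imp_increasing_open[of 0 ?y "\<lambda>t. sin t - t * cos t"])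
    fix t :: real assume t: "0 < t" "t < ?y"
    have "0 < sin t" using t assms by (intro sin_gt_zero) auto
    then show "\<exists>d. ((\<lambda>t. sin t - t * cos t) has_real_derivative d) (at t) \<and> 0 < d"
      using t by (intro exI[of _ "t * sin t"]) (auto intro!: derivative_eq_intros)
  qed (use assms in \<open>auto intro!: continuous_intros\<close>)
  then have *: "?y * cos ?y < sin ?y" by simp
  have "0 < cos ?y" using assms by (intro cos_gt_zero_pi) auto
  with * have "2 * (?y * cos ?y) * cos ?y < 2 * sin ?y * cos ?y" by simp
  also have "2 * sin ?y * cos ?y = sin x" using sin_double[of ?y] by simp
  finally have "x * (cos ?y)\<^sup>2 < sin x" by (simp add: power2_eq_square)
  moreover have "(cos ?y)\<^sup>2 = (1 + cos x) / 2" using cos_double_cos[of ?y] by simp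
  then have "x * (cos ?y)\<^sup>2 = x / 2 + x * cos x / 2" by (simp add: field_simps)
  moreover have "0 \<le> x * cos x" using assms by (intro mult_nonneg_nonneg cos_ge_zero) auto
  ultimately show ?thesis by linarith
qed

text \<open>The even solutions are \<open>cos (a t)\<close> and \<open>cos (b t)\<close>, and their
  difference is positive because cosine decreases on \<open>[0, pi]\<close> and
  \<open>b < 1\<close>. At \<open>pi\<close> the boundary quantity reduces to
  \<open>(s2 - s1) cos (a pi) cos (b pi)\<close>, which is positive because \<open>a\<close> and
  \<open>b\<close> both exceed 1/2.\<close>

lemma keeps_pair_strict:
  assumes "1/4 < s1" "s1 < s2" "s2 < 1"
  shows "keeps (\<lambda>x. (x - s1) * (x - s2))"
proof -
  define a where "a = sqrt s1"
  define b where "b = sqrt s2"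
  have a2: "a * a = s1" "b * b = s2" using assms by (auto simp: a_def b_def)
  have ab: "1/2 < a" "a < b" "b < 1"
  proof -
    show "1/2 < a" unfolding a_def using assms by (intro real_less_rsqrt) (auto simp: power2_eq_square)
    show "a < b" unfolding a_def b_def using assms by simp
    show "b < 1" unfolding b_def using assms by simp
  qed
  define U where "U t = cos (a * t)" for t
  define V where "V t = cos (a * t) - cos (b * t)" for t
  define U1 where "U1 t = - (a * sin (a * t))" for t
  define V1 where "V1 t = b * sin (b * t) - a * sin (a * t)" for t
  have ranges: "0 < a * t" "a * t < b * t" "b * t < pi" if "0 < t" "t \<le> pi" for t
  proof -
    show "0 < a * t" "a * t < b * t" using ab that by auto
    have "b * t < 1 * pi" using ab that by (intro mult_less_le_imp_less) auto
    then show "b * t < pi" by simp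
  qed
  have "keeps (\<lambda>x. x\<^sup>2 - (s1 + s2) * x + (s1 * s2 + 0 * (s2 - s1)))"
  proof (rule keeps_fourth_order_aux[where U = U and V = V and ?U1.0 = U1 and ?V1.0 = V1])
    show "(U has_real_derivative U1 t) (at t)" "(V has_real_derivative V1 t) (at t)"
      "(U1 has_real_derivative - s1 * U t - 0 * V t) (at t)"
      "(V1 has_real_derivative - s2 * V t + (s2 - s1) * U t) (at t)" for t
      unfolding U_def[abs_def] V_def[abs_def] U1_def[abs_def] V1_def[abs_def] a2[symmetric]
      by (auto intro!: derivative_eq_intros simp: algebra_simps)
    show "0 < V t" if "0 < t" "t \<le> pi" for t
      using ranges[OF that] cos_monotone_0_pi[of "a * t" "b * t"] by (simp add: V_def)
    show "0 < U t * V1 t - V t * U1 t" if t: "0 < t" "t \<le> pi" for t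
    proof -
      define M where "M = (b - a) * t"
      define P where "P = (a + b) * t"
      have eq: "U t * V1 t - V t * U1 t = ((b - a) * sin P + (a + b) * sin M) / 2"
        unfolding U_def V_def U1_def V1_def M_def P_def
        by (simp add: distrib_right left_diff_distrib sin_add sin_diff) (simp add: algebra_simps)
      have M: "0 < M" "M < pi / 2"
      proof -
        show "0 < M" using ab t by (simp add: M_def)
        have "M < 1/2 * pi" unfolding M_def using ab t by (intro mult_less_le_imp_less) auto
        then show "M < pi / 2" by simp
      qed
      then have sM: "0 < sin M" by (intro sin_gt_zero) auto
      have ab0: "0 < b - a" "0 < a + b" using ab by auto
      show ?thesis
      proof (cases "P \<le> pi")
        case True
        have "0 \<le> sin P" using True ab t by (intro sin_ge_zero) (auto simp: P_def)
        then have "0 < (b - a) * sin P + (a + b) * sin M" using sM ab0 by (simp add: add_nonneg_pos)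
        then show ?thesis unfolding eq by simp
      next
        case False
        \<comment> \<open>The possibly negative term is at least \<open>-(b - a)\<close>. It is
          outweighed because \<open>sin M > M / 2\<close>, \<open>(a + b) M = (b - a) P\<close> and
          \<open>P > pi > 2\<close>.\<close>
        have "(b - a) * (- 1) \<le> (b - a) * sin P" using ab0 by (intro mult_left_mono) auto
        moreover have "(a + b) * (M / 2) < (a + b) * sin M"
          using half_less_sin[of M] M ab0 by (intro mult_strict_left_mono) auto
        moreover have "(a + b) * (M / 2) = (b - a) * (P / 2)" by (simp add: M_def P_def algebra_simps)
        moreover have "(b - a) * 1 < (b - a) * (P / 2)" using False pi_gt3 ab0 by (intro mult_strict_left_mono) auto
        ultimately show ?thesis unfolding eq by simp
      qed
    qed
    have "cos (a * pi) < 0" "cos (b * pi) < 0"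
      using ab ranges[of pi] by (auto intro!: cos_lt_zero_pi simp: field_simps)
    then have "0 < (s2 - s1) * (cos (a * pi) * cos (b * pi))"
      using assms by (simp add: mult_neg_neg)
    also have "\<dots> = (s2 - s1) * (U pi)\<^sup>2 + 0 * (V pi)\<^sup>2 + (s1 - s2) * U pi * V pi"
      by (simp add: U_def V_def power2_eq_square algebra_simps)
    finally show "0 < (s2 - s1) * (U pi)\<^sup>2 + 0 * (V pi)\<^sup>2 + (s1 - s2) * U pi * V pi" .
  qed (auto simp: U_def V_def U1_def V1_def)
  also have "(\<lambda>x. x\<^sup>2 - (s1 + s2) * x + (s1 * s2 + 0 * (s2 - s1))) = (\<lambda>x. (x - s1) * (x - s2))"
    by (simp add: fun_eq_iff power2_eq_square algebra_simps)
  finally show ?thesis .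
qed

lemma keeps_pair:
  assumes "1/4 \<le> s1" "s1 \<le> s2" "s2 \<le> 1"
  shows "keeps (\<lambda>x. (x - s1) * (x - s2))"
proof -
  \<comment> \<open>Contraction towards 1/2 moves both parameters into the open interval (1/4, 1);
    the additional \<open>\<tau> / 4\<close> separates them when \<open>s1 = s2\<close>.\<close>
  define l where "l \<tau> s = (1 - \<tau>) * s + \<tau> * (1/2)" for \<tau> s :: real
  show ?thesis
  proof (rule keeps_family_limit[where F = "at_right 0" and M' = "\<lambda>\<tau> x. (x - l \<tau> s1) * (x - (l \<tau> s2 + \<tau> / 4))"])
    show "\<forall>\<^sub>F \<tau> in at_right 0. keeps (\<lambda>x. (x - l \<tau> s1) * (x - (l \<tau> s2 + \<tau> / 4)))"
      unfolding eventually_at_right_field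
    proof (intro exI[of _ 1] conjI allI impI)
      fix \<tau> :: real assume \<tau>: "0 < \<tau>" "\<tau> < 1"
      have "(1 - \<tau>) * (1/4) \<le> (1 - \<tau>) * s1" "(1 - \<tau>) * s1 \<le> (1 - \<tau>) * s2" "(1 - \<tau>) * s2 \<le> (1 - \<tau>) * 1"
        using \<tau> assms by (auto intro!: mult_left_mono)
      then show "keeps (\<lambda>x. (x - l \<tau> s1) * (x - (l \<tau> s2 + \<tau> / 4)))"
        using \<tau> by (intro keeps_pair_strict; unfold l_def; argo)
    qed auto
    show "((\<lambda>\<tau>. (x - l \<tau> s1) * (x - (l \<tau> s2 + \<tau> / 4))) \<longlongrightarrow> (x - s1) * (x - s2)) (at_right 0)" for x
      unfolding l_def by (rule tendsto_eq_rhs, (rule tendsto_intros)+) auto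
  qed auto
qed

subsection \<open>From sign changes to real zeros\<close>

text \<open>\<open>quot_basis 1 k\<close> at \<open>2 cos t\<close> is
  \<open>cos ((k + 1/2) t) / cos (t/2)\<close>, a Chebyshev polynomial of the third kind in
  \<open>cos t\<close>. So this is the expansion of the quotient polynomials in that basis.\<close>

definition hpoly :: "nat \<Rightarrow> (nat \<Rightarrow> real) \<Rightarrow> real poly" where
  "hpoly m c = (\<Sum>k\<le>m. smult (c k) (quot_basis 1 k))"

lemma cos_quot_basis: "cos (t / 2) * poly (quot_basis 1 k) (2 * cos t) = cos ((real k + 1/2) * t)"
proof (induction "1::real" k rule: quot_basis.induct)
  case 2
  let ?c = "cos (t/2)" and ?s = "sin (t/2)"
  have "cos (t + t/2) = cos t * ?c - (2 * ?s * ?c) * ?s"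
    using sin_double[of "t/2"] by (simp only: cos_add) simp
  also have "\<dots> = cos t * ?c - (2 * ?s\<^sup>2) * ?c" by (simp add: power2_eq_square)
  also have "2 * ?s\<^sup>2 = 1 - cos t" using cos_double_sin[of "t/2"] by simp
  finally have "cos (t + t/2) = ?c * (2 * cos t - 1)" by (simp add: algebra_simps)
  then show ?case by (simp add: algebra_simps)
next
  case (3 k)
  have *: "cos ((real (Suc (Suc k)) + 1/2) * t) = 2 * cos t * cos ((real (Suc k) + 1/2) * t) - cos ((real k + 1/2) * t)"
  proof -
    let ?a = "(real (Suc k) + 1/2) * t"
    have "cos (?a + t) + cos (?a - t) = 2 * cos t * cos ?a" by (simp add: cos_add cos_diff)
    moreover have "?a + t = (real (Suc (Suc k)) + 1/2) * t" "?a - t = (real k + 1/2) * t" by (auto simp: algebra_simps)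
    ultimately show ?thesis by simp
  qed
  show ?case unfolding * 3[symmetric] by (simp add: algebra_simps)
qed simp

lemma half_cos_hpoly: "half_cos m c t = cos (t / 2) * poly (hpoly m c) (2 * cos t)"
  unfolding half_cos_def hpoly_def cos_quot_basis[symmetric]
  by (simp add: poly_sum sum_distrib_left algebra_simps)

lemma degree_quot_basis: "degree (quot_basis s k) \<le> k"
proof (induction s k rule: quot_basis.induct)
  case (3 s k)
  have "degree ([:0, 1:] * quot_basis s (Suc k)) \<le> Suc (Suc k)"
    using degree_mult_le[of "[:0, 1:]" "quot_basis s (Suc k)"] 3 by simp
  then show ?case using 3 by (auto intro!: degree_diff_le simp del: mult_pCons_left)
qed auto

lemma degree_hpoly: "degree (hpoly m c) \<le> m"
  unfolding hpoly_def
  by (intro degree_sum_le) (auto intro: order.trans[OF degree_smult_le] order.trans[OF degree_quot_basis])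

lemma poly_cpoly_hpoly:
  "poly (cpoly (hpoly m c)) z = (\<Sum>k\<le>m. of_real (c k) * poly (cpoly (quot_basis 1 k)) z)"
proof -
  have "cpoly (\<Sum>k\<in>A. f k) = (\<Sum>k\<in>A. cpoly (f k))" if "finite A" for A :: "nat set" and f
    using that by induction auto
  then show ?thesis by (simp add: hpoly_def poly_sum)
qed

lemma alternates_imp_roots:
  assumes "alternates (half_cos m c) {0<..<pi} n e"
  shows "\<exists>S. finite S \<and> card S = n \<and> (\<forall>r\<in>S. poly (hpoly m c) r = 0)"
proof -
  obtain y where y: "\<And>i. i \<le> n \<Longrightarrow> 0 < y i \<and> y i < pi \<and> 0 < e * (-1) ^ i * half_cos m c (y i)"
    "\<And>i. i < n \<Longrightarrow> y i < y (Suc i)"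
    using assms by (auto simp: alternates_def)
  let ?p = "poly (hpoly m c)"
  define x where "x i = 2 * cos (y i)" for i
  have sgn: "0 < e * (-1) ^ i * ?p (x i)" if "i \<le> n" for i
  proof -
    have "0 < cos (y i / 2)" using y(1)[OF that] by (intro cos_gt_zero_pi) auto
    moreover have "0 < cos (y i / 2) * (e * (-1) ^ i * ?p (x i))"
      using y(1)[OF that] by (simp add: half_cos_hpoly x_def mult_ac)
    ultimately show ?thesis by (simp add: zero_less_mult_iff)
  qed
  have x: "x (Suc i) < x i" if "i < n" for i
    using y(1)[of i] y(1)[of "Suc i"] y(2)[OF that] that by (auto simp: x_def intro!: cos_monotone_0_pi)
  have "\<exists>r. x (Suc i) < r \<and> r < x i \<and> ?p r = 0" if "i < n" for i
  proof -
    have "0 < (e * (-1) ^ i * ?p (x i)) * (e * (-1) ^ Suc i * ?p (x (Suc i)))"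
      using mult_pos_pos[OF sgn[of i] sgn[of "Suc i"]] that by (simp only: Suc_leI less_imp_le)
    also have "\<dots> = - ((e * (-1) ^ i)\<^sup>2 * (?p (x (Suc i)) * ?p (x i)))"
      by (simp add: power2_eq_square algebra_simps)
    finally have "?p (x (Suc i)) * ?p (x i) < 0"
      by (smt (verit) mult_nonneg_nonneg zero_le_power2)
    then show ?thesis using poly_IVT[OF x[OF that]] by auto
  qed
  then obtain r where r: "\<And>i. i < n \<Longrightarrow> x (Suc i) < r i \<and> r i < x i \<and> ?p (r i) = 0" by metis
  have xmono: "x j \<le> x i" if "i \<le> j" "j \<le> n" for i j
    using that
  proof (induction rule: dec_induct)
    case (step k)
    then show ?case using x[of k] by simp
  qed simp
  have less: "r j < r i" if "i < j" "j < n" for i j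
  proof -
    have "r j < x j" using r that by simp
    also have "x j \<le> x (Suc i)" using that by (intro xmono) auto
    also have "\<dots> < r i" using r that by simp
    finally show ?thesis .
  qed
  have "inj_on r {..<n}"
    by (intro inj_onI) (metis less lessThan_iff less_irrefl linorder_neqE_nat)
  then show ?thesis using r
    by (intro exI[of _ "r ` {..<n}"]) (auto simp: card_image)
qed

text \<open>
  Unlike real-rootedness, this passes to limits that may vanish identically.
\<close>

definition vertically_increasing :: "real poly \<Rightarrow> bool" where
  "vertically_increasing p \<longleftrightarrow>
     (\<forall>x y y'. \<bar>y'\<bar> \<le> \<bar>y\<bar> \<longrightarrow> norm (poly (cpoly p) (Complex x y')) \<le> norm (poly (cpoly p) (Complex x y)))"

text \<open>A nonreal zero would force zeros on the whole vertical segment from it down to the real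
  axis.\<close>

lemma vertically_increasing_imp_real_rooted:
  assumes "vertically_increasing p" "p \<noteq> 0"
  shows "real_rooted p"
  unfolding real_rooted_def
proof (intro allI impI)
  fix z assume z: "poly (cpoly p) z = 0"
  show "z \<in> \<real>"
  proof (rule ccontr)
    assume "z \<notin> \<real>"
    then have im: "Im z \<noteq> 0" by (simp add: complex_is_Real_iff)
    have "poly (cpoly p) (Complex (Re z) y) = 0" if "\<bar>y\<bar> \<le> \<bar>Im z\<bar>" for y
      using assms(1) that z unfolding vertically_increasing_def by (metis complex_surj norm_le_zero_iff norm_zero)
    then have "Complex (Re z) ` {0..\<bar>Im z\<bar>} \<subseteq> {w. poly (cpoly p) w = 0}" by auto
    moreover have "infinite (Complex (Re z) ` {0..\<bar>Im z\<bar>})"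
      using im by (subst finite_image_iff) (auto simp: inj_on_def infinite_Icc)
    ultimately have "infinite {w. poly (cpoly p) w = 0}" using infinite_super by blast
    then show False using poly_roots_finite[of "cpoly p"] assms(2) by auto
  qed
qed

lemma cpoly_mult: "cpoly (p * q) = cpoly p * cpoly q"
  by (intro poly_eqI) (simp add: cpoly_def coeff_map_poly coeff_mult)

lemma vertically_increasing_mult:
  assumes "vertically_increasing p" "vertically_increasing q"
  shows "vertically_increasing (p * q)"
  using assms unfolding vertically_increasing_def cpoly_mult poly_mult norm_mult
  by (auto intro!: mult_mono)

lemma vertically_increasing_linear:
  assumes "degree p \<le> 1"
  shows "vertically_increasing p"
proof -
  define a where "a = coeff p 0"
  define b where "b = coeff p 1"
  have p: "p = [:a, b:]"
    using assms by (intro poly_eqI) (auto simp: a_def b_def coeff_pCons coeff_eq_0 split: nat.splits)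
  have "norm (poly (cpoly p) (Complex x y)) = sqrt ((a + b * x)\<^sup>2 + (b * y)\<^sup>2)" for x y
    by (simp add: p cmod_def algebra_simps)
  moreover have "(b * y')\<^sup>2 \<le> (b * y)\<^sup>2" if "\<bar>y'\<bar> \<le> \<bar>y\<bar>" for y y'
    using that by (simp add: abs_le_square_iff[symmetric] abs_mult mult_left_mono)
  ultimately show ?thesis by (simp add: vertically_increasing_def)
qed

text \<open>Once the known roots are divided out, a real factor of degree at most one remains. This
  is why \<open>n\<close> sign changes suffice for degree \<open>n + 1\<close>: the last root needs
  none.\<close>

lemma many_roots_imp_vertically_increasing:
  assumes "finite S" "\<And>r. r \<in> S \<Longrightarrow> poly p r = 0" "degree p \<le> card S + 1"
  shows "vertically_increasing p"
  using assms
proof (induction S arbitrary: p rule: finite_induct)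
  case empty
  then show ?case by (simp add: vertically_increasing_linear)
next
  case (insert r S)
  show ?case
  proof (cases "p = 0")
    case True
    then show ?thesis by (simp add: vertically_increasing_linear)
  next
    case False
    obtain q where q: "p = [:-r, 1:] * q" using insert.prems(1)[of r] by (auto simp: poly_eq_0_iff_dvd elim: dvdE)
    have "q \<noteq> 0" using False q by auto
    then have "degree p = 1 + degree q" unfolding q by (subst degree_mult_eq) auto
    moreover have "poly q x = 0" if "x \<in> S" for x
      using insert.prems(1)[of x] insert.hyps that by (auto simp: q)
    ultimately have "vertically_increasing q" using insert by (intro insert.IH) auto
    then show ?thesis
      unfolding q by (intro vertically_increasing_mult[OF vertically_increasing_linear]) auto
  qed
qed

lemma osc_imp_vertically_increasing:
  assumes "osc n (n + 1) c"
  shows "vertically_increasing (hpoly (n + 1) c)"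
proof -
  have "\<exists>c'. (\<forall>k\<le>n+1. \<bar>c' k - c k\<bar> < inverse (real (Suc i))) \<and> (\<exists>e. alternates (half_cos (n+1) c') {0<..<pi} n e)" for i
    using assms unfolding osc_def by (simp del: of_nat_Suc)
  then obtain d where d: "\<And>i k. k \<le> n + 1 \<Longrightarrow> \<bar>d i k - c k\<bar> < inverse (real (Suc i))"
    "\<And>i. \<exists>e. alternates (half_cos (n+1) (d i)) {0<..<pi} n e" by metis
  have v: "vertically_increasing (hpoly (n + 1) (d i))" for i
  proof -
    obtain S where "finite S" "card S = n" "\<forall>r\<in>S. poly (hpoly (n + 1) (d i)) r = 0"
      using d(2)[of i] alternates_imp_roots by metis
    then show ?thesis using degree_hpoly[of "n + 1" "d i"]
      by (intro many_roots_imp_vertically_increasing[of S]) auto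
  qed
  have lim: "(\<lambda>i. d i k) \<longlonglongrightarrow> c k" if "k \<le> n + 1" for k
  proof (rule LIM_zero_cancel, rule Lim_null_comparison)
    show "\<forall>\<^sub>F i in sequentially. norm (d i k - c k) \<le> inverse (real (Suc i))"
      using d(1)[OF that] by (simp add: less_imp_le)
  qed (rule LIMSEQ_inverse_real_of_nat)
  have lim': "(\<lambda>i. poly (cpoly (hpoly (n + 1) (d i))) z) \<longlonglongrightarrow> poly (cpoly (hpoly (n + 1) c)) z" for z
    unfolding poly_cpoly_hpoly by (intro tendsto_sum tendsto_mult tendsto_of_real tendsto_const lim) auto
  show ?thesis
    unfolding vertically_increasing_def
  proof (intro allI impI)
    fix x y y' :: real assume "\<bar>y'\<bar> \<le> \<bar>y\<bar>"
    then have "norm (poly (cpoly (hpoly (n + 1) (d i))) (Complex x y')) \<le> norm (poly (cpoly (hpoly (n + 1) (d i))) (Complex x y))" for i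
      using v unfolding vertically_increasing_def by blast
    then show "norm (poly (cpoly (hpoly (n + 1) c)) (Complex x y')) \<le> norm (poly (cpoly (hpoly (n + 1) c)) (Complex x y))"
      by (intro LIMSEQ_le[OF tendsto_norm[OF lim'] tendsto_norm[OF lim']]) auto
  qed
qed


subsection \<open>The unperturbed pencil\<close>

text \<open>Multiplication by \<open>2 + 2 \<sigma> cos t\<close> on coefficients. At
  \<open>k = 0\<close> the neighbour with index -1 is \<open>c 0\<close>, because
  \<open>cos (- t/2) = cos (t/2)\<close>.\<close>

definition edge_mult :: "real \<Rightarrow> (nat \<Rightarrow> real) \<Rightarrow> nat \<Rightarrow> real" where
  "edge_mult \<sigma> c k = 2 * c k + \<sigma> * (c (Suc k) + (case k of 0 \<Rightarrow> c 0 | Suc j \<Rightarrow> c j))"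

text \<open>The last summand is the error of truncating at \<open>m\<close>; it vanishes as soon as
  \<open>c\<close> has no coefficients from \<open>m\<close> on.\<close>

lemma half_cos_edge_mult_aux:
  "half_cos m (edge_mult \<sigma> c) t = (2 + 2 * \<sigma> * cos t) * half_cos m c t
     + \<sigma> * (c (Suc m) * cos ((real m + 1/2) * t) - c m * cos ((real m + 3/2) * t))"
proof (induction m)
  case 0
  have "cos (t/2 + t) + cos (t/2 - t) = 2 * cos t * cos (t/2)" by (simp only: cos_add cos_diff) simp
  moreover have "t/2 + t = 3 * t / 2" "t/2 - t = - (t/2)" by auto
  ultimately have "cos (3 * t / 2) = 2 * cos t * cos (t/2) - cos (t/2)" by (simp only: cos_minus)
  then show ?case by (simp add: half_cos_def edge_mult_def) (simp add: algebra_simps)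
next
  case (Suc m)
  let ?a = "(real (Suc m) + 1/2) * t"
  have 1: "cos ((real (Suc m) + 3/2) * t) = 2 * cos t * cos ?a - cos ((real m + 1/2) * t)"
  proof -
    have "cos (?a + t) + cos (?a - t) = 2 * cos t * cos ?a" by (simp add: cos_add cos_diff)
    moreover have "?a + t = (real (Suc m) + 3/2) * t" "?a - t = (real m + 1/2) * t" by (auto simp: algebra_simps)
    ultimately show ?thesis by simp
  qed
  have 2: "cos ((real m + 3/2) * t) = cos ?a" by (simp add: add.commute)
  have 3: "half_cos (Suc m) d t = half_cos m d t + d (Suc m) * cos ?a" for d
    by (simp add: half_cos_def)
  have 4: "edge_mult \<sigma> c (Suc m) = 2 * c (Suc m) + \<sigma> * (c (Suc (Suc m)) + c m)"
    by (simp add: edge_mult_def)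
  show ?case unfolding 3 4 Suc.IH 1 2 by algebra
qed

lemma half_cos_edge_mult:
  assumes "\<And>k. m < k \<Longrightarrow> c k = 0"
  shows "half_cos (Suc m) (edge_mult \<sigma> c) t = (2 + 2 * \<sigma> * cos t) * half_cos m c t"
  using half_cos_edge_mult_aux[of "Suc m" \<sigma> c t] assms by (simp add: half_cos_def)

lemma half_cos_support:
  assumes "\<And>k. m < k \<Longrightarrow> c k = 0" "m \<le> m'"
  shows "half_cos m' c t = half_cos m c t"
  unfolding half_cos_def using assms by (intro sum.mono_neutral_right) auto

text \<open>
  The sign near the zero \<open>t = \<pi>\<close> (for \<open>\<sigma> = 1\<close>) or \<open>t = 0\<close> (for \<open>\<sigma> = -1\<close>) of
  \<open>2 + 2 \<sigma> cos t\<close> is recorded because multiplication by \<open>2 + 2 \<sigma> cos t - \<epsilon>\<close> creates the next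
  sign change there. The sequence \<open>e, -e, e, \<dots>\<close> of \<open>alternates\<close> ends with \<open>e (-1)\<^sup>n\<close> at
  \<open>\<pi>\<close>.
\<close>

definition edge_sign :: "real \<Rightarrow> (real \<Rightarrow> real) \<Rightarrow> nat \<Rightarrow> real \<Rightarrow> bool" where
  "edge_sign \<sigma> f n e \<longleftrightarrow>
     (if \<sigma> = 1 then \<exists>a<pi. \<forall>t. a < t \<and> t < pi \<longrightarrow> 0 < e * (-1) ^ n * f t
      else \<exists>a>0. \<forall>t. 0 < t \<and> t < a \<longrightarrow> 0 < e * f t)"

definition edge_osc :: "real \<Rightarrow> nat \<Rightarrow> nat \<Rightarrow> (nat \<Rightarrow> real) \<Rightarrow> bool" where
  "edge_osc \<sigma> n d c \<longleftrightarrow> (\<forall>k>d. c k = 0) \<and>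
     (\<exists>e. alternates (half_cos d c) {0<..<pi} n e \<and> edge_sign \<sigma> (half_cos d c) n e)"

text \<open>Unlike in \<open>osc\<close>, the approximants must also vanish above \<open>d\<close>:
  \<open>edge_mult\<close> reads the coefficient \<open>k + 1\<close>, so control up to
  \<open>d\<close> alone would not survive the next multiplication.\<close>

definition edge_osc_closure :: "real \<Rightarrow> nat \<Rightarrow> nat \<Rightarrow> (nat \<Rightarrow> real) \<Rightarrow> bool" where
  "edge_osc_closure \<sigma> n d c \<longleftrightarrow> (\<forall>k>d. c k = 0) \<and>
     (\<forall>\<eta>>0. \<exists>c'. edge_osc \<sigma> n d c' \<and> (\<forall>k. \<bar>c' k - c k\<bar> < \<eta>))"

text \<open>The factor \<open>2 + 2 cos t\<close> keeps all signs but creates none. Lowered by an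
  \<open>\<epsilon>\<close> below its value at the last alternation point, it stays positive at all
  of them and turns negative near \<open>pi\<close>, where \<open>edge_sign\<close> tells the sign
  of the function. This adds one alternation point.\<close>

lemma edge_osc_step_pi:
  assumes "edge_osc 1 n d c" "0 < \<eta>"
  shows "\<exists>\<epsilon>. 0 < \<epsilon> \<and> \<epsilon> < \<eta> \<and> edge_osc 1 (Suc n) (Suc d) (\<lambda>k. edge_mult 1 c k - \<epsilon> * c k)"
proof -
  have supp: "c k = 0" if "d < k" for k using assms(1) that by (simp add: edge_osc_def)
  obtain e where e: "alternates (half_cos d c) {0<..<pi} n e" "edge_sign 1 (half_cos d c) n e"
    using assms(1) by (auto simp: edge_osc_def)
  obtain y where y: "\<And>i. i \<le> n \<Longrightarrow> 0 < y i \<and> y i < pi \<and> 0 < e * (-1) ^ i * half_cos d c (y i)"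
      "\<And>i. i < n \<Longrightarrow> y i < y (Suc i)"
    using e(1) unfolding alternates_def by auto
  obtain a where a: "a < pi" "\<And>t. a < t \<Longrightarrow> t < pi \<Longrightarrow> 0 < e * (-1) ^ n * half_cos d c t"
    using e(2) unfolding edge_sign_def by auto
  have ymono: "y i \<le> y n" if "i \<le> n" for i
    using that
  proof (induction rule: inc_induct)
    case (step j)
    then show ?case using y(2)[of j] by simp
  qed simp
  have cosn: "0 < 2 + 2 * cos (y n)"
    using y(1)[of n] cos_monotone_0_pi[of "y n" pi] by simp
  define \<epsilon> where "\<epsilon> = min \<eta> (2 + 2 * cos (y n)) / 2"
  have \<epsilon>: "0 < \<epsilon>" "\<epsilon> < \<eta>" "\<epsilon> < 2 + 2 * cos (y n)"
    using cosn assms(2) by (auto simp: \<epsilon>_def)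
  define f where "f = half_cos (Suc d) (\<lambda>k. edge_mult 1 c k - \<epsilon> * c k)"
  have f: "f t = (2 + 2 * cos t - \<epsilon>) * half_cos d c t" for t
  proof -
    have "f t = half_cos (Suc d) (edge_mult 1 c) t - \<epsilon> * half_cos (Suc d) c t"
      unfolding f_def by (simp add: half_cos_def sum_subtractf sum_distrib_left algebra_simps)
    then show ?thesis
      using half_cos_edge_mult[of d c 1 t] half_cos_support[of d c "Suc d" t] supp by (simp add: algebra_simps)
  qed
  have "((\<lambda>t. 2 + 2 * cos t) \<longlongrightarrow> 2 + 2 * cos pi) (at_left pi)" by (intro tendsto_intros)
  then have "\<forall>\<^sub>F t in at_left pi. 2 + 2 * cos t < \<epsilon>" using \<epsilon>(1) by (intro order_tendstoD) auto
  moreover have "\<forall>\<^sub>F t in at_left pi. max a (y n) < t \<and> t < pi"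
    using a(1) y(1)[of n] by (auto simp: eventually_at_left_field intro!: exI[of _ "max a (y n)"])
  ultimately have "\<forall>\<^sub>F t in at_left pi. 2 + 2 * cos t < \<epsilon> \<and> max a (y n) < t \<and> t < pi" by eventually_elim auto
  then obtain s where s: "2 + 2 * cos s < \<epsilon>" "a < s" "y n < s" "s < pi"
    using eventually_happens'[of "at_left pi"] by force
  have neg: "2 + 2 * cos t - \<epsilon> < 0" if "s \<le> t" "t < pi" for t
    using s that y(1)[of n] cos_monotone_0_pi_le[of s t] by auto
  have edge: "0 < e * (-1) ^ Suc n * f t" if "s \<le> t" "t < pi" for t
  proof -
    have "0 < - (2 + 2 * cos t - \<epsilon>)" "0 < e * (-1) ^ n * half_cos d c t"
      using neg[OF that] a(2)[of t] s that by auto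
    then have "0 < (- (2 + 2 * cos t - \<epsilon>)) * (e * (-1) ^ n * half_cos d c t)" by (rule mult_pos_pos)
    then show ?thesis by (simp add: f algebra_simps)
  qed
  define y' where "y' i = (if i \<le> n then y i else s)" for i
  have "0 < y' i \<and> y' i < pi \<and> 0 < e * (-1) ^ i * f (y' i)" if i: "i \<le> Suc n" for i
  proof (cases "i \<le> n")
    case True
    have "cos (y n) \<le> cos (y i)"
      using y(1)[of i] y(1)[of n] True ymono[OF True] by (intro cos_monotone_0_pi_le) auto
    then have "0 < 2 + 2 * cos (y i) - \<epsilon>" "0 < e * (-1) ^ i * half_cos d c (y i)"
      using \<epsilon> y(1)[OF True] by auto
    then have "0 < (2 + 2 * cos (y i) - \<epsilon>) * (e * (-1) ^ i * half_cos d c (y i))" by (rule mult_pos_pos)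
    then show ?thesis using True y(1)[OF True] by (simp add: y'_def f algebra_simps)
  next
    case False
    then have "i = Suc n" using i by simp
    then show ?thesis using edge[of s] s y(1)[of n] by (simp add: y'_def)
  qed
  moreover have "y' i < y' (Suc i)" if "i < Suc n" for i
    using that y(2)[of i] s by (auto simp: y'_def less_Suc_eq)
  ultimately have "alternates f {0<..<pi} (Suc n) e"
    unfolding alternates_def by (intro exI[of _ y']) auto
  moreover have "edge_sign 1 f (Suc n) e"
    unfolding edge_sign_def using edge s(4) by (auto intro!: exI[of _ s])
  moreover have "edge_mult 1 c k - \<epsilon> * c k = 0" if "Suc d < k" for k
    using supp that by (auto simp: edge_mult_def split: nat.splits)
  ultimately show ?thesis using \<epsilon> unfolding edge_osc_def f_def by blast
qed

text \<open>The mirror image of \<open>edge_osc_step_pi\<close>. The new point now comes first, so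
  the leading sign becomes \<open>-e\<close>.\<close>

lemma edge_osc_step_zero:
  assumes "edge_osc (-1) n d c" "0 < \<eta>"
  shows "\<exists>\<epsilon>. 0 < \<epsilon> \<and> \<epsilon> < \<eta> \<and> edge_osc (-1) (Suc n) (Suc d) (\<lambda>k. edge_mult (-1) c k - \<epsilon> * c k)"
proof -
  have supp: "c k = 0" if "d < k" for k using assms(1) that by (simp add: edge_osc_def)
  obtain e where e: "alternates (half_cos d c) {0<..<pi} n e" "edge_sign (-1) (half_cos d c) n e"
    using assms(1) by (auto simp: edge_osc_def)
  obtain y where y: "\<And>i. i \<le> n \<Longrightarrow> 0 < y i \<and> y i < pi \<and> 0 < e * (-1) ^ i * half_cos d c (y i)"
      "\<And>i. i < n \<Longrightarrow> y i < y (Suc i)"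
    using e(1) unfolding alternates_def by auto
  obtain a where a: "0 < a" "\<And>t. 0 < t \<Longrightarrow> t < a \<Longrightarrow> 0 < e * half_cos d c t"
    using e(2) unfolding edge_sign_def by auto
  have ymono: "y 0 \<le> y i" if "i \<le> n" for i
    using that
  proof (induction i)
    case (Suc j)
    then show ?case using y(2)[of j] by simp
  qed simp
  have cosn: "0 < 2 - 2 * cos (y 0)"
    using y(1)[of 0] cos_monotone_0_pi[of 0 "y 0"] by simp
  define \<epsilon> where "\<epsilon> = min \<eta> (2 - 2 * cos (y 0)) / 2"
  have \<epsilon>: "0 < \<epsilon>" "\<epsilon> < \<eta>" "\<epsilon> < 2 - 2 * cos (y 0)"
    using cosn assms(2) by (auto simp: \<epsilon>_def)
  define f where "f = half_cos (Suc d) (\<lambda>k. edge_mult (-1) c k - \<epsilon> * c k)"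
  have f: "f t = (2 - 2 * cos t - \<epsilon>) * half_cos d c t" for t
  proof -
    have "f t = half_cos (Suc d) (edge_mult (-1) c) t - \<epsilon> * half_cos (Suc d) c t"
      unfolding f_def by (simp add: half_cos_def sum_subtractf sum_distrib_left algebra_simps)
    then show ?thesis
      using half_cos_edge_mult[of d c "-1" t] half_cos_support[of d c "Suc d" t] supp by (simp add: algebra_simps)
  qed
  have "((\<lambda>t. 2 - 2 * cos t) \<longlongrightarrow> 2 - 2 * cos 0) (at_right (0::real))" by (intro tendsto_intros)
  then have "\<forall>\<^sub>F t in at_right (0::real). 2 - 2 * cos t < \<epsilon>" using \<epsilon>(1) by (intro order_tendstoD) auto
  moreover have "\<forall>\<^sub>F t in at_right (0::real). 0 < t \<and> t < min a (y 0)"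
    using a(1) y(1)[of 0] by (auto simp: eventually_at_right_field intro!: exI[of _ "min a (y 0)"])
  ultimately have "\<forall>\<^sub>F t in at_right (0::real). 2 - 2 * cos t < \<epsilon> \<and> 0 < t \<and> t < min a (y 0)" by eventually_elim auto
  then obtain s where s: "2 - 2 * cos s < \<epsilon>" "0 < s" "s < a" "s < y 0"
    using eventually_happens'[of "at_right (0::real)"] by force
  have neg: "2 - 2 * cos t - \<epsilon> < 0" if "0 < t" "t \<le> s" for t
    using s that y(1)[of 0] cos_monotone_0_pi_le[of t s] by auto
  have edge: "0 < (-e) * f t" if "0 < t" "t \<le> s" for t
  proof -
    have "0 < - (2 - 2 * cos t - \<epsilon>)" "0 < e * half_cos d c t"
      using neg[OF that] a(2)[of t] s that by auto
    then have "0 < (- (2 - 2 * cos t - \<epsilon>)) * (e * half_cos d c t)" by (rule mult_pos_pos)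
    then show ?thesis by (simp add: f algebra_simps)
  qed
  define y' where "y' i = (case i of 0 \<Rightarrow> s | Suc j \<Rightarrow> y j)" for i
  have "0 < y' i \<and> y' i < pi \<and> 0 < (-e) * (-1) ^ i * f (y' i)" if i: "i \<le> Suc n" for i
  proof (cases i)
    case (Suc j)
    then have j: "j \<le> n" using i by simp
    have "cos (y j) \<le> cos (y 0)"
      using y(1)[of 0] y(1)[OF j] ymono[OF j] by (intro cos_monotone_0_pi_le) auto
    then have "0 < 2 - 2 * cos (y j) - \<epsilon>" "0 < e * (-1) ^ j * half_cos d c (y j)"
      using \<epsilon> y(1)[OF j] by auto
    then have "0 < (2 - 2 * cos (y j) - \<epsilon>) * (e * (-1) ^ j * half_cos d c (y j))" by (rule mult_pos_pos)
    then show ?thesis using Suc y(1)[OF j] by (simp add: y'_def f algebra_simps)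
  next
    case 0
    then show ?thesis using edge[of s] s y(1)[of 0] by (simp add: y'_def)
  qed
  moreover have "y' i < y' (Suc i)" if "i < Suc n" for i
    using that y(2)[of "i - 1"] s by (auto simp: y'_def split: nat.splits)
  ultimately have "alternates f {0<..<pi} (Suc n) (-e)"
    unfolding alternates_def by (intro exI[of _ y']) auto
  moreover have "edge_sign (-1) f (Suc n) (-e)"
    unfolding edge_sign_def using edge s(2) by (auto intro!: exI[of _ s])
  moreover have "edge_mult (-1) c k - \<epsilon> * c k = 0" if "Suc d < k" for k
    using supp that by (auto simp: edge_mult_def split: nat.splits)
  ultimately show ?thesis using \<epsilon> unfolding edge_osc_def f_def by blast
qed

lemma edge_mult_diff_le:
  assumes "\<sigma> = 1 \<or> \<sigma> = -1" "\<And>k. \<bar>c' k - c k\<bar> < \<eta>"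
  shows "\<bar>edge_mult \<sigma> c' k - edge_mult \<sigma> c k\<bar> < 4 * \<eta>"
  using assms(1) assms(2)[of k] assms(2)[of "Suc k"] assms(2)[of "k - 1"] assms(2)[of 0]
  by (auto simp: edge_mult_def abs_if split: nat.splits if_splits)

lemma edge_osc_closure_step:
  assumes \<sigma>: "\<sigma> = 1 \<or> \<sigma> = -1" and c: "edge_osc_closure \<sigma> n d c"
  shows "edge_osc_closure \<sigma> (Suc n) (Suc d) (edge_mult \<sigma> c)"
  unfolding edge_osc_closure_def
proof (intro conjI allI impI)
  show "edge_mult \<sigma> c k = 0" if "Suc d < k" for k
    using c that by (auto simp: edge_osc_closure_def edge_mult_def split: nat.splits)
  fix \<eta> :: real assume \<eta>: "0 < \<eta>"
  then have "0 < \<eta> / 8" by simp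
  then obtain c' where c': "edge_osc \<sigma> n d c'" "\<And>k. \<bar>c' k - c k\<bar> < \<eta> / 8"
    using c unfolding edge_osc_closure_def by blast
  define B where "B = 1 + (\<Sum>i\<le>d. \<bar>c' i\<bar>)"
  have B: "0 < B" by (simp add: B_def add_pos_nonneg sum_nonneg)
  have supp: "c' k = 0" if "d < k" for k using c'(1) that by (simp add: edge_osc_def)
  have cB: "\<bar>c' k\<bar> < B" for k
  proof (cases "k \<le> d")
    case True
    then show ?thesis using abs_le_sum[OF True, where f = c'] by (simp add: B_def)
  qed (use supp B in auto)
  obtain \<epsilon> where \<epsilon>: "0 < \<epsilon>" "\<epsilon> < \<eta> / (2 * B)" "edge_osc \<sigma> (Suc n) (Suc d) (\<lambda>k. edge_mult \<sigma> c' k - \<epsilon> * c' k)"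
    using \<sigma> edge_osc_step_pi[of n d c' "\<eta> / (2 * B)"] edge_osc_step_zero[of n d c' "\<eta> / (2 * B)"] c'(1) \<eta> B
    by auto
  have "\<bar>edge_mult \<sigma> c' k - \<epsilon> * c' k - edge_mult \<sigma> c k\<bar> < \<eta>" for k
  proof -
    have "\<bar>\<epsilon> * c' k\<bar> \<le> \<epsilon> * B" using cB[of k] \<epsilon>(1) by (simp add: abs_mult less_imp_le)
    also have "\<dots> < \<eta> / 2" using \<epsilon>(2) B by (simp add: field_simps)
    finally show ?thesis using edge_mult_diff_le[of \<sigma> c' c "\<eta> / 8" k, OF \<sigma> c'(2)] by linarith
  qed
  then show "\<exists>c''. edge_osc \<sigma> (Suc n) (Suc d) c'' \<and> (\<forall>k. \<bar>c'' k - edge_mult \<sigma> c k\<bar> < \<eta>)"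
    using \<epsilon>(3) by (intro exI[of _ "\<lambda>k. edge_mult \<sigma> c' k - \<epsilon> * c' k"]) blast
qed

lemma edge_osc_closure_iterate:
  assumes "\<sigma> = 1 \<or> \<sigma> = -1" "edge_osc_closure \<sigma> n d c"
  shows "edge_osc_closure \<sigma> (n + j) (d + j) ((edge_mult \<sigma> ^^ j) c)"
  using assms by (induction j) (auto intro: edge_osc_closure_step)

lemma edge_osc_closure_imp_osc: "edge_osc_closure \<sigma> n d c \<Longrightarrow> osc n d c"
  unfolding edge_osc_closure_def osc_def edge_osc_def by blast

lemma osc_limit:
  assumes "\<And>i. osc n m (d i)" "\<And>k. (\<lambda>i. d i k) \<longlonglongrightarrow> c k"
  shows "osc n m c"
proof (rule osc_closed)
  fix \<eta> :: real assume "0 < \<eta>"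
  then have "\<forall>\<^sub>F i in sequentially. \<forall>k\<in>{..m}. \<bar>d i k - c k\<bar> < \<eta>"
    using assms(2) by (intro eventually_ball_finite) (auto simp: tendsto_iff dist_real_def)
  then obtain i where "\<forall>k\<in>{..m}. \<bar>d i k - c k\<bar> < \<eta>"
    using eventually_happens'[OF sequentially_bot] by blast
  then show "\<exists>c'. (\<forall>k\<le>m. \<bar>c' k - c k\<bar> < \<eta>) \<and> osc n m c'"
    using assms(1)[of i] by (intro exI[of _ "d i"]) simp
qed

section \<open>Powers of the edge factor\<close>

definition edge_seq :: "real \<Rightarrow> nat \<Rightarrow> nat \<Rightarrow> real" where
  "edge_seq \<sigma> n = (edge_mult \<sigma> ^^ n) (\<lambda>k. if k = 0 then 1 else 0)"

lemma edge_seq_0: "edge_seq \<sigma> 0 k = (if k = 0 then 1 else 0)"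
  by (simp add: edge_seq_def)

lemma edge_seq_Suc: "edge_seq \<sigma> (Suc n) = edge_mult \<sigma> (edge_seq \<sigma> n)"
  by (simp add: edge_seq_def)

lemma edge_seq_support: "n < k \<Longrightarrow> edge_seq \<sigma> n k = 0"
  by (induction n arbitrary: k) (auto simp: edge_seq_0 edge_seq_Suc edge_mult_def split: nat.splits)

lemma half_cos_edge_seq:
  assumes "n \<le> m"
  shows "half_cos m (edge_seq \<sigma> n) t = cos (t / 2) * (2 + 2 * \<sigma> * cos t) ^ n"
proof -
  have "half_cos n (edge_seq \<sigma> n) t = cos (t / 2) * (2 + 2 * \<sigma> * cos t) ^ n"
  proof (induction n)
    case (Suc n)
    then show ?case
      using half_cos_edge_mult[of n "edge_seq \<sigma> n" \<sigma> t] edge_seq_support[of n _ \<sigma>] by (simp add: edge_seq_Suc)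
  qed (simp add: half_cos_def edge_seq_0)
  then show ?thesis using half_cos_support[of n "edge_seq \<sigma> n" m t] edge_seq_support assms by simp
qed

lemma edge_mult_funpow_add:
  "(edge_mult \<sigma> ^^ j) (\<lambda>k. c k + d k) = (\<lambda>k. (edge_mult \<sigma> ^^ j) c k + (edge_mult \<sigma> ^^ j) d k)"
  by (induction j) (auto simp: edge_mult_def fun_eq_iff algebra_simps split: nat.splits)

lemma edge_mult_funpow_scale:
  "(edge_mult \<sigma> ^^ j) (\<lambda>k. r * c k) = (\<lambda>k. r * (edge_mult \<sigma> ^^ j) c k)"
  by (induction j) (auto simp: edge_mult_def fun_eq_iff algebra_simps split: nat.splits)

lemma edge_mult_funpow_edge_seq: "(edge_mult \<sigma> ^^ j) (edge_seq \<sigma> n) = edge_seq \<sigma> (n + j)"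
  by (simp add: edge_seq_def add.commute[of n] funpow_add)

lemma sign_near_pi:
  fixes q :: "real \<Rightarrow> real"
  assumes "isCont q 0" "q 0 \<noteq> 0" and that: "b < pi"
  shows "\<exists>a. a < pi \<and> b < a \<and> 0 < a \<and> (\<forall>t. a \<le> t \<and> t < pi \<longrightarrow> 0 < q 0 * (cos (t / 2) * q (2 + 2 * cos t)))"
proof -
  have "isCont (\<lambda>t. q (2 + 2 * cos t)) pi"
    by (rule isCont_o2[where g = q]) (use assms in \<open>auto intro!: continuous_intros\<close>)
  then have "((\<lambda>t. q 0 * q (2 + 2 * cos t)) \<longlongrightarrow> q 0 * q 0) (at_left pi)"
    using assms by (intro tendsto_intros) (auto simp: isCont_def intro: tendsto_within_subset)
  then have "\<forall>\<^sub>F t in at_left pi. 0 < q 0 * q (2 + 2 * cos t)"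
    by (rule order_tendstoD(1)) (use assms(2) in \<open>auto simp: zero_less_mult_iff linorder_neq_iff\<close>)
  then obtain c where c: "c < pi" "\<And>t. c < t \<Longrightarrow> t < pi \<Longrightarrow> 0 < q 0 * q (2 + 2 * cos t)"
    unfolding eventually_at_left_field by auto
  define a where "a = (Max {b, c, 0} + pi) / 2"
  have a: "a < pi" "b < a" "c < a" "0 < a" using that c pi_gt_zero by (auto simp: a_def max_def)
  have "0 < q 0 * (cos (t / 2) * q (2 + 2 * cos t))" if t: "a \<le> t" "t < pi" for t
  proof -
    have "0 < cos (t / 2)" using t a by (intro cos_gt_zero_pi) auto
    moreover have "0 < q 0 * q (2 + 2 * cos t)" using c(2)[of t] t a by auto
    ultimately have "0 < cos (t / 2) * (q 0 * q (2 + 2 * cos t))" by (rule mult_pos_pos)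
    then show ?thesis by (simp only: mult.left_commute)
  qed
  then show ?thesis using a by auto
qed

lemma sign_near_zero:
  fixes q :: "real \<Rightarrow> real"
  assumes "isCont q 0" "q 0 \<noteq> 0" and that: "0 < b"
  shows "\<exists>a. 0 < a \<and> a < b \<and> a < pi \<and> (\<forall>t. 0 < t \<and> t \<le> a \<longrightarrow> 0 < q 0 * (cos (t / 2) * q (2 - 2 * cos t)))"
proof -
  have "isCont (\<lambda>t. q (2 - 2 * cos t)) 0"
    by (rule isCont_o2[where g = q]) (use assms in \<open>auto intro!: continuous_intros\<close>)
  then have "((\<lambda>t. q 0 * q (2 - 2 * cos t)) \<longlongrightarrow> q 0 * q 0) (at_right 0)"
    using assms by (intro tendsto_intros) (auto simp: isCont_def intro: tendsto_within_subset)
  then have "\<forall>\<^sub>F t in at_right 0. 0 < q 0 * q (2 - 2 * cos t)"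
    by (rule order_tendstoD(1)) (use assms(2) in \<open>auto simp: zero_less_mult_iff linorder_neq_iff\<close>)
  then obtain c where c: "0 < c" "\<And>t. 0 < t \<Longrightarrow> t < c \<Longrightarrow> 0 < q 0 * q (2 - 2 * cos t)"
    unfolding eventually_at_right_field by auto
  define a where "a = Min {b, c, pi} / 2"
  have a: "a < pi" "a < b" "a < c" "0 < a" using that c by (auto simp: a_def min_def)
  have "0 < q 0 * (cos (t / 2) * q (2 - 2 * cos t))" if t: "0 < t" "t \<le> a" for t
  proof -
    have "0 < cos (t / 2)" using t a by (intro cos_gt_zero_pi) auto
    moreover have "0 < q 0 * q (2 - 2 * cos t)" using c(2)[of t] t a by auto
    ultimately have "0 < cos (t / 2) * (q 0 * q (2 - 2 * cos t))" by (rule mult_pos_pos)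
    then show ?thesis by (simp only: mult.left_commute)
  qed
  then show ?thesis using a by auto
qed

lemma edge_osc_base_0:
  assumes \<sigma>: "\<sigma> = 1 \<or> \<sigma> = -1" and supp: "\<And>k. d < k \<Longrightarrow> c k = 0"
    and q: "\<And>t. half_cos d c t = cos (t / 2) * q (2 + 2 * \<sigma> * cos t)" "isCont q 0" "q 0 \<noteq> 0"
  shows "edge_osc \<sigma> 0 d c"
proof -
  have "alternates (half_cos d c) {0<..<pi} 0 (q 0) \<and> edge_sign \<sigma> (half_cos d c) 0 (q 0)"
  proof (cases "\<sigma> = 1")
    case True
    obtain a where a: "a < pi" "0 < a" "\<And>t. a \<le> t \<Longrightarrow> t < pi \<Longrightarrow> 0 < q 0 * (cos (t / 2) * q (2 + 2 * cos t))"
      using sign_near_pi[OF q(2,3), of 0] by auto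
    have "edge_sign \<sigma> (half_cos d c) 0 (q 0)"
      unfolding edge_sign_def using a True by (auto simp: q(1) intro!: exI[of _ a])
    moreover have "alternates (half_cos d c) {0<..<pi} 0 (q 0)"
      unfolding alternates_def using a True by (auto simp: q(1) intro!: exI[of _ "\<lambda>_. a"])
    ultimately show ?thesis by blast
  next
    case False
    then have s: "\<sigma> = -1" using \<sigma> by simp
    obtain a where a: "0 < a" "a < pi" "\<And>t. 0 < t \<Longrightarrow> t \<le> a \<Longrightarrow> 0 < q 0 * (cos (t / 2) * q (2 - 2 * cos t))"
      using sign_near_zero[OF q(2,3), of pi] by auto
    have "edge_sign \<sigma> (half_cos d c) 0 (q 0)"
      unfolding edge_sign_def using a s by (auto simp: q(1) intro!: exI[of _ a])
    moreover have "alternates (half_cos d c) {0<..<pi} 0 (q 0)"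
      unfolding alternates_def using a s by (auto simp: q(1) intro!: exI[of _ "\<lambda>_. a"])
    ultimately show ?thesis by blast
  qed
  then show ?thesis using supp by (auto simp: edge_osc_def)
qed

text \<open>The variable \<open>2 + 2 \<sigma> cos t\<close> runs through (0, 4) and is 0 at the
  edge. A sign of \<open>q\<close> at an interior \<open>x\<close> opposite to that at 0 therefore
  gives one sign change, with the known sign at the edge.\<close>

lemma edge_osc_base_1:
  assumes \<sigma>: "\<sigma> = 1 \<or> \<sigma> = -1" and supp: "\<And>k. d < k \<Longrightarrow> c k = 0"
    and q: "\<And>t. half_cos d c t = cos (t / 2) * q (2 + 2 * \<sigma> * cos t)" "isCont q 0"
    and x: "0 < x" "x < 4" "q 0 * q x < 0"
  shows "edge_osc \<sigma> 1 d c"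
proof -
  have q0: "q 0 \<noteq> 0" using x by auto
  define s where "s = arccos (\<sigma> * (x - 2) / 2)"
  have cs: "cos s = \<sigma> * (x - 2) / 2" "0 < s" "s < pi"
    using x \<sigma> by (auto simp: s_def intro!: arccos_lt_bounded[THEN conjunct1] arccos_lt_bounded[THEN conjunct2])
  have xs: "2 + 2 * \<sigma> * cos s = x" using cs(1) \<sigma> by auto
  have fs: "0 < - q 0 * half_cos d c s"
  proof -
    have "0 < cos (s / 2)" using cs by (intro cos_gt_zero_pi) auto
    then have "0 < cos (s / 2) * (- (q 0 * q x))" using x by (intro mult_pos_pos) auto
    then show ?thesis unfolding q(1) xs by (simp add: algebra_simps)
  qed
  have "\<exists>e. alternates (half_cos d c) {0<..<pi} 1 e \<and> edge_sign \<sigma> (half_cos d c) 1 e"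
  proof (cases "\<sigma> = 1")
    case True
    obtain a where a: "a < pi" "s < a" "0 < a" "\<And>t. a \<le> t \<Longrightarrow> t < pi \<Longrightarrow> 0 < q 0 * (cos (t / 2) * q (2 + 2 * cos t))"
      using sign_near_pi[OF q(2) q0 cs(3)] by auto
    have "edge_sign \<sigma> (half_cos d c) 1 (- q 0)"
      unfolding edge_sign_def using a True by (auto simp: q(1) intro!: exI[of _ a])
    moreover have "alternates (half_cos d c) {0<..<pi} 1 (- q 0)"
      unfolding alternates_def using a cs fs True
      by (intro exI[of _ "\<lambda>i. if i = 0 then s else a"]) (auto simp: q(1) le_Suc_eq)
    ultimately show ?thesis by blast
  next
    case False
    then have m: "\<sigma> = -1" using \<sigma> by simp
    obtain a where a: "0 < a" "a < s" "a < pi" "\<And>t. 0 < t \<Longrightarrow> t \<le> a \<Longrightarrow> 0 < q 0 * (cos (t / 2) * q (2 - 2 * cos t))"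
      using sign_near_zero[OF q(2) q0 cs(2)] by auto
    have "edge_sign \<sigma> (half_cos d c) 1 (q 0)"
      unfolding edge_sign_def using a m by (auto simp: q(1) intro!: exI[of _ a])
    moreover have "alternates (half_cos d c) {0<..<pi} 1 (q 0)"
      unfolding alternates_def using a cs fs m
      by (intro exI[of _ "\<lambda>i. if i = 0 then a else s"]) (auto simp: q(1) le_Suc_eq)
    ultimately show ?thesis by blast
  qed
  then show ?thesis using supp by (auto simp: edge_osc_def)
qed

lemma edge_osc_imp_closure: "edge_osc \<sigma> n d c \<Longrightarrow> edge_osc_closure \<sigma> n d c"
  unfolding edge_osc_closure_def by (auto simp: edge_osc_def intro!: exI[of _ c])

text \<open>\<open>X + t\<close> with \<open>t \<noteq> 0\<close> is nonzero at the edge and starts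
  the induction with no sign change and degree 1; each of the \<open>n\<close> factors
  \<open>X\<close> adds one to both. For \<open>t = 0\<close> the start would vanish at the edge, so
  this case is a limit.\<close>

lemma osc_edge_seq:
  assumes \<sigma>: "\<sigma> = 1 \<or> \<sigma> = -1"
  shows "osc n (n + 1) (\<lambda>k. edge_seq \<sigma> (n + 1) k + t * edge_seq \<sigma> n k)"
proof -
  have nz: "osc n (n + 1) (\<lambda>k. edge_seq \<sigma> (n + 1) k + t * edge_seq \<sigma> n k)" if t: "t \<noteq> 0" for t
  proof -
    let ?c = "\<lambda>k. edge_seq \<sigma> 1 k + t * edge_seq \<sigma> 0 k"
    have "edge_osc \<sigma> 0 1 ?c"
    proof (rule edge_osc_base_0[OF \<sigma>, where q = "\<lambda>x. x + t"])
      show "half_cos 1 ?c s = cos (s / 2) * ((2 + 2 * \<sigma> * cos s) + t)" for s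
        unfolding half_cos_add half_cos_cmult using half_cos_edge_seq[of _ 1 \<sigma> s] by (simp add: algebra_simps)
    qed (use t edge_seq_support in auto)
    then have "edge_osc_closure \<sigma> (0 + n) (1 + n) ((edge_mult \<sigma> ^^ n) ?c)"
      by (intro edge_osc_closure_iterate \<sigma> edge_osc_imp_closure)
    then show ?thesis
      by (auto dest!: edge_osc_closure_imp_osc
          simp: edge_mult_funpow_add edge_mult_funpow_scale edge_mult_funpow_edge_seq)
  qed
  \<comment> \<open>The direction in which \<open>t\<close> is perturbed away from 0, so that no
    approximating parameter is 0.\<close>
  define r :: real where "r = (if t \<ge> 0 then 1 else -1)"
  have "t + r * inverse (real (Suc i)) \<noteq> 0" for i
  proof -
    have "0 < inverse (real (Suc i))" by simp
    then have "t + inverse (real (Suc i)) \<noteq> 0" if "0 \<le> t" using that by linarith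
    moreover have "t - inverse (real (Suc i)) \<noteq> 0" if "t < 0" using that \<open>0 < inverse (real (Suc i))\<close> by linarith
    ultimately show ?thesis by (cases "0 \<le> t") (simp_all add: r_def del: of_nat_Suc)
  qed
  then have "osc n (n + 1) (\<lambda>k. edge_seq \<sigma> (n + 1) k + (t + r * inverse (real (Suc i))) * edge_seq \<sigma> n k)" for i
    by (rule nz)
  moreover have "(\<lambda>i. t + r * inverse (real (Suc i))) \<longlonglongrightarrow> t + r * 0"
    by (rule tendsto_add[OF tendsto_const tendsto_mult[OF tendsto_const LIMSEQ_inverse_real_of_nat]])
  then have "(\<lambda>i. edge_seq \<sigma> (n + 1) k + (t + r * inverse (real (Suc i))) * edge_seq \<sigma> n k)
      \<longlonglongrightarrow> edge_seq \<sigma> (n + 1) k + (t + r * 0) * edge_seq \<sigma> n k" for k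
    by (rule tendsto_add[OF tendsto_const tendsto_mult[OF _ tendsto_const]])
  ultimately have "osc n (n + 1) (\<lambda>k. edge_seq \<sigma> (n + 1) k + (t + r * 0) * edge_seq \<sigma> n k)"
    by (rule osc_limit)
  then show ?thesis by simp
qed

section \<open>Closed forms and recurrences for the coefficients\<close>

lemma edge_seq_even: "edge_seq 1 n k = real ((2 * n + 1) choose (n + 1 + k))"
proof (induction n arbitrary: k)
  case (Suc n)
  have 1: "(2 * Suc n + 1) choose (Suc n + 1 + k) =
      ((2 * n + 1) choose (n + k)) + 2 * ((2 * n + 1) choose (n + 1 + k)) + ((2 * n + 1) choose (n + 1 + Suc k))"
    by (simp add: numeral_eq_Suc)
  have 2: "(2 * n + 1) choose n = (2 * n + 1) choose (n + 1)"
    by (subst binomial_symmetric) auto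
  show ?case unfolding edge_seq_Suc edge_mult_def Suc.IH 1
    using 2 by (cases k) (auto simp: algebra_simps)
qed (auto simp: edge_seq_0 binomial_eq_0)

lemma edge_seq_odd:
  "edge_seq (-1) n k = (-1) ^ k * (real ((2 * n) choose (n + k)) - real ((2 * n) choose (n + 1 + k)))"
proof (induction n arbitrary: k)
  case (Suc n)
  have 1: "(2 * Suc n) choose (Suc (Suc j)) = ((2 * n) choose j) + 2 * ((2 * n) choose (Suc j)) + ((2 * n) choose (Suc (Suc j)))" for j
    by (simp add: numeral_eq_Suc)
  show ?case
  proof (cases k)
    case 0
    show ?thesis
    proof (cases n)
      case 0
      then show ?thesis using \<open>k = 0\<close> unfolding edge_seq_Suc edge_mult_def Suc.IH
        by (simp add: numeral_2_eq_2)
    next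
      case (Suc n')
      have 2: "(2 * n) choose n' = (2 * n) choose (Suc n)"
        using Suc by (subst binomial_symmetric) auto
      show ?thesis using \<open>k = 0\<close> 1[of n'] 1[of n] 2 Suc unfolding edge_seq_Suc edge_mult_def Suc.IH
        by (simp add: algebra_simps del: binomial_Suc_Suc)
    qed
  next
    case (Suc j)
    then show ?thesis using 1[of "n + j"] 1[of "n + Suc j"] unfolding edge_seq_Suc edge_mult_def Suc.IH
      by (simp add: algebra_simps del: binomial_Suc_Suc)
  qed
qed (auto simp: edge_seq_0 binomial_eq_0)

lemma real_binomial_absorb:
  "(real j + 1) * real (Suc N choose Suc j) = (real N + 1) * real (N choose j)"
proof -
  have "real (Suc N * (N choose j)) = real ((Suc N choose Suc j) * Suc j)"
    by (simp only: Suc_times_binomial_eq)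
  then show ?thesis by (simp only: of_nat_mult of_nat_Suc) (simp only: mult.commute add.commute)
qed

lemma real_binomial_absorb_comp:
  "(real N - real j) * real (N choose j) = real N * real ((N - 1) choose j)"
proof (cases "j \<le> N")
  case True
  have "real ((N - j) * (N choose j)) = real (N * ((N - 1) choose j))"
    by (simp only: binomial_absorb_comp)
  then show ?thesis using True by (simp add: of_nat_diff)
qed (simp add: binomial_eq_0)

text \<open>The bridge to the odd case: the factor \<open>u\<close> sampled at
  \<open>k + 1/2\<close>, together with the sign from \<open>x\<close> to \<open>-x\<close>, turns
  the coefficients of the power of \<open>2 + 2 cos t\<close> into those of the power of
  \<open>2 - 2 cos t\<close>, up to a constant depending on \<open>n\<close> only.\<close>

lemma edge_seq_odd': "(2 * real n + 1) * edge_seq (-1) n k = (-1) ^ k * (2 * real k + 1) * edge_seq 1 n k"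
proof -
  have 1: "(real n + real k + 1) * real ((2 * n + 1) choose (n + 1 + k)) = (2 * real n + 1) * real ((2 * n) choose (n + k))"
    using real_binomial_absorb[of "n + k" "2 * n"] by (simp del: binomial_Suc_Suc)
  have 2: "(real n - real k) * real ((2 * n + 1) choose (n + 1 + k)) = (2 * real n + 1) * real ((2 * n) choose (n + 1 + k))"
    using real_binomial_absorb_comp[of "2 * n + 1" "n + 1 + k"] by (simp del: binomial_Suc_Suc)
  have "(2 * real n + 1) * edge_seq (-1) n k
      = (-1) ^ k * ((2 * real n + 1) * real ((2 * n) choose (n + k)) - (2 * real n + 1) * real ((2 * n) choose (n + 1 + k)))"
    unfolding edge_seq_odd by (simp only: right_diff_distrib mult.left_commute)
  also have "\<dots> = (-1) ^ k * (2 * real k + 1) * edge_seq 1 n k"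
    unfolding 1[symmetric] 2[symmetric] edge_seq_even by algebra
  finally show ?thesis .
qed

text \<open>Multiplication by \<open>node k\<close> is \<open>-D\<^sup>2\<close> on
  \<open>cos (t/2) X\<^sup>n\<close>, which only involves the powers \<open>n\<close> and
  \<open>n - 1\<close>. For \<sigma> = 1 it is absorption of \<open>(n - k) (n + k + 1)\<close> into
  the binomial coefficient; the other sign follows through \<open>edge_seq_odd'\<close>.\<close>

lemma node_edge_seq:
  assumes \<sigma>: "\<sigma> = 1 \<or> \<sigma> = -1" and n: "n = Suc n'"
  shows "node k * edge_seq \<sigma> n k = node n * edge_seq \<sigma> n k - 2 * real n * (2 * real n + \<sigma>) * edge_seq \<sigma> n' k"
proof -
  have even: "(node n - node k) * edge_seq 1 n k = 2 * real n * (2 * real n + 1) * edge_seq 1 n' k"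
  proof -
    have 1: "(real n + real k + 1) * real ((2 * n + 1) choose (n + 1 + k)) = (2 * real n + 1) * real ((2 * n) choose (n + k))"
      using real_binomial_absorb[of "n + k" "2 * n"] by (simp del: binomial_Suc_Suc)
    have 2: "(real n - real k) * real ((2 * n) choose (n + k)) = 2 * real n * real ((2 * n' + 1) choose (n' + 1 + k))"
    proof -
      have e: "2 * n - 1 = 2 * n' + 1" "n' + 1 + k = n + k" using n by auto
      have "(real (2 * n) - real (n + k)) * real ((2 * n) choose (n + k)) = real (2 * n) * real ((2 * n' + 1) choose (n' + 1 + k))"
        using real_binomial_absorb_comp[of "2 * n" "n + k"] unfolding e .
      moreover have "real (2 * n) - real (n + k) = real n - real k" "real (2 * n) = 2 * real n" by simp_all
      ultimately show ?thesis by (simp only:)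
    qed
    have "node n - node k = (real n - real k) * (real n + real k + 1)"
      by (simp add: node_def power2_eq_square algebra_simps)
    then have "(node n - node k) * edge_seq 1 n k
        = (real n - real k) * ((real n + real k + 1) * real ((2 * n + 1) choose (n + 1 + k)))"
      unfolding edge_seq_even by (simp only: mult.assoc)
    also have "\<dots> = (2 * real n + 1) * ((real n - real k) * real ((2 * n) choose (n + k)))"
      unfolding 1 by (simp only: mult.left_commute)
    also have "\<dots> = 2 * real n * (2 * real n + 1) * edge_seq 1 n' k"
      unfolding 2 edge_seq_even by (simp only: mult_ac)
    finally show ?thesis .
  qed
  show ?thesis
  proof (cases "\<sigma> = 1")
    case True
    then show ?thesis using even by (simp add: algebra_simps)
  next
    case False
    then have s: "\<sigma> = -1" using \<sigma> by simp
    have "(2 * real n + 1) * ((node n - node k) * edge_seq (-1) n k)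
        = (-1) ^ k * (2 * real k + 1) * ((node n - node k) * edge_seq 1 n k)"
    proof -
      have "(2 * real n + 1) * ((node n - node k) * edge_seq (-1) n k)
          = (node n - node k) * ((2 * real n + 1) * edge_seq (-1) n k)" by (simp only: mult.left_commute)
      then show ?thesis unfolding edge_seq_odd' by (simp only: mult_ac)
    qed
    also have "\<dots> = 2 * real n * (2 * real n + 1) * ((-1) ^ k * (2 * real k + 1) * edge_seq 1 n' k)"
      unfolding even by algebra
    also have "\<dots> = (2 * real n + 1) * (2 * real n * (2 * real n - 1) * edge_seq (-1) n' k)"
      unfolding edge_seq_odd'[symmetric] by (simp add: n algebra_simps)
    finally have "(node n - node k) * edge_seq (-1) n k = 2 * real n * (2 * real n - 1) * edge_seq (-1) n' k"
      by simp
    then show ?thesis unfolding s by (simp add: algebra_simps)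
  qed
qed

text \<open>
  The polynomial with these coefficients is \<open>X\<^sup>n\<^sup>-\<^sup>1 (X (\<alpha> X - \<gamma>) + t (\<beta> X - \<delta>))\<close> with
  \<open>X = 2 + 2 \<sigma> cos u\<close>.
\<close>

lemma osc_linear_factor_edge_seq_aux:
  fixes s t :: real
  assumes \<sigma>: "\<sigma> = 1 \<or> \<sigma> = -1" and n: "n = Suc n'" and t: "t \<noteq> 0"
  defines "\<alpha> \<equiv> node (n + 1) - s" and "\<beta> \<equiv> node n - s"
    and "\<gamma> \<equiv> 2 * real (n + 1) * (2 * real (n + 1) + \<sigma>)" and "\<delta> \<equiv> 2 * real n * (2 * real n + \<sigma>)"
  assumes pos: "0 < \<alpha>" "0 < \<beta>" "\<gamma> < 4 * \<alpha>" "\<delta> < 4 * \<beta>" and key: "\<alpha> * \<delta> < \<beta> * \<gamma>"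
  shows "osc n (n + 1) (\<lambda>k. (node k - s) * (edge_seq \<sigma> (n + 1) k + t * edge_seq \<sigma> n k))"
proof -
  define q where "q x = x * (\<alpha> * x - \<gamma>) + t * (\<beta> * x - \<delta>)" for x
  have "0 < 2 * real n + \<sigma>" using \<sigma> n by auto
  then have \<delta>: "0 < \<delta>" using n by (simp add: \<delta>_def)
  have \<gamma>: "0 < \<gamma>" using \<sigma> by (auto simp: \<gamma>_def)
  have "\<exists>x. 0 < x \<and> x < 4 \<and> q 0 * q x < 0"
  \<comment> \<open>\<open>q 0 = - t \<delta>\<close>. For negative \<open>t\<close> the test point
    is the zero \<open>\<delta> / \<beta>\<close> of the second summand, where \<open>q\<close> does
    not depend on \<open>t\<close> and \<open>key\<close> gives the sign. For positive
    \<open>t\<close> any point below 4 and to the right of both \<open>\<gamma> / \<alpha>\<close>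
    and \<open>\<delta> / \<beta>\<close> makes both summands positive.\<close>
  proof (cases "t < 0")
    case True
    have "q (\<delta> / \<beta>) = (\<delta> / \<beta>\<^sup>2) * (\<alpha> * \<delta> - \<beta> * \<gamma>)"
      using pos by (simp add: q_def field_simps power2_eq_square)
    also have "\<dots> < 0" using key \<delta> pos by (intro mult_pos_neg) auto
    finally have "q (\<delta> / \<beta>) < 0" .
    moreover have "0 < q 0" using True \<delta> by (simp add: q_def mult_neg_pos)
    ultimately show ?thesis using pos \<delta> by (intro exI[of _ "\<delta> / \<beta>"]) (auto simp: field_simps mult_pos_neg)
  next
    case False
    define x where "x = (max (\<gamma> / \<alpha>) (\<delta> / \<beta>) + 4) / 2"
    have "\<gamma> / \<alpha> < 4" "\<delta> / \<beta> < 4" using pos by (auto simp: field_simps)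
    then have "\<gamma> / \<alpha> \<le> max (\<gamma> / \<alpha>) (\<delta> / \<beta>)" "\<delta> / \<beta> \<le> max (\<gamma> / \<alpha>) (\<delta> / \<beta>)"
      "max (\<gamma> / \<alpha>) (\<delta> / \<beta>) < 4" by auto
    then have x: "\<gamma> / \<alpha> < x" "\<delta> / \<beta> < x" "x < 4" unfolding x_def by argo+
    moreover have "0 < \<gamma> / \<alpha>" using \<gamma> pos by simp
    ultimately have "0 < x" by linarith
    have "0 < \<alpha> * x - \<gamma>" "0 < \<beta> * x - \<delta>" using x pos by (auto simp: field_simps)
    then have "0 < q x" unfolding q_def using \<open>0 < x\<close> False t by (intro add_pos_pos mult_pos_pos) auto
    moreover have "q 0 < 0" using False t \<delta> by (simp add: q_def mult_pos_neg)
    ultimately show ?thesis using x \<open>0 < x\<close> by (intro exI[of _ x]) (auto simp: mult_neg_pos)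
  qed
  then obtain x where x: "0 < x" "x < 4" "q 0 * q x < 0" by blast
  let ?c = "\<lambda>k. \<alpha> * edge_seq \<sigma> 2 k + ((t * \<beta> - \<gamma>) * edge_seq \<sigma> 1 k + (- t * \<delta>) * edge_seq \<sigma> 0 k)"
  have "edge_osc \<sigma> 1 2 ?c"
  proof (rule edge_osc_base_1[OF \<sigma>, where q = q])
    show "half_cos 2 ?c u = cos (u / 2) * q (2 + 2 * \<sigma> * cos u)" for u
      unfolding half_cos_add half_cos_cmult q_def using half_cos_edge_seq[of _ 2 \<sigma> u]
      by (simp add: algebra_simps power2_eq_square)
    show "isCont q 0" unfolding q_def by (intro continuous_intros)
  qed (use x edge_seq_support in auto)
  then have "edge_osc_closure \<sigma> (1 + n') (2 + n') ((edge_mult \<sigma> ^^ n') ?c)"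
    by (intro edge_osc_closure_iterate \<sigma> edge_osc_imp_closure)
  moreover have "(edge_mult \<sigma> ^^ n') ?c = (\<lambda>k. (node k - s) * (edge_seq \<sigma> (n + 1) k + t * edge_seq \<sigma> n k))"
  proof
    fix k
    have e: "node k * edge_seq \<sigma> (n + 1) k = node (n + 1) * edge_seq \<sigma> (n + 1) k - \<gamma> * edge_seq \<sigma> n k"
      "node k * edge_seq \<sigma> n k = node n * edge_seq \<sigma> n k - \<delta> * edge_seq \<sigma> n' k"
      unfolding \<gamma>_def \<delta>_def using node_edge_seq[OF \<sigma>, of "n + 1" n k] node_edge_seq[OF \<sigma> n, of k] by simp_all
    have "(edge_mult \<sigma> ^^ n') ?c k = \<alpha> * edge_seq \<sigma> (n + 1) k + ((t * \<beta> - \<gamma>) * edge_seq \<sigma> n k + (- t * \<delta>) * edge_seq \<sigma> n' k)"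
      unfolding edge_mult_funpow_add edge_mult_funpow_scale edge_mult_funpow_edge_seq by (simp add: n)
    also have "\<dots> = (node k - s) * (edge_seq \<sigma> (n + 1) k + t * edge_seq \<sigma> n k)"
      unfolding \<alpha>_def \<beta>_def using e by algebra
    finally show "(edge_mult \<sigma> ^^ n') ?c k = (node k - s) * (edge_seq \<sigma> (n + 1) k + t * edge_seq \<sigma> n k)" .
  qed
  ultimately show ?thesis using n by (auto dest!: edge_osc_closure_imp_osc)
qed

text \<open>Bounds the square of the half-width of the strip; 1 belongs to the odd
  functions.\<close>

definition strip_bound :: "real \<Rightarrow> real" where
  "strip_bound \<sigma> = (if \<sigma> = 1 then 15/28 else 1)"

text \<open>For \<sigma> = 1 the condition \<open>key\<close> reads
  \<open>s < (2n + 1) (2n + 3) / (4 (4n + 3))\<close>; for \<open>n \<ge> 1\<close> the right-hand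
  side is least at \<open>n = 1\<close>, where it is 15/28. For \<sigma> = -1 it reads
  \<open>s < (12 n\<^sup>2 + 16 n + 1) / (4 (4n + 1))\<close>, which every \<open>s < 1\<close>
  satisfies.\<close>

lemma osc_linear_factor_edge_seq_strict:
  assumes \<sigma>: "\<sigma> = 1 \<or> \<sigma> = -1" and n: "n = Suc n'" and t: "t \<noteq> 0" and s: "s < strip_bound \<sigma>"
  shows "osc n (n + 1) (\<lambda>k. (node k - s) * (edge_seq \<sigma> (n + 1) k + t * edge_seq \<sigma> n k))"
proof -
  define x where "x = real n"
  have x: "1 \<le> x" using n by (simp add: x_def)
  have nd: "node (n + 1) = (x + 3/2)\<^sup>2" "node n = (x + 1/2)\<^sup>2" "real (n + 1) = x + 1"
    by (auto simp: node_def x_def add.commute)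
  have sq: "x \<le> x\<^sup>2" using x by (simp add: power2_eq_square)
  have s1: "s < 1" using s by (auto simp: strip_bound_def split: if_splits)
  have c0: "0 < (x + 3/2)\<^sup>2 - s" "0 < (x + 1/2)\<^sup>2 - s"
  proof -
    have "1 \<le> (x + 3/2)\<^sup>2" using x by (intro one_le_power) simp
    then show "0 < (x + 3/2)\<^sup>2 - s" using s1 by linarith
    have "1 \<le> (x + 1/2)\<^sup>2" using x by (intro one_le_power) simp
    then show "0 < (x + 1/2)\<^sup>2 - s" using s1 by linarith
  qed
  consider "\<sigma> = 1" "s < 15/28" | "\<sigma> = -1" "s < 1"
    using \<sigma> s by (auto simp: strip_bound_def)
  then have c: "2 * (x + 1) * (2 * (x + 1) + \<sigma>) < 4 * ((x + 3/2)\<^sup>2 - s)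
      \<and> 2 * x * (2 * x + \<sigma>) < 4 * ((x + 1/2)\<^sup>2 - s)
      \<and> ((x + 3/2)\<^sup>2 - s) * (2 * x * (2 * x + \<sigma>)) < ((x + 1/2)\<^sup>2 - s) * (2 * (x + 1) * (2 * (x + 1) + \<sigma>))"
  proof cases
    case 1
    have "((x + 1/2)\<^sup>2 - s) * (2 * (x + 1) * (2 * (x + 1) + 1)) - ((x + 3/2)\<^sup>2 - s) * (2 * x * (2 * x + 1))
        = (2 * x + 1) * (x + 3/2) - 2 * (s * (4 * x + 3))"
      by (simp add: power2_eq_square algebra_simps)
    moreover have "s * (4 * x + 3) < 15/28 * (4 * x + 3)" using 1 x by (intro mult_strict_right_mono) auto
    moreover have "15/14 * (4 * x + 3) \<le> (2 * x + 1) * (x + 3/2)"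
    proof -
      have "(2 * x + 1) * (x + 3/2) - 15/14 * (4 * x + 3) = 2 * (x\<^sup>2 - x) + 12/7 * (x - 1)"
        by (simp add: power2_eq_square field_simps)
      moreover have "0 \<le> 2 * (x\<^sup>2 - x) + 12/7 * (x - 1)"
        using sq x by (intro add_nonneg_nonneg mult_nonneg_nonneg) simp_all
      ultimately have "0 \<le> (2 * x + 1) * (x + 3/2) - 15/14 * (4 * x + 3)" by (simp only:)
      then show ?thesis by (simp only: diff_ge_0_iff_ge)
    qed
    ultimately have "((x + 3/2)\<^sup>2 - s) * (2 * x * (2 * x + 1)) < ((x + 1/2)\<^sup>2 - s) * (2 * (x + 1) * (2 * (x + 1) + 1))"
      by linarith
    then show ?thesis unfolding 1 using 1 x by (auto simp: power2_eq_square algebra_simps)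
  next
    case 2
    define y where "y = x\<^sup>2"
    have y: "1 \<le> y" unfolding y_def using x by (rule one_le_power)
    have "((x + 1/2)\<^sup>2 - s) * (2 * (x + 1) * (2 * (x + 1) - 1)) - ((x + 3/2)\<^sup>2 - s) * (2 * x * (2 * x - 1))
        = (12 * y + 16 * x + 1) / 2 - 2 * (s * (4 * x + 1))"
      unfolding y_def by (simp add: power2_eq_square algebra_simps)
    moreover have "s * (4 * x + 1) \<le> 1 * (4 * x + 1)" using 2 x by (intro mult_right_mono) auto
    then have "0 < (12 * y + 16 * x + 1) / 2 - 2 * (s * (4 * x + 1))"
    proof -
      have "0 < (12 * y + 16 * x + 1) / 2 - 2 * w" if "w \<le> 1 * (4 * x + 1)" for w
        using that y by (simp add: field_simps)
      then show ?thesis using \<open>s * (4 * x + 1) \<le> 1 * (4 * x + 1)\<close> .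
    qed
    ultimately have "0 < ((x + 1/2)\<^sup>2 - s) * (2 * (x + 1) * (2 * (x + 1) - 1)) - ((x + 3/2)\<^sup>2 - s) * (2 * x * (2 * x - 1))"
      by (simp only:)
    then have "((x + 3/2)\<^sup>2 - s) * (2 * x * (2 * x - 1)) < ((x + 1/2)\<^sup>2 - s) * (2 * (x + 1) * (2 * (x + 1) - 1))"
      by (simp only: diff_gt_0_iff_gt)
    then show ?thesis unfolding 2 using 2 x by (auto simp: power2_eq_square algebra_simps)
  qed
  show ?thesis
    by (rule osc_linear_factor_edge_seq_aux[OF \<sigma> n t]) (use c0 c in \<open>simp_all only: nd\<close>, simp_all only: x_def[symmetric])
qed

lemma osc_linear_factor_edge_seq:
  assumes \<sigma>: "\<sigma> = 1 \<or> \<sigma> = -1" and n: "n = Suc n'" and s: "s \<le> strip_bound \<sigma>"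
  shows "osc n (n + 1) (\<lambda>k. (node k - s) * (edge_seq \<sigma> (n + 1) k + t * edge_seq \<sigma> n k))"
proof -
  define r :: real where "r = (if t \<ge> 0 then 1 else -1)"
  let ?\<tau> = "\<lambda>i. inverse (real (Suc i))"
  have \<tau>: "0 < ?\<tau> i" for i by simp
  have nz: "t + r * ?\<tau> i \<noteq> 0" for i
  proof -
    have "t + ?\<tau> i \<noteq> 0" if "0 \<le> t" using that \<tau>[of i] by linarith
    moreover have "t - ?\<tau> i \<noteq> 0" if "t < 0" using that \<tau>[of i] by linarith
    ultimately show ?thesis by (cases "0 \<le> t") (simp_all add: r_def del: of_nat_Suc)
  qed
  have lim: "(\<lambda>i. t + r * ?\<tau> i) \<longlonglongrightarrow> t + r * 0" "(\<lambda>i. s - ?\<tau> i) \<longlonglongrightarrow> s - 0"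
    by (rule tendsto_add[OF tendsto_const tendsto_mult[OF tendsto_const LIMSEQ_inverse_real_of_nat]])
       (rule tendsto_diff[OF tendsto_const LIMSEQ_inverse_real_of_nat])
  have "osc n (n + 1) (\<lambda>k. (node k - (s - 0)) * (edge_seq \<sigma> (n + 1) k + (t + r * 0) * edge_seq \<sigma> n k))"
  proof (rule osc_limit)
    show "osc n (n + 1) (\<lambda>k. (node k - (s - ?\<tau> i)) * (edge_seq \<sigma> (n + 1) k + (t + r * ?\<tau> i) * edge_seq \<sigma> n k))" for i
      using s \<tau>[of i] by (intro osc_linear_factor_edge_seq_strict[OF \<sigma> n nz]) linarith
    show "(\<lambda>i. (node k - (s - ?\<tau> i)) * (edge_seq \<sigma> (n + 1) k + (t + r * ?\<tau> i) * edge_seq \<sigma> n k))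
        \<longlonglongrightarrow> (node k - (s - 0)) * (edge_seq \<sigma> (n + 1) k + (t + r * 0) * edge_seq \<sigma> n k)" for k
      by (rule tendsto_mult[OF tendsto_diff[OF tendsto_const lim(2)]
            tendsto_add[OF tendsto_const tendsto_mult[OF lim(1) tendsto_const]]])
  qed
  then show ?thesis by simp
qed

text \<open>
  A product over zeros of an even real function in the strip of half-width \<open>h\<close>, as a function of
  \<open>x = u\<^sup>2\<close>: a real or imaginary pair contributes \<open>x - s\<close>, a quadruple \<open>\<plusminus>a \<plusminus> i b\<close>
  contributes \<open>|x - (a + i b)\<^sup>2|\<^sup>2\<close>.
\<close>

inductive strip_mult :: "real \<Rightarrow> (real \<Rightarrow> real) \<Rightarrow> bool" for h where
  one: "strip_mult h (\<lambda>_. 1)"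
| real: "strip_mult h M \<Longrightarrow> s \<le> h\<^sup>2 \<Longrightarrow> strip_mult h (\<lambda>x. M x * (x - s))"
| complex: "strip_mult h M \<Longrightarrow> 0 < a \<Longrightarrow> a \<le> h \<Longrightarrow> 0 < b \<Longrightarrow>
    strip_mult h (\<lambda>x. M x * ((x - (a\<^sup>2 - b\<^sup>2))\<^sup>2 + (2 * a * b)\<^sup>2))"

text \<open>The invariant of the induction is that at most one real factor waits for a partner. The
  next real factor beyond 1/4 is merged with it by \<open>keeps_pair\<close>, after which none
  waits; all other factors are absorbed at once.\<close>

lemma strip_mult_cases:
  assumes "strip_mult h M" "0 \<le> h" "h \<le> 1"
  shows "keeps M \<or> (\<exists>s N. 1/4 \<le> s \<and> s \<le> h\<^sup>2 \<and> keeps N \<and> M = (\<lambda>x. N x * (x - s)))"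
  using assms(1)
proof induction
  case one
  then show ?case using keeps_const[of 1] by simp
next
  case (real M s)
  have h1: "h\<^sup>2 \<le> 1" using assms by (simp add: power_le_one)
  show ?case
  proof (cases "s \<le> 1/4")
    case True
    from real.IH show ?thesis
    proof
      assume "keeps M"
      then show ?thesis using keeps_mult[OF _ keeps_real[OF True]] by blast
    next
      assume "\<exists>s N. 1/4 \<le> s \<and> s \<le> h\<^sup>2 \<and> keeps N \<and> M = (\<lambda>x. N x * (x - s))"
      then obtain s' N where N: "1/4 \<le> s'" "s' \<le> h\<^sup>2" "keeps N" "M = (\<lambda>x. N x * (x - s'))" by blast
      have "keeps (\<lambda>x. N x * (x - s))" by (rule keeps_mult[OF N(3) keeps_real[OF True]])
      moreover have "(\<lambda>x. M x * (x - s)) = (\<lambda>x. N x * (x - s) * (x - s'))" by (simp add: N(4) mult_ac)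
      ultimately show ?thesis using N(1,2) by blast
    qed
  next
    case False
    from real.IH show ?thesis
    proof
      assume "keeps M"
      then show ?thesis using False real.hyps by (intro disjI2 exI[of _ s] exI[of _ M]) auto
    next
      assume "\<exists>s N. 1/4 \<le> s \<and> s \<le> h\<^sup>2 \<and> keeps N \<and> M = (\<lambda>x. N x * (x - s))"
      then obtain s' N where N: "1/4 \<le> s'" "s' \<le> h\<^sup>2" "keeps N" "M = (\<lambda>x. N x * (x - s'))" by blast
      have "keeps (\<lambda>x. (x - s) * (x - s'))"
      proof (cases "s \<le> s'")
        case True
        then show ?thesis using keeps_pair[of s s'] False N h1 by simp
      next
        case False
        then show ?thesis using keeps_pair[of s' s] N real.hyps h1 by (simp add: mult.commute)
      qed
      then have "keeps (\<lambda>x. N x * ((x - s) * (x - s')))" by (rule keeps_mult[OF N(3)])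
      moreover have "(\<lambda>x. M x * (x - s)) = (\<lambda>x. N x * ((x - s) * (x - s')))" by (simp add: N(4) mult_ac)
      ultimately show ?thesis by metis
    qed
  qed
next
  case (complex M a b)
  have k: "keeps (\<lambda>x. (x - (a\<^sup>2 - b\<^sup>2))\<^sup>2 + (2 * a * b)\<^sup>2)"
    using complex.hyps assms by (intro keeps_complex) auto
  from complex.IH show ?case
  proof
    assume "keeps M"
    then show ?thesis using keeps_mult[OF _ k] by blast
  next
    assume "\<exists>s N. 1/4 \<le> s \<and> s \<le> h\<^sup>2 \<and> keeps N \<and> M = (\<lambda>x. N x * (x - s))"
    then obtain s' N where N: "1/4 \<le> s'" "s' \<le> h\<^sup>2" "keeps N" "M = (\<lambda>x. N x * (x - s'))" by blast
    have "keeps (\<lambda>x. N x * ((x - (a\<^sup>2 - b\<^sup>2))\<^sup>2 + (2 * a * b)\<^sup>2))" by (rule keeps_mult[OF N(3) k])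
    moreover have "(\<lambda>x. M x * ((x - (a\<^sup>2 - b\<^sup>2))\<^sup>2 + (2 * a * b)\<^sup>2))
        = (\<lambda>x. N x * ((x - (a\<^sup>2 - b\<^sup>2))\<^sup>2 + (2 * a * b)\<^sup>2) * (x - s'))" by (simp add: N(4) mult_ac)
    ultimately show ?thesis using N(1,2) by blast
  qed
qed

lemma osc_strip_mult:
  assumes \<sigma>: "\<sigma> = 1 \<or> \<sigma> = -1" and n: "n = Suc n'" and h: "0 \<le> h" "h\<^sup>2 \<le> strip_bound \<sigma>"
    and M: "strip_mult h M"
  shows "osc n (n + 1) (\<lambda>k. M (node k) * (edge_seq \<sigma> (n + 1) k + t * edge_seq \<sigma> n k))"
proof -
  have "strip_bound \<sigma> \<le> 1" by (simp add: strip_bound_def)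
  then have "h\<^sup>2 \<le> 1" using h(2) by (rule order_trans[rotated])
  then have "h \<le> 1" using h(1) by (simp add: power_le_one_iff)
  from strip_mult_cases[OF M h(1) this] show ?thesis
  proof
    assume "keeps M"
    then show ?thesis by (intro keepsD osc_edge_seq \<sigma>)
  next
    assume "\<exists>s N. 1/4 \<le> s \<and> s \<le> h\<^sup>2 \<and> keeps N \<and> M = (\<lambda>x. N x * (x - s))"
    then obtain s N where N: "s \<le> h\<^sup>2" "keeps N" "M = (\<lambda>x. N x * (x - s))" by blast
    have "osc n (n + 1) (\<lambda>k. N (node k) * ((node k - s) * (edge_seq \<sigma> (n + 1) k + t * edge_seq \<sigma> n k)))"
      using N h by (intro keepsD osc_linear_factor_edge_seq[OF \<sigma> n]) auto
    then show ?thesis by (simp add: N(3) mult.assoc)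
  qed
qed

subsection \<open>Approximation of entire functions of order at most one\<close>

lemma entire_divide_root:
  assumes "F holomorphic_on UNIV" "F a = 0"
  obtains G where "G holomorphic_on UNIV" "\<And>z. F z = (z - a) * G z"
proof
  let ?G = "\<lambda>z. if z = a then deriv F a else (F z - F a) / (z - a)"
  show "?G holomorphic_on UNIV" by (rule pole_lemma_open[OF assms(1)]) auto
  show "F z = (z - a) * ?G z" for z using assms(2) by simp
qed

text \<open>Used to pass evenness and realness from a function to its quotient by a polynomial: the
  two candidates agree off the finitely many zeros, hence everywhere by continuity.\<close>

lemma continuous_cancel:
  fixes A B p :: "complex \<Rightarrow> complex"
  assumes "continuous_on UNIV A" "continuous_on UNIV B" "finite {z. p z = 0}" "\<And>z. p z * A z = p z * B z"
  shows "A = B"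
proof
  fix z0
  have "open (- ({z. p z = 0} - {z0}))" using assms(3) by (intro open_Compl finite_imp_closed) auto
  then have "\<forall>\<^sub>F z in at z0. z \<in> - ({z. p z = 0} - {z0})" by (intro eventually_at_in_open') auto
  moreover have "\<forall>\<^sub>F z in at z0. z \<noteq> z0" by (simp add: eventually_at_filter)
  ultimately have eq: "\<forall>\<^sub>F z in at z0. A z = B z"
    by eventually_elim (use assms(4) in auto)
  have "(A \<longlongrightarrow> A z0) (at z0)" "(B \<longlongrightarrow> B z0) (at z0)"
    using assms(1,2) by (auto simp: continuous_on_def)
  then have "(B \<longlongrightarrow> A z0) (at z0)" using eq by (metis tendsto_cong)
  with \<open>(B \<longlongrightarrow> B z0) (at z0)\<close> show "A z0 = B z0"
    by (metis tendsto_unique trivial_limit_at)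
qed

definition even_entire :: "(complex \<Rightarrow> complex) \<Rightarrow> bool" where
  "even_entire F \<longleftrightarrow> F holomorphic_on UNIV \<and> (\<forall>u. F (- u) = F u)"

lemma finite_quadratic_zeros: "finite {u::complex. 1 - u\<^sup>2 / r = 0}"
proof (rule finite_subset)
  show "{u. 1 - u\<^sup>2 / r = 0} \<subseteq> {csqrt r, - csqrt r}"
  proof
    fix u assume "u \<in> {u. 1 - u\<^sup>2 / r = 0}"
    then have "u\<^sup>2 = (csqrt r)\<^sup>2" by (cases "r = 0") (auto simp: field_simps)
    then have "u = csqrt r \<or> u = - csqrt r" by (simp only: power2_eq_iff)
    then show "u \<in> {csqrt r, - csqrt r}" by blast
  qed
qed simp

lemma holomorphic_imp_continuous_UNIV: "F holomorphic_on UNIV \<Longrightarrow> continuous_on UNIV F"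
  by (rule holomorphic_on_imp_continuous_on)

lemma even_entire_divide_root:
  assumes F: "even_entire F" and \<rho>: "F \<rho> = 0" "\<rho> \<noteq> 0"
  obtains G where "even_entire G" "\<And>u. F u = (1 - u\<^sup>2 / \<rho>\<^sup>2) * G u"
proof -
  obtain G1 where G1: "G1 holomorphic_on UNIV" "\<And>z. F z = (z - \<rho>) * G1 z"
    using entire_divide_root F \<rho> unfolding even_entire_def by metis
  have "(- \<rho> - \<rho>) * G1 (- \<rho>) = 0" using F \<rho> G1(2)[of "- \<rho>"] unfolding even_entire_def by metis
  moreover have "- \<rho> - \<rho> \<noteq> 0" using \<rho>(2) by (simp add: neg_eq_iff_add_eq_0 flip: mult_2)
  ultimately have "G1 (- \<rho>) = 0" by simp
  then obtain G2 where G2: "G2 holomorphic_on UNIV" "\<And>z. G1 z = (z - - \<rho>) * G2 z"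
    using entire_divide_root G1(1) by metis
  define G where "G u = - \<rho>\<^sup>2 * G2 u" for u
  have eq: "F u = (1 - u\<^sup>2 / \<rho>\<^sup>2) * G u" for u
    using \<rho>(2) unfolding G1(2) G2(2) G_def by (simp add: field_simps power2_eq_square)
  have hol: "G holomorphic_on UNIV" unfolding G_def[abs_def] by (intro holomorphic_intros G2)
  have "G = (\<lambda>u. G (- u))"
  proof (rule continuous_cancel)
    show "continuous_on UNIV (\<lambda>u. G (- u))"
      by (intro continuous_on_compose2[OF holomorphic_imp_continuous_UNIV[OF hol]] continuous_intros) auto
    show "(1 - u\<^sup>2 / \<rho>\<^sup>2) * G u = (1 - u\<^sup>2 / \<rho>\<^sup>2) * G (- u)" for u
      using eq[of u] eq[of "- u"] F by (simp add: even_entire_def)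
  qed (rule holomorphic_imp_continuous_UNIV[OF hol], rule finite_quadratic_zeros)
  then have "even_entire G" using hol unfolding even_entire_def by metis
  then show ?thesis using that eq by blast
qed

lemma real_fun_cancel:
  assumes "G holomorphic_on UNIV" "finite {z. p z = 0}"
    and "real_fun F" "real_fun p" "\<And>u. F u = p u * G u"
  shows "real_fun G"
proof -
  have cont: "continuous_on UNIV G" using assms(1) by (rule holomorphic_imp_continuous_UNIV)
  have "G = (\<lambda>u. cnj (G (cnj u)))"
  proof (rule continuous_cancel[OF cont _ assms(2)])
    show "continuous_on UNIV (\<lambda>u. cnj (G (cnj u)))"
      by (intro continuous_intros continuous_on_compose2[OF cont]) auto
    show "p u * G u = p u * cnj (G (cnj u))" for u
    proof -
      have "p u * cnj (G (cnj u)) = cnj (p (cnj u) * G (cnj u))"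
        using assms(4) by (simp add: real_fun_def)
      also have "\<dots> = cnj (F (cnj u))" by (simp add: assms(5))
      also have "\<dots> = F u" using assms(3) by (simp add: real_fun_def)
      finally show ?thesis by (simp only: assms(5))
    qed
  qed
  then have "G u = cnj (G (cnj u))" for u by metis
  then show ?thesis unfolding real_fun_def by (metis complex_cnj_cnj)
qed

text \<open>The bound is larger than 1 on the sphere of radius \<open>2 R\<close>, so every zero
  removed from the disc of radius \<open>R\<close> shrinks the quotient there by a fixed
  factor.\<close>

lemma norm_one_minus_ratio:
  assumes "norm u = 2 * R" "norm \<rho> \<le> R" "\<rho> \<noteq> 0" "0 < R"
  shows "3 \<le> norm (1 - u\<^sup>2 / \<rho>\<^sup>2 :: complex)"
proof -
  have "2 \<le> norm u / norm \<rho>" using assms by (simp add: field_simps)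
  then have "2\<^sup>2 \<le> (norm u / norm \<rho>)\<^sup>2" by (intro power_mono) auto
  then have "4 \<le> norm (u\<^sup>2 / \<rho>\<^sup>2)" by (simp add: norm_divide norm_power power_divide)
  moreover have "norm (u\<^sup>2 / \<rho>\<^sup>2) - 1 \<le> norm (1 - u\<^sup>2 / \<rho>\<^sup>2)"
    using norm_triangle_ineq2[of "u\<^sup>2 / \<rho>\<^sup>2" 1] by (simp add: norm_minus_commute)
  ultimately show ?thesis by linarith
qed

text \<open>A zero \<rho> brings with it \<open>-\<rho>\<close> and both conjugates. These four
  collapse to one pair exactly if the square of \<rho> is real, that is, \<rho> is real or
  imaginary. Normalizing \<open>p 0 = 1\<close> leaves the value at 0 unchanged.\<close>

lemma divide_out_zero:
  assumes F: "even_entire F" "real_fun F" and \<rho>: "F \<rho> = 0" "\<rho> \<noteq> 0" "norm \<rho> \<le> R" "\<bar>Re \<rho>\<bar> \<le> h" and R: "0 < R"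
    and M: "strip_mult h M"
  obtains G p c M' where "even_entire G" "real_fun G" "\<And>u. F u = p u * G u" "p 0 = 1"
    "\<And>u. norm u = 2 * R \<Longrightarrow> 3 \<le> norm (p u)" "c \<noteq> 0" "strip_mult h (\<lambda>x. M x * M' x)"
    "\<And>x. p (of_real x) = of_real (c * M' (x\<^sup>2))"
proof -
  obtain G where G: "even_entire G" "\<And>u. F u = (1 - u\<^sup>2 / \<rho>\<^sup>2) * G u"
    using even_entire_divide_root[OF F(1) \<rho>(1,2)] by blast
  show ?thesis
  proof (cases "Im (\<rho>\<^sup>2) = 0")
    case True
    define s where "s = (Re \<rho>)\<^sup>2 - (Im \<rho>)\<^sup>2"
    have \<rho>2: "\<rho>\<^sup>2 = of_real s" using True by (auto simp: s_def complex_eq_iff Re_power2)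
    have "(Re \<rho>)\<^sup>2 \<le> h\<^sup>2" using \<rho>(4) power_mono[of "\<bar>Re \<rho>\<bar>" h 2] by simp
    then have s1: "s \<le> h\<^sup>2" unfolding s_def using zero_le_power2[of "Im \<rho>"] by linarith
    have "complex_of_real s \<noteq> 0" using \<rho>2 \<rho>(2) by (metis power_not_zero)
    then have s: "s \<le> h\<^sup>2" "s \<noteq> 0" using s1 by auto
    show ?thesis
    proof (rule that[of G "\<lambda>u. 1 - u\<^sup>2 / \<rho>\<^sup>2" "- 1 / s" "\<lambda>x. x - s"])
      show "real_fun G"
        using G F by (intro real_fun_cancel[OF _ finite_quadratic_zeros F(2) _ G(2)])
          (auto simp: even_entire_def real_fun_def \<rho>2)
      show "1 - (of_real x)\<^sup>2 / \<rho>\<^sup>2 = complex_of_real (- 1 / s * (x\<^sup>2 - s))" for x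
        using s unfolding \<rho>2 by (simp add: field_simps)
    qed (use G \<rho> R M s norm_one_minus_ratio in \<open>auto intro: strip_mult.real\<close>)
  next
    case False
    define a where "a = \<bar>Re \<rho>\<bar>"
    define b where "b = \<bar>Im \<rho>\<bar>"
    have ab: "0 < a" "0 < b" using False by (auto simp: a_def b_def Im_power2)
    have ne: "1 - (cnj \<rho>)\<^sup>2 / \<rho>\<^sup>2 \<noteq> 0"
    proof
      assume "1 - (cnj \<rho>)\<^sup>2 / \<rho>\<^sup>2 = 0"
      then have "cnj (\<rho>\<^sup>2) = \<rho>\<^sup>2" using \<rho>(2) by simp
      then have "Im (\<rho>\<^sup>2) = 0" by (simp add: complex_eq_iff del: complex_cnj_power)
      then show False using False by simp
    qed
    have "F (cnj \<rho>) = 0" using F(2) \<rho>(1) by (simp add: real_fun_def)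
    then have "G (cnj \<rho>) = 0" using G(2)[of "cnj \<rho>"] ne by (metis mult_eq_0_iff)
    then obtain H where H: "even_entire H" "\<And>u. G u = (1 - u\<^sup>2 / (cnj \<rho>)\<^sup>2) * H u"
      using even_entire_divide_root[OF G(1), of "cnj \<rho>"] \<rho>(2) by auto
    define p where "p u = (1 - u\<^sup>2 / \<rho>\<^sup>2) * (1 - u\<^sup>2 / (cnj \<rho>)\<^sup>2)" for u
    define K where "K = (norm \<rho>) ^ 4"
    have K: "K \<noteq> 0" using \<rho>(2) by (simp add: K_def)
    have FH: "F u = p u * H u" for u unfolding G(2) H(2) p_def by simp
    show ?thesis
    proof (rule that[of H p "1 / K" "\<lambda>x. (x - (a\<^sup>2 - b\<^sup>2))\<^sup>2 + (2 * a * b)\<^sup>2"])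
      have "{u. p u = 0} = {u. 1 - u\<^sup>2 / \<rho>\<^sup>2 = 0} \<union> {u. 1 - u\<^sup>2 / (cnj \<rho>)\<^sup>2 = 0}" by (auto simp: p_def)
      then have "finite {u. p u = 0}" using finite_quadratic_zeros by (metis finite_UnI)
      then show "real_fun H"
        using H F by (intro real_fun_cancel[OF _ _ F(2) _ FH])
          (auto simp: even_entire_def real_fun_def p_def)
      show "3 \<le> norm (p u)" if "norm u = 2 * R" for u
      proof -
        have "3 \<le> norm (1 - u\<^sup>2 / \<rho>\<^sup>2)" "3 \<le> norm (1 - u\<^sup>2 / (cnj \<rho>)\<^sup>2)"
          using that \<rho> R by (auto intro!: norm_one_minus_ratio)
        then have "3 * 1 \<le> norm (1 - u\<^sup>2 / \<rho>\<^sup>2) * norm (1 - u\<^sup>2 / (cnj \<rho>)\<^sup>2)" by (intro mult_mono) auto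
        then show ?thesis by (simp add: p_def norm_mult)
      qed
      show "p (of_real x) = of_real (1 / K * ((x\<^sup>2 - (a\<^sup>2 - b\<^sup>2))\<^sup>2 + (2 * a * b)\<^sup>2))" for x
      proof -
        have "p (of_real x) = ((of_real x)\<^sup>2 - \<rho>\<^sup>2) * ((of_real x)\<^sup>2 - (cnj \<rho>)\<^sup>2) / ((\<rho> * cnj \<rho>)\<^sup>2)"
          using \<rho>(2) by (simp add: p_def field_simps power2_eq_square)
        also have "(\<rho> * cnj \<rho>)\<^sup>2 = of_real K"
          unfolding complex_norm_square[symmetric] by (simp add: K_def flip: of_real_power power_mult)
        also have "((of_real x)\<^sup>2 - \<rho>\<^sup>2) * ((of_real x)\<^sup>2 - (cnj \<rho>)\<^sup>2)
            = ((of_real x)\<^sup>2 - \<rho>\<^sup>2) * cnj ((of_real x)\<^sup>2 - \<rho>\<^sup>2)" by simp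
        also have "\<dots> = of_real ((x\<^sup>2 - (a\<^sup>2 - b\<^sup>2))\<^sup>2 + (2 * a * b)\<^sup>2)"
          unfolding complex_mult_cnj by (simp add: a_def b_def Re_power2 Im_power2 power_mult_distrib flip: of_real_power)
        finally show ?thesis by simp
      qed
      show "strip_mult h (\<lambda>x. M x * ((x - (a\<^sup>2 - b\<^sup>2))\<^sup>2 + (2 * a * b)\<^sup>2))"
        using M ab \<rho>(4) by (intro strip_mult.complex) (auto simp: a_def)
    qed (use H FH K in \<open>auto simp: p_def\<close>)
  qed
qed

lemma entire_bound_on_sphere:
  assumes "f holomorphic_on UNIV" "0 < r" "\<And>u. norm u = r \<Longrightarrow> norm (f u) \<le> B" "norm u \<le> r"
  shows "norm (f u :: complex) \<le> B"
proof (rule maximum_modulus_frontier[of f "cball 0 r"])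
  show "f holomorphic_on interior (cball 0 r)" using assms(1) by (rule holomorphic_on_subset) auto
  show "continuous_on (closure (cball 0 r)) f"
    using holomorphic_imp_continuous_UNIV[OF assms(1)] by (rule continuous_on_subset) auto
  show "norm (f z) \<le> B" if "z \<in> frontier (cball 0 r)" for z
    using that assms(2,3) by (auto simp: frontier_cball)
qed (use assms in auto)

text \<open>The removal must stop: each step keeps the value at 0 and divides the bound on the
  sphere of radius \<open>2 R\<close> by at least 3, so after many steps the maximum principle would
  contradict \<open>F 0 \<noteq> 0\<close>. Multiplicities need no separate count.\<close>

lemma divide_out_zeros:
  assumes F: "even_entire F" "real_fun F" "F 0 \<noteq> 0" and R: "0 < R"
    and zeros: "zero_set F \<subseteq> strip h"
  obtains G p c M where "even_entire G" "real_fun G" "\<And>u. F u = p u * G u" "p 0 = 1"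
    "\<And>u. norm u = 2 * R \<Longrightarrow> 1 \<le> norm (p u)" "c \<noteq> 0" "strip_mult h M"
    "\<And>x. p (of_real x) = of_real (c * M (x\<^sup>2))" "\<And>u. norm u \<le> R \<Longrightarrow> G u \<noteq> 0"
proof (rule ccontr)
  note result = that
  assume no: "\<not> thesis"
  define Q where "Q k G p c M \<longleftrightarrow> even_entire G \<and> real_fun G \<and> (\<forall>u. F u = p u * G u) \<and> p 0 = 1 \<and>
    (\<forall>u. norm u = 2 * R \<longrightarrow> 3 ^ k \<le> norm (p u)) \<and> c \<noteq> 0 \<and> strip_mult h M \<and>
    (\<forall>x. p (of_real x) = of_real (c * M (x\<^sup>2)))" for k :: nat and G p c M
  have "\<exists>G p c M. Q k G p c M" for k
  proof (induction k)
    case 0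
    have "Q 0 F (\<lambda>_. 1) 1 (\<lambda>_. 1)" unfolding Q_def using F by (auto intro: strip_mult.one)
    then show ?case by blast
  next
    case (Suc k)
    then obtain G p c M where Q: "Q k G p c M" by blast
    have "1 \<le> norm (p u)" if "norm u = 2 * R" for u
    proof -
      have "3 ^ k \<le> norm (p u)" using Q that unfolding Q_def by blast
      then show ?thesis using one_le_power[where a = "3::real" and n = k] by linarith
    qed
    then obtain \<rho> where \<rho>: "norm \<rho> \<le> R" "G \<rho> = 0"
      using Q no result[of G p c M] unfolding Q_def by metis
    have "F \<rho> = 0" using Q \<rho> by (simp add: Q_def)
    then have "\<bar>Re \<rho>\<bar> \<le> h" using zeros by (auto simp: zero_set_def strip_def)
    moreover have "\<rho> \<noteq> 0" using F(3) \<open>F \<rho> = 0\<close> by auto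
    moreover have G: "even_entire G" "real_fun G" "strip_mult h M" using Q unfolding Q_def by blast+
    ultimately obtain G' p' c' M' where n: "even_entire G'" "real_fun G'" "\<And>u. G u = p' u * G' u" "p' 0 = 1"
      "\<And>u. norm u = 2 * R \<Longrightarrow> 3 \<le> norm (p' u)" "c' \<noteq> 0" "strip_mult h (\<lambda>x. M x * M' x)"
      "\<And>x. p' (of_real x) = of_real (c' * M' (x\<^sup>2))"
      using divide_out_zero[OF G(1,2) \<rho>(2) _ \<rho>(1) _ R G(3)] by blast
    have "3 ^ Suc k \<le> norm (p u * p' u)" if "norm u = 2 * R" for u
    proof -
      have "3 ^ k * 3 \<le> norm (p u) * norm (p' u)"
        using Q n(5) that unfolding Q_def by (intro mult_mono) auto
      then show ?thesis by (simp add: norm_mult mult.commute)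
    qed
    then have "Q (Suc k) G' (\<lambda>u. p u * p' u) (c * c') (\<lambda>x. M x * M' x)"
      using Q n unfolding Q_def by (auto simp: mult_ac)
    then show ?case by blast
  qed
  moreover have "\<exists>k. \<forall>G p c M. \<not> Q k G p c M"
  proof -
    have "continuous_on (sphere 0 (2 * R)) F"
      using F(1) holomorphic_imp_continuous_UNIV continuous_on_subset unfolding even_entire_def by blast
    then have "bounded (F ` sphere 0 (2 * R))" by (intro compact_imp_bounded compact_continuous_image) auto
    then obtain B where B: "0 < B" "\<And>u. norm u = 2 * R \<Longrightarrow> norm (F u) \<le> B"
      unfolding bounded_pos by auto
    obtain k where k: "B / norm (F 0) < 3 ^ k" using real_arch_pow[of 3] by auto
    have False if Q: "Q k G p c M" for G p c M
    proof -
      have "norm (G 0) \<le> B / 3 ^ k"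
      proof (rule entire_bound_on_sphere[of G "2 * R"])
        show "G holomorphic_on UNIV" using Q by (simp add: Q_def even_entire_def)
        show "norm (G u) \<le> B / 3 ^ k" if u: "norm u = 2 * R" for u
        proof -
          have "3 ^ k * norm (G u) \<le> norm (p u) * norm (G u)"
            using Q u unfolding Q_def by (intro mult_right_mono) auto
          also have "\<dots> = norm (F u)" using Q by (simp add: Q_def norm_mult)
          also have "\<dots> \<le> B" using B u by simp
          finally show ?thesis by (simp add: field_simps)
        qed
      qed (use R in auto)
      moreover have "F 0 = G 0" using Q by (simp add: Q_def)
      ultimately show False using k F(3) by (simp add: field_simps)
    qed
    then show ?thesis by blast
  qed
  ultimately show False by blast
qed

text \<open>
  A logarithm \<open>g\<close> with \<open>g(0) = 0\<close> has \<open>g'(0) = 0\<close> by evenness, so Schwarz' lemma for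
  \<open>g / (2A - g)\<close> (Borel-Caratheodory) gives a bound that is quadratic in \<open>u / R\<close>. It tends to \<open>0\<close>
  for order less than two.
\<close>

lemma even_zero_free_log:
  assumes G: "even_entire G" and R: "0 < R" and nz: "\<And>u. norm u < R \<Longrightarrow> G u \<noteq> 0"
    and B: "\<And>u. norm u < R \<Longrightarrow> norm (G u) \<le> B"
  obtains g where "\<And>u. norm u < R \<Longrightarrow> G u = G 0 * exp (g u)"
    "\<And>u. norm u \<le> R / 2 \<Longrightarrow> norm (g u) \<le> 8 * (ln (B / norm (G 0)) + 1) * (norm u)\<^sup>2 / R\<^sup>2"
proof -
  \<comment> \<open>The summand 1 makes \<open>Re g < A\<close> strict and \<open>A\<close>
    positive.\<close>
  define A where "A = ln (B / norm (G 0)) + 1"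
  have hol: "G holomorphic_on UNIV" and even: "\<And>u. G (- u) = G u" using G by (auto simp: even_entire_def)
  have "simply_connected (ball (0::complex) R)" by (intro convex_imp_simply_connected convex_ball)
  then have "\<forall>f. f holomorphic_on ball 0 R \<and> (\<forall>z\<in>ball 0 R. f z \<noteq> 0) \<longrightarrow>
      (\<exists>g. g holomorphic_on ball 0 R \<and> (\<forall>z\<in>ball 0 R. f z = exp (g z)))"
    by (rule conjunct2[OF iffD1[OF simply_connected_eq_holomorphic_log[OF open_ball]]])
  moreover have "G holomorphic_on ball 0 R \<and> (\<forall>z\<in>ball 0 R. G z \<noteq> 0)"
    using holomorphic_on_subset[OF hol] nz by simp
  ultimately have "\<exists>g. g holomorphic_on ball 0 R \<and> (\<forall>z\<in>ball 0 R. G z = exp (g z))" by (elim allE impE)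
  then obtain g0 where g0: "g0 holomorphic_on ball 0 R" "\<And>z. z \<in> ball 0 R \<Longrightarrow> G z = exp (g0 z)" by (elim exE conjE) simp
  define g where "g z = g0 z - g0 0" for z
  have gh: "g holomorphic_on ball 0 R" unfolding g_def[abs_def] by (intro holomorphic_intros g0)
  have g_0: "g 0 = 0" by (simp add: g_def)
  have Gg: "G z = G 0 * exp (g z)" if "norm z < R" for z
    using that R by (simp add: g0(2) g_def exp_diff)
  have G0: "0 < norm (G 0)" "norm (G 0) \<le> B" using nz[of 0] B[of 0] R by auto
  have "1 \<le> A" using G0 by (simp add: A_def)
  have Re_less: "Re (g z) < A" if "norm z < R" for z
  proof -
    have "norm (G 0 * exp (g z)) \<le> B" using B[OF that] Gg[OF that] by metis
    then have "norm (G 0) * exp (Re (g z)) \<le> B" by (simp add: norm_mult)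
    then have "exp (Re (g z)) \<le> B / norm (G 0)" using G0(1) by (simp add: field_simps)
    moreover have "0 < B / norm (G 0)" using less_le_trans[OF G0] G0(1) by (intro divide_pos_pos)
    ultimately have "Re (g z) \<le> ln (B / norm (G 0))" by (simp only: ln_ge_iff)
    then show ?thesis by (simp add: A_def)
  qed
  have d0: "deriv g 0 = 0"
  proof -
    have DG: "(G has_field_derivative deriv G 0) (at 0)" by (rule holomorphic_derivI[OF hol]) auto
    have "((\<lambda>z. G (- z)) has_field_derivative deriv G 0 * (- 1)) (at 0)"
      by (rule DERIV_chain2[of G _ uminus]) (use DG in \<open>auto intro!: derivative_eq_intros\<close>)
    then have "(G has_field_derivative - deriv G 0) (at 0)" by (simp add: even)
    from DERIV_unique[OF this DG] have G'0: "deriv G 0 = 0" by simp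
    have Dg: "(g has_field_derivative deriv g 0) (at 0)" by (rule holomorphic_derivI[OF gh]) (use R in auto)
    have "((\<lambda>z. G 0 * exp (g z)) has_field_derivative G 0 * (exp (g 0) * deriv g 0)) (at 0)"
      by (intro DERIV_cmult DERIV_chain2[OF DERIV_exp Dg])
    then have "(G has_field_derivative G 0 * (exp (g 0) * deriv g 0)) (at 0)"
    proof (rule has_field_derivative_transform_within_open[of _ _ _ "ball 0 R"])
      show "G 0 * exp (g z) = G z" if "z \<in> ball 0 R" for z by (rule Gg[symmetric]) (use that in simp)
    qed (use R in auto)
    from DERIV_unique[OF this DG] show ?thesis using G'0 G0 g_0 by simp
  qed
  \<comment> \<open>Points with real part below \<open>A\<close> are closer to 0 than to
    \<open>2 A\<close>.\<close>
  have lt: "norm (g z) < norm (of_real (2 * A) - g z)" if "norm z < R" for z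
  proof -
    have "0 < 4 * A * (A - Re (g z))"
      using Re_less[OF that] \<open>1 \<le> A\<close> by (intro mult_pos_pos) auto
    then have "(Re (g z))\<^sup>2 + (Im (g z))\<^sup>2 < (2 * A - Re (g z))\<^sup>2 + (Im (g z))\<^sup>2"
      by (simp add: power2_eq_square algebra_simps)
    then show ?thesis by (simp add: cmod_def)
  qed
  have half: "norm (g z) \<le> 2 * A" if z: "norm z \<le> R / 2" for z
  proof -
    define f where "f w = g (of_real R * w) / (of_real (2 * A) - g (of_real R * w))" for w
    have in_ball: "norm (of_real R * w) < R" if "norm w < 1" for w :: complex
      using that R by (simp add: norm_mult)
    have gR: "(\<lambda>w. g (of_real R * w)) holomorphic_on ball 0 1"
      using in_ball by (intro holomorphic_on_compose_gen[OF _ gh, unfolded o_def] holomorphic_intros) auto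
    have "f holomorphic_on ball 0 1"
      unfolding f_def[abs_def]
    proof (intro holomorphic_intros gR)
      fix w :: complex assume "w \<in> ball 0 1"
      then show "of_real (2 * A) - g (of_real R * w) \<noteq> 0" using lt[OF in_ball, of w] by auto
    qed
    moreover have "f 0 = 0" by (simp add: f_def g_0)
    moreover have "norm (f w) < 1" if "norm w < 1" for w
      using lt[OF in_ball[OF that]] unfolding f_def norm_divide
      by (subst divide_less_eq_1_pos) (auto intro: le_less_trans[OF norm_ge_zero])
    moreover have "norm (z / of_real R) < 1" using z R by (simp add: norm_divide)
    ultimately have "norm (f (z / of_real R)) \<le> norm (z / of_real R)" by (rule Schwarz_Lemma)
    also have "\<dots> \<le> 1 / 2" using z R by (simp add: norm_divide field_simps)
    finally have "norm (g z) / norm (of_real (2 * A) - g z) \<le> 1 / 2"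
      using R by (simp add: f_def norm_divide)
    moreover have "0 < norm (of_real (2 * A) - g z)" using lt[of z] z R le_less_trans[OF norm_ge_zero] by auto
    ultimately have "norm (g z) \<le> norm (of_real (2 * A) - g z) / 2" by (simp add: field_simps)
    moreover have "norm (of_real (2 * A) - g z) \<le> 2 * A + norm (g z)"
      using norm_triangle_ineq4[of "of_real (2 * A)" "g z"] \<open>1 \<le> A\<close> by simp
    ultimately show ?thesis by linarith
  qed
  define g1 where "g1 z = (if z = 0 then deriv g 0 else (g z - g 0) / (z - 0))" for z
  have g1: "g1 holomorphic_on ball 0 R" unfolding g1_def[abs_def] by (rule pole_lemma_open[OF gh open_ball])
  define g2 where "g2 z = (if z = 0 then deriv g1 0 else (g1 z - g1 0) / (z - 0))" for z
  have g2: "g2 holomorphic_on ball 0 R" unfolding g2_def[abs_def] by (rule pole_lemma_open[OF g1 open_ball])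
  have gg2: "g z = z\<^sup>2 * g2 z" for z
    by (simp add: g2_def g1_def g_0 d0 power2_eq_square)
  \<comment> \<open>On the sphere of radius \<open>R / 2\<close> the bound \<open>2 A\<close> on
    \<open>g\<close>, divided by \<open>(R / 2)\<^sup>2\<close>, is
    \<open>8 A / R\<^sup>2\<close>.\<close>
  have g2_le: "norm (g2 z) \<le> 8 * A / R\<^sup>2" if z: "norm z \<le> R / 2" for z
  proof (rule maximum_modulus_frontier[of g2 "cball 0 (R / 2)"])
    show "g2 holomorphic_on interior (cball 0 (R / 2))"
      using R by (intro holomorphic_on_subset[OF g2]) auto
    show "continuous_on (closure (cball 0 (R / 2))) g2"
      using R by (intro continuous_on_subset[OF holomorphic_on_imp_continuous_on[OF g2]]) auto
    show "norm (g2 w) \<le> 8 * A / R\<^sup>2" if "w \<in> frontier (cball 0 (R / 2))" for w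
    proof -
      have w: "norm w = R / 2" using that by (simp add: frontier_cball)
      have "norm (g w) \<le> 2 * A" by (rule half) (simp add: w)
      then have "(norm w)\<^sup>2 * norm (g2 w) \<le> 2 * A" by (simp add: gg2 norm_mult norm_power)
      then have "(R / 2)\<^sup>2 * norm (g2 w) \<le> 2 * A" by (simp only: w)
      then show ?thesis using R by (simp add: field_simps power2_eq_square)
    qed
  qed (use z in auto)
  show ?thesis
  proof (rule that[OF Gg])
    show "norm (g u) \<le> 8 * (ln (B / norm (G 0)) + 1) * (norm u)\<^sup>2 / R\<^sup>2" if "norm u \<le> R / 2" for u
      using mult_left_mono[OF g2_le[OF that], of "(norm u)\<^sup>2"]
      by (simp add: gg2 norm_mult norm_power A_def mult_ac)
  qed
qed

text \<open>The exponent 3/2 is one choice between 1, as the order is at most one, and 2, the power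
  of \<open>R\<close> in the denominator.\<close>

lemma exists_radius_log_growth_small:
  fixes C a K :: real
  assumes "0 < C" "0 < a" "0 < \<delta>"
  obtains R where "r \<le> R" "8 * (ln (C * exp ((2 * R) powr (3/2)) / a) + 1) * K / R\<^sup>2 < \<delta>"
proof -
  have "((\<lambda>R. K * (8 * (ln C + (2 * R) powr (3/2) - ln a + 1) / R\<^sup>2)) \<longlongrightarrow> K * 0) at_top"
    by (intro tendsto_mult tendsto_const) real_asymp
  then have "\<forall>\<^sub>F R in at_top. K * (8 * (ln C + (2 * R) powr (3/2) - ln a + 1) / R\<^sup>2) < \<delta>"
    using assms(3) by (intro order_tendstoD(2)) auto
  then have "\<forall>\<^sub>F R in at_top. r \<le> R \<and> K * (8 * (ln C + (2 * R) powr (3/2) - ln a + 1) / R\<^sup>2) < \<delta>"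
    using eventually_ge_at_top by (rule eventually_elim2) auto
  then obtain R where R: "r \<le> R" "K * (8 * (ln C + (2 * R) powr (3/2) - ln a + 1) / R\<^sup>2) < \<delta>"
    using eventually_happens' trivial_limit_at_top_linorder by blast
  have eq: "ln (C * exp ((2 * R) powr (3/2)) / a) = ln C + (2 * R) powr (3/2) - ln a"
    using assms by (simp add: ln_mult ln_div)
  have "8 * (ln (C * exp ((2 * R) powr (3/2)) / a) + 1) * K / R\<^sup>2 < \<delta>"
    using R(2) unfolding eq by (simp add: mult_ac)
  then show ?thesis by (rule that[OF R(1)])
qed

text \<open>With the zeros in a large disc divided out, \<open>F = F(0) p exp g\<close>, and
  \<open>g\<close> is uniformly small on the fixed interval. Hence \<open>F(0) p\<close> is the
  approximating product.\<close>

lemma even_entire_approx: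
  assumes F: "even_entire F" "real_fun F" "F 0 \<noteq> 0" "zero_set F \<subseteq> strip h"
    and growth: "\<And>u. b \<le> norm u \<Longrightarrow> norm (F u) \<le> C * exp (norm u powr (3/2))"
    and \<eta>: "0 < \<eta>"
  obtains c M where "c \<noteq> 0" "strip_mult h M" "\<And>x. \<bar>x\<bar> \<le> K \<Longrightarrow> \<bar>Re (F (of_real x)) - c * M (x\<^sup>2)\<bar> < \<eta>"
proof -
  have hol: "F holomorphic_on UNIV" using F(1) by (simp add: even_entire_def)
  have "compact (F ` cball 0 K)"
    by (intro compact_continuous_image continuous_on_subset[OF holomorphic_imp_continuous_UNIV[OF hol]]) auto
  then obtain S where S: "0 < S" "\<And>u. norm u \<le> K \<Longrightarrow> norm (F u) \<le> S"
    using compact_imp_bounded[of "F ` cball 0 K"] unfolding bounded_pos by auto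
  define C' where "C' = max C 1"
  have C': "0 < C'" by (simp add: C'_def)
  define \<delta> where "\<delta> = min (1/2) (\<eta> / (4 * S))"
  have \<delta>: "0 < \<delta>" "\<delta> \<le> 1 / 2" "S * (2 * \<delta>) < \<eta>"
  proof -
    have "\<delta> \<le> \<eta> / (4 * S)" by (simp add: \<delta>_def)
    then have "S * \<delta> \<le> \<eta> / 4" using S by (simp add: field_simps)
    then show "S * (2 * \<delta>) < \<eta>" using \<eta> by simp
  qed (use S \<eta> in \<open>auto simp: \<delta>_def\<close>)
  obtain R where R: "max (max b 1) (2 * \<bar>K\<bar> + 1) \<le> R"
      "8 * (ln (C' * exp ((2 * R) powr (3/2)) / norm (F 0)) + 1) * K\<^sup>2 / R\<^sup>2 < \<delta>"
    using exists_radius_log_growth_small[of C' "norm (F 0)" \<delta>] C' F(3) \<delta>(1)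
    by (metis zero_less_norm_iff)
  then have R1: "b \<le> R" "1 \<le> R" "\<bar>K\<bar> \<le> R / 2" "0 < R" by auto
  define B where "B = C' * exp ((2 * R) powr (3/2))"
  obtain G p c M where G: "even_entire G" "\<And>u. F u = p u * G u" "p 0 = 1"
    "\<And>u. norm u = 2 * R \<Longrightarrow> 1 \<le> norm (p u)" "c \<noteq> 0" "strip_mult h M"
    "\<And>x. p (of_real x) = of_real (c * M (x\<^sup>2))" "\<And>u. norm u \<le> R \<Longrightarrow> G u \<noteq> 0"
    using divide_out_zeros[OF F(1-3) R1(4) F(4)] by metis
  have GB: "norm (G u) \<le> B" if "norm u \<le> 2 * R" for u
  proof (rule entire_bound_on_sphere[OF _ _ _ that])
    show "G holomorphic_on UNIV" using G(1) by (simp add: even_entire_def)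
    show "norm (G v) \<le> B" if v: "norm v = 2 * R" for v
    proof -
      have "1 * norm (G v) \<le> norm (p v) * norm (G v)" using G(4)[OF v] by (intro mult_right_mono) auto
      also have "\<dots> = norm (F v)" by (simp add: G(2) norm_mult)
      also have "\<dots> \<le> C * exp (norm v powr (3/2))" using v R1 by (intro growth) auto
      also have "\<dots> \<le> B" unfolding B_def C'_def v by (intro mult_right_mono) auto
      finally show ?thesis by simp
    qed
  qed (use R1 in auto)
  have nz: "\<And>u. norm u < R \<Longrightarrow> G u \<noteq> 0" using G(8) by simp
  have GB': "\<And>u. norm u < R \<Longrightarrow> norm (G u) \<le> B" using GB R1 by simp
  obtain g where g: "\<And>u. norm u < R \<Longrightarrow> G u = G 0 * exp (g u)"
    "\<And>u. norm u \<le> R / 2 \<Longrightarrow> norm (g u) \<le> 8 * (ln (B / norm (G 0)) + 1) * (norm u)\<^sup>2 / R\<^sup>2"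
    using even_zero_free_log[OF G(1) R1(4) nz GB'] by blast
  have F0: "F 0 = of_real (Re (F 0))"
    using F(2) by (metis Reals_cnj_iff complex_cnj_zero of_real_Re real_fun_def)
  have G0: "G 0 = F 0" using G(2,3) by simp
  show ?thesis
  proof (rule that[of "Re (F 0) * c" M])
    show "Re (F 0) * c \<noteq> 0" using F0 F(3) G(5) by (metis mult_eq_0_iff of_real_0)
    show "strip_mult h M" by (rule G(6))
    fix x :: real assume x: "\<bar>x\<bar> \<le> K"
    define u where "u = complex_of_real x"
    have u: "norm u \<le> K" "norm u \<le> R / 2" "norm u < R" using x R1 by (auto simp: u_def)
    have "norm (g u) \<le> \<delta>"
    proof -
      have "0 \<le> 8 * (ln (B / norm (G 0)) + 1)" 
      proof -
        have "norm (G 0) \<le> B" using GB[of 0] R1 by simp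
        then have "1 \<le> B / norm (G 0)" using F(3) G0 by (simp add: field_simps)
        then show ?thesis by simp
      qed
      moreover have "(norm u)\<^sup>2 \<le> K\<^sup>2" using u by (intro power_mono) auto
      ultimately have "8 * (ln (B / norm (G 0)) + 1) * (norm u)\<^sup>2 / R\<^sup>2 \<le> 8 * (ln (B / norm (G 0)) + 1) * K\<^sup>2 / R\<^sup>2"
        by (intro divide_right_mono mult_left_mono) auto
      with g(2)[OF u(2)] R(2) show ?thesis unfolding B_def G0 by linarith
    qed
    have "norm (exp (- g u) - 1) \<le> 3 / 2 * norm (- g u)"
      using \<open>norm (g u) \<le> \<delta>\<close> \<delta>(2) by (intro norm_exp_bounds(2)) simp
    then have e: "norm (exp (- g u) - 1) \<le> 2 * \<delta>"
      using \<open>norm (g u) \<le> \<delta>\<close> norm_ge_zero[of "g u"] unfolding norm_minus_cancel by linarith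
    have "F 0 * p u = F u * exp (- g u)"
      unfolding G(2)[of u] g(1)[OF u(3)] G0 by (simp add: exp_minus)
    then have "F 0 * p u - F u = F u * (exp (- g u) - 1)" by (simp add: algebra_simps)
    then have "norm (F 0 * p u - F u) \<le> S * (2 * \<delta>)"
      using S(2)[OF u(1)] e S(1) by (simp only: norm_mult) (intro mult_mono, auto)
    then have "norm (F 0 * p u - F u) < \<eta>" using \<delta>(3) by linarith
    moreover have "Re (F 0 * p u) = Re (F 0) * c * M (x\<^sup>2)"
      unfolding u_def G(7) by simp
    ultimately show "\<bar>Re (F (of_real x)) - Re (F 0) * c * M (x\<^sup>2)\<bar> < \<eta>"
      using abs_Re_le_cmod[of "F 0 * p u - F u"] unfolding u_def by simp
  qed
qed

subsection \<open>The quotient polynomials\<close>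

lemma real_fun_of_real: "real_fun H \<Longrightarrow> H (of_real x) = of_real (Re (H (of_real x)))"
  by (metis Reals_cnj_iff complex_cnj_complex_of_real of_real_Re real_fun_def)

lemma cpoly_sum: "finite A \<Longrightarrow> cpoly (\<Sum>k\<in>A. f k) = (\<Sum>k\<in>A. cpoly (f k))"
  by (induction rule: finite_induct) auto

text \<open>Indexed by the distance \<open>k\<close> from the middle, the terms
  \<open>j = n + 1 + k\<close> and \<open>j = n - k\<close> pair up by symmetry, and each pair is
  one basis polynomial.\<close>

lemma binomial_sample_eq_quot_basis:
  assumes H: "real_fun H" and s: "s = 1 \<or> s = -1" and sym: "\<And>u. H (-u) = of_real s * H u" and z: "z \<noteq> 0"
  shows "binomial_sample (2 * n + 1) H z = z ^ n * (z + of_real s) *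
    poly (cpoly (\<Sum>k\<le>n. smult (edge_seq 1 n k * Re (H (of_real (real k + 1/2)))) (quot_basis s k))) (z + inverse z)"
proof -
  define r where "r k = edge_seq 1 n k * Re (H (of_real (real k + 1/2)))" for k
  define b where "b j = of_nat ((2 * n + 1) choose j) * H (of_nat j - of_nat (2 * n + 1) / 2)" for j
  have high: "b (n + 1 + k) = of_real (r k)" for k
  proof -
    have "of_nat (n + 1 + k) - of_nat (2 * n + 1) / 2 = complex_of_real (real k + 1/2)"
      by (simp add: field_simps)
    then show ?thesis using real_fun_of_real[OF H, of "real k + 1/2"]
      unfolding b_def r_def edge_seq_even by (simp del: binomial_Suc_Suc of_real_add)
  qed
  have low: "b (n - k) = of_real s * of_real (r k)" if "k \<le> n" for k
  proof -
    have "of_nat (n - k) - of_nat (2 * n + 1) / 2 = - (of_nat (n + 1 + k) - of_nat (2 * n + 1) / 2 :: complex)"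
      using that by (simp add: of_nat_diff field_simps)
    moreover have "(2 * n + 1) choose (n - k) = (2 * n + 1) choose (n + 1 + k)"
      using that by (subst binomial_symmetric) auto
    ultimately have "b (n - k) = of_real s * b (n + 1 + k)" by (simp only: b_def sym mult_ac)
    then show ?thesis by (simp only: high)
  qed
  have "{0..2*n+1} = {..n} \<union> {n+1..2*n+1}" by auto
  then have "binomial_sample (2 * n + 1) H z = (\<Sum>j\<le>n. b j * z ^ j) + (\<Sum>j=n+1..2*n+1. b j * z ^ j)"
    unfolding binomial_sample_def b_def by (simp only:) (intro sum.union_disjoint, auto)
  also have "(\<Sum>j=n+1..2*n+1. b j * z ^ j) = (\<Sum>k\<le>n. b (n+1+k) * z ^ (n+1+k))"
    by (intro sum.reindex_bij_witness[of _ "\<lambda>k. n+1+k" "\<lambda>j. j-(n+1)"]) auto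
  also have "(\<Sum>j\<le>n. b j * z ^ j) = (\<Sum>k\<le>n. b (n-k) * z ^ (n-k))"
    by (intro sum.reindex_bij_witness[of _ "\<lambda>k. n-k" "\<lambda>j. n-j"]) auto
  also have "(\<Sum>k\<le>n. b (n-k) * z ^ (n-k)) + (\<Sum>k\<le>n. b (n+1+k) * z ^ (n+1+k))
      = (\<Sum>k\<le>n. of_real (r k) * (z ^ n * (z + of_real s) * poly (cpoly (quot_basis s k)) (z + inverse z)))"
    unfolding sum.distrib[symmetric]
  proof (intro sum.cong refl)
    fix k assume "k \<in> {..n}"
    then have k: "k \<le> n" by simp
    have e: "z ^ n = z ^ (n - k) * z ^ k" "z ^ (n + 1 + k) = z ^ (n - k) * z ^ (2 * k + 1)"
      using k by (simp_all add: add.commute flip: power_add)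
    have "b (n-k) * z ^ (n-k) + b (n+1+k) * z ^ (n+1+k) = of_real (r k) * (z ^ (n - k) * (z ^ (2 * k + 1) + of_real s))"
      unfolding low[OF k] high e(2) by (simp only: algebra_simps)
    then show "b (n-k) * z ^ (n-k) + b (n+1+k) * z ^ (n+1+k)
      = of_real (r k) * (z ^ n * (z + of_real s) * poly (cpoly (quot_basis s k)) (z + inverse z))"
      unfolding quot_basis[OF s z, symmetric] e(1) by (simp only: mult_ac)
  qed
  finally show ?thesis unfolding r_def[symmetric]
    by (simp add: cpoly_sum poly_sum sum_distrib_left mult_ac)
qed

lemma quot_minus_sum:
  assumes "real_fun F" "\<And>u. F (-u) = F u"
  shows "quot_minus F n = hpoly n (\<lambda>k. Re (F (of_real (real k + 1/2))) * edge_seq 1 n k)"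
proof -
  have sym: "F (-u) = of_real 1 * F u" for u using assms(2) by simp
  show ?thesis unfolding quot_minus_def
  proof (rule the1_equality)
    show "\<exists>!C. \<forall>z. z \<noteq> 0 \<longrightarrow>
        binomial_sample (2 * n + 1) F z = z ^ n * (z + 1) * poly (cpoly C) (z + inverse z)"
      using quotient_ex1[OF assms(1) _ sym, of n] by simp
    show "\<forall>z. z \<noteq> 0 \<longrightarrow> binomial_sample (2 * n + 1) F z = z ^ n * (z + 1) *
        poly (cpoly (hpoly n (\<lambda>k. Re (F (of_real (real k + 1/2))) * edge_seq 1 n k))) (z + inverse z)"
      using binomial_sample_eq_quot_basis[OF assms(1) _ sym, of _ n] by (simp add: hpoly_def mult.commute)
  qed
qed

lemma quot_basis_reflect: "poly (quot_basis (-1) k) (- x) = (-1) ^ k * poly (quot_basis 1 k) x"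
  by (induction "1::real" k rule: quot_basis.induct) (auto simp: algebra_simps)

text \<open>The odd quotient is expanded in Chebyshev polynomials of the fourth kind, which the
  reflection turns into those of the third kind with sign \<open>(-1)\<^sup>k\<close>.\<close>

lemma quot_plus_reflect:
  assumes "real_fun G" "\<And>u. G (-u) = - G u"
  shows "quot_plus G n \<circ>\<^sub>p [:0, -1:] = hpoly n (\<lambda>k. (-1) ^ k * Re (G (of_real (real k + 1/2))) * edge_seq 1 n k)"
proof -
  have sym: "G (-u) = of_real (-1) * G u" for u using assms(2) by simp
  let ?Q = "\<Sum>k\<le>n. smult (edge_seq 1 n k * Re (G (of_real (real k + 1/2)))) (quot_basis (-1) k)"
  have "quot_plus G n = ?Q" unfolding quot_plus_def
  proof (rule the1_equality)
    show "\<exists>!C. \<forall>z. z \<noteq> 0 \<longrightarrow>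
        binomial_sample (2 * n + 1) G z = z ^ n * (z - 1) * poly (cpoly C) (z + inverse z)"
      using quotient_ex1[OF assms(1) _ sym, of n] by simp
    show "\<forall>z. z \<noteq> 0 \<longrightarrow> binomial_sample (2 * n + 1) G z = z ^ n * (z - 1) * poly (cpoly ?Q) (z + inverse z)"
      using binomial_sample_eq_quot_basis[OF assms(1) _ sym, of _ n] by simp
  qed
  then show ?thesis
    by (intro poly_ext) (simp add: poly_pcompose poly_sum hpoly_def quot_basis_reflect mult_ac)
qed

lemma cpoly_uminus: "cpoly (- p) = - cpoly p"
  using cpoly_simps(3)[of 0 p] by simp

lemma cpoly_pcompose_reflect: "poly (cpoly (p \<circ>\<^sub>p [:0, -1:])) z = poly (cpoly p) (- z)"
  by (induction p) (simp_all add: pcompose_pCons cpoly_mult cpoly_uminus)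

lemma real_rooted_reflect:
  assumes "real_rooted (p \<circ>\<^sub>p [:0, -1:])"
  shows "real_rooted p"
  unfolding real_rooted_def
proof (intro allI impI)
  fix z assume "poly (cpoly p) z = 0"
  then have "poly (cpoly (p \<circ>\<^sub>p [:0, -1:])) (- z) = 0" by (simp add: cpoly_pcompose_reflect)
  then have "- z \<in> \<real>" using assms unfolding real_rooted_def by blast
  then show "z \<in> \<real>" by simp
qed

lemma smult_sum_right: "smult a (\<Sum>k\<in>S. f k) = (\<Sum>k\<in>S. smult a (f k))"
  by (induction S rule: infinite_finite_induct) (simp_all add: smult_add_right)

lemma hpoly_add_smult: "hpoly (n + 1) c + smult t (hpoly n d) = hpoly (n + 1) (\<lambda>k. c k + t * (if k \<le> n then d k else 0))"
proof -
  have "hpoly n d = (\<Sum>k\<le>n + 1. smult (if k \<le> n then d k else 0) (quot_basis 1 k))"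
    by (simp add: hpoly_def)
  then show ?thesis by (simp add: hpoly_def sum.distrib smult_add_left smult_add_right smult_sum_right)
qed

lemma hpoly_cong: "(\<And>k. k \<le> n \<Longrightarrow> c k = d k) \<Longrightarrow> hpoly n c = hpoly n d"
  by (simp add: hpoly_def)

text \<open>\<open>n = 0\<close> is separate: the degree is at most one, so no sign change is
  needed.\<close>

lemma hpoly_real_rooted:
  assumes "hpoly (n + 1) c \<noteq> 0" "0 < n \<Longrightarrow> osc n (n + 1) c"
  shows "real_rooted (hpoly (n + 1) c)"
proof (rule vertically_increasing_imp_real_rooted[OF _ assms(1)])
  show "vertically_increasing (hpoly (n + 1) c)"
  proof (cases n)
    case 0
    then show ?thesis using degree_hpoly[of "n + 1" c] by (intro vertically_increasing_linear) simp
  next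
    case (Suc n')
    then show ?thesis using assms(2) osc_imp_vertically_increasing by simp
  qed
qed

lemma quot_minus_weak_obreschkoff:
  assumes F: "real_fun F" "\<And>u. F (-u) = F u"
    and osc: "\<And>t. 0 < n \<Longrightarrow>
      osc n (n + 1) (\<lambda>k. Re (F (of_real (real k + 1/2))) * (edge_seq 1 (n + 1) k + t * edge_seq 1 n k))"
  shows "quot_minus F n \<preceq>\<^sub>O quot_minus F (n + 1)"
  unfolding weak_obreschkoff_def
proof (intro allI impI)
  fix t
  have eq: "quot_minus F (n + 1) + smult t (quot_minus F n) =
      hpoly (n + 1) (\<lambda>k. Re (F (of_real (real k + 1/2))) * (edge_seq 1 (n + 1) k + t * edge_seq 1 n k))"
    unfolding quot_minus_sum[OF F] hpoly_add_smult
    by (intro hpoly_cong) (auto simp: edge_seq_support algebra_simps)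
  assume "quot_minus F (n + 1) + smult t (quot_minus F n) \<noteq> 0"
  then show "real_rooted (quot_minus F (n + 1) + smult t (quot_minus F n))"
    unfolding eq by (rule hpoly_real_rooted) (rule osc)
qed

lemma quot_plus_weak_obreschkoff:
  assumes G: "real_fun G" "\<And>u. G (-u) = - G u" and F: "\<And>u. G u = u * F u"
    and osc: "\<And>t. 0 < n \<Longrightarrow>
      osc n (n + 1) (\<lambda>k. Re (F (of_real (real k + 1/2))) * (edge_seq (-1) (n + 1) k + t * edge_seq (-1) n k))"
  shows "quot_plus G n \<preceq>\<^sub>O quot_plus G (n + 1)"
  unfolding weak_obreschkoff_def
proof (intro allI impI)
  fix t
  let ?p = "quot_plus G (n + 1) + smult t (quot_plus G n)"
  define f where "f k = Re (F (of_real (real k + 1/2)))" for k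
  \<comment> \<open>\<open>edge_seq_odd'\<close> produces the factors \<open>n + 3/2\<close> and
    \<open>n + 1/2\<close> in the two members of the pencil. The first is pulled out, and the
    parameter is rescaled to \<open>b\<close>.\<close>
  define a where "a = real n + 3/2"
  define b where "b = t * (real n + 1/2) / a"
  have "0 < a" by (simp add: a_def)
  have c: "(-1) ^ k * Re (G (of_real (real k + 1/2))) * edge_seq 1 m k = (real m + 1/2) * (f k * edge_seq (-1) m k)" for k m
  proof -
    have "(-1) ^ k * Re (G (of_real (real k + 1/2))) * edge_seq 1 m k = f k * ((-1) ^ k * (2 * real k + 1) * edge_seq 1 m k) / 2"
      by (simp add: F f_def field_simps)
    then show ?thesis unfolding edge_seq_odd'[symmetric] by (simp add: algebra_simps)
  qed
  have "?p \<circ>\<^sub>p [:0, -1:] = hpoly (n + 1) (\<lambda>k. (real (n + 1) + 1/2) * (f k * edge_seq (-1) (n + 1) k))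
      + smult t (hpoly n (\<lambda>k. (real n + 1/2) * (f k * edge_seq (-1) n k)))"
    unfolding pcompose_add pcompose_smult quot_plus_reflect[OF G] c ..
  also have "\<dots> = hpoly (n + 1) (\<lambda>k. a * (f k * (edge_seq (-1) (n + 1) k + b * edge_seq (-1) n k)))"
    unfolding hpoly_add_smult
  proof (rule hpoly_cong)
    fix k
    have "a * b = t * (real n + 1/2)" using \<open>0 < a\<close> by (simp add: b_def)
    then have "a * (f k * (edge_seq (-1) (n + 1) k + b * edge_seq (-1) n k)) =
      a * (f k * edge_seq (-1) (n + 1) k) + t * (real n + 1/2) * (f k * edge_seq (-1) n k)" by algebra
    then show "(real (n + 1) + 1/2) * (f k * edge_seq (-1) (n + 1) k)
        + t * (if k \<le> n then (real n + 1/2) * (f k * edge_seq (-1) n k) else 0)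
      = a * (f k * (edge_seq (-1) (n + 1) k + b * edge_seq (-1) n k))"
      by (simp add: a_def edge_seq_support)
  qed
  finally have eq: "?p \<circ>\<^sub>p [:0, -1:] = \<dots>" .
  assume "?p \<noteq> 0"
  then have "?p \<circ>\<^sub>p [:0, -1:] \<noteq> 0" by (simp add: pcompose_eq_0_iff)
  moreover have "osc n (n + 1) (\<lambda>k. a * (f k * (edge_seq (-1) (n + 1) k + b * edge_seq (-1) n k)))" if "0 < n"
    using \<open>0 < a\<close> osc[OF that] unfolding f_def by (intro keepsD[OF keeps_const]) auto
  ultimately have "real_rooted (?p \<circ>\<^sub>p [:0, -1:])" unfolding eq by (rule hpoly_real_rooted)
  then show "real_rooted ?p" by (rule real_rooted_reflect)
qed

section \<open>Zeros at the origin and the passage to entire functions\<close>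

lemma even_entire_divide_square:
  assumes F: "even_entire F" "real_fun F" "F 0 = 0"
  obtains G where "even_entire G" "real_fun G" "\<And>u. F u = u\<^sup>2 * G u"
proof -
  have hol: "F holomorphic_on UNIV" and even: "\<And>u. F (- u) = F u" using F(1) by (auto simp: even_entire_def)
  obtain G1 where G1: "G1 holomorphic_on UNIV" "\<And>u. F u = (u - 0) * G1 u"
    using entire_divide_root[OF hol F(3)] by blast
  have c1: "continuous_on UNIV G1" using G1(1) by (rule holomorphic_imp_continuous_UNIV)
  have "G1 = (\<lambda>u. - G1 (- u))"
  proof (rule continuous_cancel[OF c1])
    show "continuous_on UNIV (\<lambda>u. - G1 (- u))"
      by (intro continuous_intros continuous_on_compose2[OF c1]) auto
    show "u * G1 u = u * - G1 (- u)" for u using even[of u] by (simp add: G1(2))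
  qed simp
  then have "G1 0 = - G1 (- 0)" by (rule fun_cong)
  then have "G1 0 = 0" by simp
  then obtain G where G: "G holomorphic_on UNIV" "\<And>u. G1 u = (u - 0) * G u"
    using entire_divide_root[OF G1(1)] by blast
  have eq: "F u = u\<^sup>2 * G u" for u by (simp add: G1(2) G(2) power2_eq_square)
  have c: "continuous_on UNIV G" using G(1) by (rule holomorphic_imp_continuous_UNIV)
  have "G = (\<lambda>u. G (- u))"
  proof (rule continuous_cancel[OF c])
    show "continuous_on UNIV (\<lambda>u. G (- u))" by (intro continuous_intros continuous_on_compose2[OF c]) auto
    show "u\<^sup>2 * G u = u\<^sup>2 * G (- u)" for u using even[of u] by (auto simp: eq)
  qed simp
  then have "G u = G (- u)" for u by (rule fun_cong)
  then have "even_entire G" using G(1) by (simp add: even_entire_def)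
  moreover have "real_fun G"
    by (rule real_fun_cancel[OF G(1) _ F(2) _ eq]) (auto simp: real_fun_def)
  ultimately show ?thesis using eq by (rule that)
qed

text \<open>If all even powers of \<open>u\<close> divided \<open>F\<close>, the maximum principle
  on a sphere of radius more than twice \<open>norm z\<close> would bound \<open>norm (F z)\<close>
  by \<open>B / 4\<^sup>j\<close> for every \<open>j\<close>.\<close>

lemma even_entire_factor_zero:
  assumes F: "even_entire F" "real_fun F" "F \<noteq> (\<lambda>_. 0)"
  obtains G j where "even_entire G" "real_fun G" "\<And>u. F u = u ^ (2 * j) * G u" "G 0 \<noteq> 0"
proof (rule ccontr)
  note result = that
  assume no: "\<not> thesis"
  have ex: "\<exists>G. even_entire G \<and> real_fun G \<and> (\<forall>u. F u = u ^ (2 * j) * G u)" for j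
  proof (induction j)
    case 0
    then show ?case using F by (intro exI[of _ F]) simp
  next
    case (Suc j)
    then obtain G where G: "even_entire G" "real_fun G" "\<And>u. F u = u ^ (2 * j) * G u" by blast
    have "G 0 = 0" using result[OF G] no by blast
    then obtain H where H: "even_entire H" "real_fun H" "\<And>u. G u = u\<^sup>2 * H u"
      using even_entire_divide_square[OF G(1,2)] by blast
    have "F u = u ^ (2 * Suc j) * H u" for u by (simp add: G(3) H(3) power2_eq_square)
    then show ?case using H(1,2) by blast
  qed
  obtain z where z: "F z \<noteq> 0" using F(3) by auto
  define r where "r = 2 * norm z + 1"
  have r: "0 < r" by (simp add: r_def add_nonneg_pos)
  have hol: "F holomorphic_on UNIV" using F(1) by (simp add: even_entire_def)
  have "bounded (F ` sphere 0 r)"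
    by (intro compact_imp_bounded compact_continuous_image
        continuous_on_subset[OF holomorphic_imp_continuous_UNIV[OF hol]]) auto
  then obtain B where B: "0 < B" "\<And>u. norm u = r \<Longrightarrow> norm (F u) \<le> B" unfolding bounded_pos by auto
  obtain j where j: "B / norm (F z) < 4 ^ j" using real_arch_pow[of 4] by auto
  obtain G where G: "even_entire G" "\<And>u. F u = u ^ (2 * j) * G u" using ex[of j] by blast
  have "norm (G z) \<le> B / r ^ (2 * j)"
  proof (rule entire_bound_on_sphere[of G r _ z])
    show "G holomorphic_on UNIV" using G(1) by (simp add: even_entire_def)
    show "norm (G u) \<le> B / r ^ (2 * j)" if "norm u = r" for u
      using B(2)[OF that] r by (simp add: G(2) norm_mult norm_power that field_simps)
  qed (use r in \<open>auto simp: r_def\<close>)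
  then have "norm (F z) \<le> (norm z) ^ (2 * j) * (B / r ^ (2 * j))"
    by (simp only: G(2) norm_mult norm_power) (rule mult_left_mono, auto)
  also have "\<dots> = B * ((norm z / r) ^ 2) ^ j" by (simp add: power_divide flip: power_mult)
  also have "\<dots> \<le> B * (1 / 4) ^ j"
  proof -
    have "norm z / r \<le> 1 / 2" using r by (simp add: r_def field_simps)
    then have "(norm z / r)\<^sup>2 \<le> (1 / 2)\<^sup>2" using r by (intro power_mono) auto
    then show ?thesis using B(1) by (intro mult_left_mono power_mono) (auto simp: power2_eq_square)
  qed
  finally show False using j z by (simp add: field_simps)
qed

lemma strip_mult_power: "strip_mult h M \<Longrightarrow> strip_mult h (\<lambda>x. x ^ j * M x)"
proof (induction j)
  case (Suc j)
  have "strip_mult h (\<lambda>x. x ^ j * M x * (x - 0))" using Suc by (intro strip_mult.real) auto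
  then show ?case by (simp add: mult_ac)
qed simp

text \<open>Only the values at the \<open>n + 2\<close> sample points up to \<open>n + 3/2\<close>
  matter, and there finite products approximate \<open>F\<close> arbitrarily well, so closedness of
  \<open>osc\<close> finishes. A zero of order \<open>2 j\<close> at the origin counts as
  \<open>j\<close> real factors with \<open>s = 0\<close>.\<close>

lemma even_entire_osc:
  assumes F: "even_entire F" "real_fun F" "F \<noteq> (\<lambda>_. 0)" "zero_set F \<subseteq> strip h"
    and growth: "\<And>u. b \<le> norm u \<Longrightarrow> norm (F u) \<le> C * exp (norm u powr (3/2))"
    and \<sigma>: "\<sigma> = 1 \<or> \<sigma> = -1" and h: "0 \<le> h" "h\<^sup>2 \<le> strip_bound \<sigma>" and n: "0 < n"
  shows "osc n (n + 1) (\<lambda>k. Re (F (of_real (real k + 1/2))) * (edge_seq \<sigma> (n + 1) k + t * edge_seq \<sigma> n k))"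
proof -
  obtain G j where G: "even_entire G" "real_fun G" "\<And>u. F u = u ^ (2 * j) * G u" "G 0 \<noteq> 0"
    using even_entire_factor_zero[OF F(1-3)] by blast
  have zG: "zero_set G \<subseteq> strip h" using F(4) by (auto simp: zero_set_def G(3))
  have gG: "norm (G u) \<le> C * exp (norm u powr (3/2))" if "max b 1 \<le> norm u" for u
  proof -
    have "1 * norm (G u) \<le> norm u ^ (2 * j) * norm (G u)"
      using that by (intro mult_right_mono one_le_power) auto
    also have "\<dots> = norm (F u)" by (simp add: G(3) norm_mult norm_power)
    also have "\<dots> \<le> C * exp (norm u powr (3/2))" using that by (intro growth) simp
    finally show ?thesis by simp
  qed
  define e where "e k = edge_seq \<sigma> (n + 1) k + t * edge_seq \<sigma> n k" for k
  define f where "f k = node k ^ j * e k" for k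
  have Fk: "Re (F (of_real (real k + 1/2))) * e k = f k * Re (G (of_real (real k + 1/2)))" for k
  proof -
    have "complex_of_real (real k + 1/2) ^ (2 * j) = of_real (node k ^ j)"
      by (simp add: node_def power_mult)
    then show ?thesis by (simp add: G(3) f_def)
  qed
  show ?thesis unfolding e_def[symmetric] Fk
  proof (rule osc_closed)
    fix \<eta> :: real assume \<eta>: "0 < \<eta>"
    obtain c M where cM: "c \<noteq> 0" "strip_mult h M"
      "\<And>x. \<bar>x\<bar> \<le> real (n + 2) \<Longrightarrow> \<bar>Re (G (of_real x)) - c * M (x\<^sup>2)\<bar> < \<eta> / (1 + (\<Sum>i\<le>n+1. \<bar>f i\<bar>))"
      using even_entire_approx[OF G(1,2,4) zG gG small_bound_pos[OF \<eta>, where f = f and m = "n + 1"],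
          where K = "real (n + 2)"] by blast
    have "osc n (n + 1) (\<lambda>k. c * ((node k ^ j * M (node k)) * e k))"
      unfolding e_def using n
      by (intro keepsD[OF keeps_const[OF cM(1)]] osc_strip_mult[OF \<sigma> _ h strip_mult_power[OF cM(2)], of n "n - 1"]) simp
    moreover have "\<bar>c * ((node k ^ j * M (node k)) * e k) - f k * Re (G (of_real (real k + 1/2)))\<bar> < \<eta>"
      if k: "k \<le> n + 1" for k
    proof -
      have "\<bar>c * M (node k) - Re (G (of_real (real k + 1/2)))\<bar> < \<eta> / (1 + (\<Sum>i\<le>n+1. \<bar>f i\<bar>))"
        using cM(3)[of "real k + 1/2"] k by (simp add: node_def abs_minus_commute)
      from mult_small[OF \<eta> this k] show ?thesis by (simp add: f_def algebra_simps)
    qed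
    ultimately show "\<exists>c'. (\<forall>k\<le>n+1. \<bar>c' k - f k * Re (G (of_real (real k + 1/2)))\<bar> < \<eta>) \<and> osc n (n + 1) c'"
      by (intro exI[of _ "\<lambda>k. c * ((node k ^ j * M (node k)) * e k)"]) blast
  qed
qed

lemma entire_order_le_1_growth:
  assumes "entire_order F \<le> 1"
  obtains b C where "\<And>u. b \<le> norm u \<Longrightarrow> norm (F u) \<le> C * exp (norm u powr (3/2))"
proof -
  have "(\<lambda>u. norm (F u)) \<in> O[at_infinity](\<lambda>u. exp (norm u powr (1 + 1/2)))"
    using assms unfolding entire_order_le_1_iff by (elim allE[of _ "1/2"]) simp
  then obtain C where "\<forall>\<^sub>F u in at_infinity. norm (norm (F u)) \<le> C * norm (exp (norm u powr (1 + 1/2)))"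
    by (elim landau_o.bigE)
  then show ?thesis using that unfolding eventually_at_infinity by auto
qed

lemma quot_minus_pencil:
  assumes "F holomorphic_on UNIV" "F \<noteq> (\<lambda>_. 0)" "real_fun F" "entire_order F \<le> 1"
    "\<And>u. F (- u) = F u" "zero_set F \<subseteq> strip (sqrt (15 / 28))"
  shows "quot_minus F n \<preceq>\<^sub>O quot_minus F (n + 1)"
proof -
  obtain b C where "\<And>u. b \<le> norm u \<Longrightarrow> norm (F u) \<le> C * exp (norm u powr (3/2))"
    using entire_order_le_1_growth[OF assms(4)] by blast
  then show ?thesis
    using assms by (intro quot_minus_weak_obreschkoff even_entire_osc[where h = "sqrt (15 / 28)" and b = b and C = C])
      (auto simp: even_entire_def strip_bound_def)
qed

lemma quot_plus_pencil:
  assumes G: "G holomorphic_on UNIV" "G \<noteq> (\<lambda>_. 0)" "real_fun G" "entire_order G \<le> 1"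
    "\<And>u. G (- u) = - G u" "zero_set G \<subseteq> strip 1"
  shows "quot_plus G n \<preceq>\<^sub>O quot_plus G (n + 1)"
proof -
  obtain b C where gr: "\<And>u. b \<le> norm u \<Longrightarrow> norm (G u) \<le> C * exp (norm u powr (3/2))"
    using entire_order_le_1_growth[OF G(4)] by blast
  have "G 0 = 0" using G(5)[of 0] by simp
  then obtain F where F: "F holomorphic_on UNIV" "\<And>u. G u = (u - 0) * F u"
    using entire_divide_root[OF G(1)] by blast
  then have GF: "G u = u * F u" for u by simp
  have c: "continuous_on UNIV F" using F(1) by (rule holomorphic_imp_continuous_UNIV)
  have "F = (\<lambda>u. F (- u))"
  proof (rule continuous_cancel[OF c])
    show "continuous_on UNIV (\<lambda>u. F (- u))" by (intro continuous_intros continuous_on_compose2[OF c]) auto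
    show "u * F u = u * F (- u)" for u using G(5)[of u] by (auto simp: GF)
  qed simp
  then have "F u = F (- u)" for u by (rule fun_cong)
  then have ev: "even_entire F" using F(1) by (simp add: even_entire_def)
  have real: "real_fun F" by (rule real_fun_cancel[OF F(1) _ G(3) _ GF]) (auto simp: real_fun_def)
  have nz: "F \<noteq> (\<lambda>_. 0)" using G(2) GF by auto
  have zs: "zero_set F \<subseteq> strip 1" using G(6) by (auto simp: zero_set_def GF)
  have gF: "norm (F u) \<le> C * exp (norm u powr (3/2))" if "max b 1 \<le> norm u" for u
  proof -
    have "1 * norm (F u) \<le> norm u * norm (F u)" using that by (intro mult_right_mono) auto
    also have "\<dots> = norm (G u)" by (simp add: GF norm_mult)
    also have "\<dots> \<le> C * exp (norm u powr (3/2))" using that by (intro gr) simp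
    finally show ?thesis by simp
  qed
  show ?thesis
  proof (rule quot_plus_weak_obreschkoff[OF G(3,5) GF])
    fix t assume "0 < n"
    then show "osc n (n + 1)
        (\<lambda>k. Re (F (of_real (real k + 1/2))) * (edge_seq (-1) (n + 1) k + t * edge_seq (-1) n k))"
      using even_entire_osc[OF ev real nz zs _ _ _ _ \<open>0 < n\<close>, of "max b 1" C "-1" t] gF
      by (simp add: strip_bound_def)
  qed
qed

subsection \<open>Optimality of the strip constant\<close>

lemma quadratic_not_real_rooted:
  assumes "b\<^sup>2 < 4 * a * c"
  shows "[:c, b, a:] \<noteq> 0" "\<not> real_rooted [:c, b, a:]"
proof -
  have a: "a \<noteq> 0" using assms zero_le_power2[of b] by auto
  then show "[:c, b, a:] \<noteq> 0" by simp
  define d where "d = sqrt (4 * a * c - b\<^sup>2)"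
  have d: "0 < d" "d\<^sup>2 = 4 * a * c - b\<^sup>2" using assms by (simp_all add: d_def)
  define z where "z = Complex (- b / (2 * a)) (d / (2 * a))"
  have re: "c + (b * (- b / (2 * a)) + a * ((- b / (2 * a))\<^sup>2 - (d / (2 * a))\<^sup>2)) = 0"
    using a d(2) by (simp add: field_simps power2_eq_square) algebra
  have im: "b * (d / (2 * a)) + a * (2 * (- b / (2 * a)) * (d / (2 * a))) = 0"
    using a by (simp add: field_simps)
  have "poly (cpoly [:c, b, a:]) z = 0"
    using re im unfolding z_def by (simp add: complex_eq_iff power2_eq_square algebra_simps)
  moreover have "z \<notin> \<real>" using a d(1) by (simp add: complex_is_Real_iff z_def)
  ultimately show "\<not> real_rooted [:c, b, a:]" unfolding real_rooted_def by blast
qed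

text \<open>
  In the variable \<open>X = x + 2\<close> the pencil \<open>C\<^sub>2 + t C\<^sub>1\<close> of \<open>F(u) = u\<^sup>2 - s\<close> is
  \<open>a X\<^sup>2 + (t b - 20) X - 6 t\<close> with \<open>a = 25/4 - s\<close> and \<open>b = 9/4 - s\<close>. Its discriminant is
  minimal at \<open>t = (20 - 12 a/b) / b\<close>, where it is \<open>48 (a/b) (10 - 3 a/b)\<close>; this is negative
  exactly if \<open>s > 15/28\<close>.
\<close>

lemma quadratic_pencil_fails:
  assumes s: "15 / 28 < s" "s < 9 / 4"
  shows "\<not> quot_minus (poly (cpoly [:- s, 0, 1:])) 1 \<preceq>\<^sub>O quot_minus (poly (cpoly [:- s, 0, 1:])) 2"
proof -
  let ?F = "poly (cpoly [:- s, 0, 1:])"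
  define a where "a = 25 / 4 - s"
  define b where "b = 9 / 4 - s"
  define r where "r = a / b"
  define t where "t = (20 - 12 * r) / b"
  have b: "0 < b" using s by (simp add: b_def)
  have ar: "a = r * b" and tb: "t * b = 20 - 12 * r" using b by (simp_all add: r_def t_def)
  have r: "10 / 3 < r" using b s by (simp add: r_def field_simps a_def b_def)
  have F: "real_fun ?F" "\<And>u. ?F (- u) = ?F u" by (simp_all add: real_fun_def)
  have Fk: "Re (?F (of_real x)) = x\<^sup>2 - s" for x by (simp add: power2_eq_square)
  have C1: "quot_minus ?F 1 = [:2 * b - 6, b:]"
    unfolding quot_minus_sum[OF F] Fk hpoly_def edge_seq_even b_def
    by (simp add: eval_nat_numeral power2_eq_square field_simps)
  have C2: "quot_minus ?F 2 = [:4 * a - 40, 4 * a - 20, a:]"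
    unfolding quot_minus_sum[OF F] Fk hpoly_def edge_seq_even a_def
    by (simp add: one_pCons eval_nat_numeral power2_eq_square field_simps)
  define p where "p = [:4 * a - 40 + t * (2 * b - 6), 4 * a - 20 + t * b, a:]"
  have p: "quot_minus ?F 2 + smult t (quot_minus ?F 1) = p" unfolding C1 C2 p_def by simp
  have "(4 * a - 20 + t * b)\<^sup>2 - 4 * a * (4 * a - 40 + t * (2 * b - 6)) = (t * b - 20)\<^sup>2 + 24 * (a * t)"
    by (simp add: power2_eq_square algebra_simps)
  also have "a * t = r * (20 - 12 * r)" unfolding ar tb[symmetric] by simp
  also have "(t * b - 20)\<^sup>2 + 24 * (r * (20 - 12 * r)) = - (48 * r * (3 * r - 10))"
    unfolding tb by (simp add: power2_eq_square algebra_simps)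
  also have "\<dots> < 0"
  proof -
    have "0 < 48 * r" "0 < 3 * r - 10" using r by auto
    then have "0 < 48 * r * (3 * r - 10)" by (rule mult_pos_pos)
    then show ?thesis by simp
  qed
  finally have "(4 * a - 20 + t * b)\<^sup>2 < 4 * a * (4 * a - 40 + t * (2 * b - 6))" by simp
  from quadratic_not_real_rooted[OF this] have "p \<noteq> 0" "\<not> real_rooted p" unfolding p_def .
  then show ?thesis unfolding weak_obreschkoff_def p[symmetric] by blast
qed

theorem theorem1p1:
  shows "(\<forall>F. F holomorphic_on UNIV \<and> F \<noteq> (\<lambda>_. 0) \<and> real_fun F \<and> entire_order F \<le> 1
              \<and> (\<forall>u. F (- u) = F u) \<and> zero_set F \<subseteq> strip (sqrt (15 / 28))
            \<longrightarrow> (\<forall>n. quot_minus F n \<preceq>\<^sub>O quot_minus F (n + 1)))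
       \<and> (\<forall>\<epsilon>>0. \<exists>p :: real poly. p \<noteq> 0
              \<and> (\<forall>u. poly (cpoly p) (- u) = poly (cpoly p) u)
              \<and> zero_set (poly (cpoly p)) \<subseteq> strip (sqrt (15 / 28) + \<epsilon>)
              \<and> \<not> quot_minus (poly (cpoly p)) 1 \<preceq>\<^sub>O quot_minus (poly (cpoly p)) 2)
       \<and> (\<forall>G. G holomorphic_on UNIV \<and> G \<noteq> (\<lambda>_. 0) \<and> real_fun G \<and> entire_order G \<le> 1
              \<and> (\<forall>u. G (- u) = - G u) \<and> zero_set G \<subseteq> strip 1
            \<longrightarrow> (\<forall>n. quot_plus G n \<preceq>\<^sub>O quot_plus G (n + 1)))"
proof (intro conjI)
  show "\<forall>F. F holomorphic_on UNIV \<and> F \<noteq> (\<lambda>_. 0) \<and> real_fun F \<and> entire_order F \<le> 1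
              \<and> (\<forall>u. F (- u) = F u) \<and> zero_set F \<subseteq> strip (sqrt (15 / 28))
            \<longrightarrow> (\<forall>n. quot_minus F n \<preceq>\<^sub>O quot_minus F (n + 1))"
    using quot_minus_pencil by blast
  show "\<forall>G. G holomorphic_on UNIV \<and> G \<noteq> (\<lambda>_. 0) \<and> real_fun G \<and> entire_order G \<le> 1
              \<and> (\<forall>u. G (- u) = - G u) \<and> zero_set G \<subseteq> strip 1
            \<longrightarrow> (\<forall>n. quot_plus G n \<preceq>\<^sub>O quot_plus G (n + 1))"
    using quot_plus_pencil by blast
  show "\<forall>\<epsilon>>0. \<exists>p :: real poly. p \<noteq> 0
              \<and> (\<forall>u. poly (cpoly p) (- u) = poly (cpoly p) u)
              \<and> zero_set (poly (cpoly p)) \<subseteq> strip (sqrt (15 / 28) + \<epsilon>)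
              \<and> \<not> quot_minus (poly (cpoly p)) 1 \<preceq>\<^sub>O quot_minus (poly (cpoly p)) 2"
  proof (intro allI impI)
    fix \<epsilon> :: real assume \<epsilon>: "0 < \<epsilon>"
    \<comment> \<open>The cap 5/4 keeps the square of \<open>x\<close> below 9/4, as
      \<open>quadratic_pencil_fails\<close> requires, when \<epsilon> is large.\<close>
    define x where "x = min (sqrt (15 / 28) + \<epsilon>) (5 / 4)"
    have lt1: "sqrt (15 / 28) < 1" using real_sqrt_less_mono[of "15 / 28" 1] by simp
    have "sqrt (15 / 28) < x" unfolding x_def min_less_iff_conj using \<epsilon> lt1 by linarith
    moreover have "x \<le> sqrt (15 / 28) + \<epsilon>" "x \<le> 5 / 4" unfolding x_def by (rule min.cobounded1, rule min.cobounded2)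
    ultimately have x: "sqrt (15 / 28) < x" "x \<le> sqrt (15 / 28) + \<epsilon>" "x \<le> 5 / 4" by blast+
    then have x0: "0 < x" using real_sqrt_ge_zero[of "15 / 28"] by linarith
    have "(sqrt (15 / 28))\<^sup>2 < x\<^sup>2" using x(1) by (intro power_strict_mono) auto
    moreover have "x\<^sup>2 \<le> (5 / 4)\<^sup>2" using x x0 by (intro power_mono) auto
    ultimately have s: "15 / 28 < x\<^sup>2" "x\<^sup>2 < 9 / 4" by (simp_all add: power2_eq_square)
    have "zero_set (poly (cpoly [:- x\<^sup>2, 0, 1:])) \<subseteq> strip (sqrt (15 / 28) + \<epsilon>)"
    proof
      fix u assume "u \<in> zero_set (poly (cpoly [:- x\<^sup>2, 0, 1:]))"
      then have "u\<^sup>2 = (of_real x)\<^sup>2" by (simp add: zero_set_def power2_eq_square)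
      then have "u = of_real x \<or> u = - of_real x" by (simp only: power2_eq_iff)
      then show "u \<in> strip (sqrt (15 / 28) + \<epsilon>)" using x x0 by (auto simp: strip_def)
    qed
    then show "\<exists>p :: real poly. p \<noteq> 0
              \<and> (\<forall>u. poly (cpoly p) (- u) = poly (cpoly p) u)
              \<and> zero_set (poly (cpoly p)) \<subseteq> strip (sqrt (15 / 28) + \<epsilon>)
              \<and> \<not> quot_minus (poly (cpoly p)) 1 \<preceq>\<^sub>O quot_minus (poly (cpoly p)) 2"
      using quadratic_pencil_fails[OF s] by (intro exI[of _ "[:- x\<^sup>2, 0, 1:]"] conjI) simp_all
  qed
qed

end
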